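(* Consider an evolution system $\varphi^i_t=F^i(\varphi,\varphi_x,\dots)$, $i=1,\dots,n$, Hamiltonian with respect to a local field-theoretic Poisson bracket $\{\varphi^i(x),\varphi^j(y)\}=\sum_{k\ge0}B^{ij}_{(k)}(\varphi,\varphi_x,\dots)\delta^{(k)}(x-y)$. Let $\Lambda$ be a regular Hamiltonian family of $m$-phase solutions of this system. Let $(I^1,\dots,I^N)$, $I^\nu=\int P^\nu(\varphi,\varphi_x,\dots)dx$, be a complete Hamiltonian set of commuting first integrals of the system, with $P^\nu_t=Q^\nu_x$ by virtue of the system, and let $H=\int P_H(\varphi,\varphi_x,\dots)\,dx$ be the Hamiltonian function of the system. Then the Whitham system $$\langle P^\nu\rangle_T=\langle Q^\nu\rangle_X,\qquad \nu=1,\dots,N,$$ in the variables $U^\nu=\langle P^\nu\rangle$, is Hamiltonian with respect to the corresponding Dubrovin--Novikov bracket $$\{U^\nu(X),U^\mu(Y)\}_{\rm DN}=\langle A^{\nu\mu}_1\rangle({\bf U}(X))\,\delta'(X-Y)+\frac{\partial\langle Q^{\nu\mu}\rangle}{\partial U^\gamma}U^\gamma_X\,\delta(X-Y)$$ with the Hamiltonian function $H^{av}=\int_{-\infty}^{+\infty}\langle P_H\rangle({\bf U}(X))\,dX$, i.e. it coincides with $U^\nu_T=\{U^\nu(X),H^{av}\}_{\rm DN}$.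
   Context: Conventions. All functions are smooth; repeated indices are summed; $i,j=1,\dots,n$; $\alpha,\beta=1,\dots,m$; expressions $f(\varphi,\varphi_x,\dots)$ depend on finitely many derivatives. "Periodic" means $2\pi$-periodic in each $\theta^\alpha$. Integrals over $\theta$ are over $[0,2\pi]^m$ with measure $d^m\theta/(2\pi)^m$. $f(\Phi,k^\beta\Phi_{\theta^\beta},\dots)$ means that $\varphi_{lx}$ is replaced by $(k^\beta\partial_{\theta^\beta})^l\Phi$. $m$-phase family. $\Lambda$ is a smooth family of periodic functions $\Phi(\theta+\theta_0,{\bf U})$, ${\bf U}=(U^1,\dots,U^N)$, $\theta_0\in\mathbb{R}^m$, satisfying $\omega^\alpha({\bf U})\Phi^i_{\theta^\alpha}=F^i(\Phi,k^\beta({\bf U})\Phi_{\theta^\beta},\dots)$; the $m$-phase solutions are $\varphi^i(x,t)=\Phi^i({\bf k}({\bf U})x+\omega({\bf U})t+\theta_0,{\bf U})$. $\hat L=\hat L_{[{\bf U},\theta_0]}$ is the linearization, on periodic functions, of $\omega^\alpha\varphi^i_{\theta^\alpha}-F^i(\varphi,k^\beta\varphi_{\theta^\beta},\dots)$ at $\Phi(\theta+\theta_0,{\bf U})$; left eigenvectors with zero eigenvalue are kernel vectors of the adjoint operator. Complete regular family: (1) the $k^\alpha,\omega^\alpha$ are independent parameters on $\Lambda$, so that parameters can be written $({\bf k},\omega,{\bf n})$, ${\bf n}=(n^1,\dots,n^s)$, $N=2m+s$; (2) $\Phi_{\theta^\alpha},\Phi_{n^l}$ are linearly independent and form a maximal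 linearly independent set among kernel vectors of $\hat L$ depending smoothly on $({\bf k},\omega,{\bf n})$ on the whole parameter set; (3) $\hat L$ has exactly $m+s$ linearly independent left eigenvectors with zero eigenvalue among those depending smoothly on the parameters on the whole parameter set. Regular Hamiltonian family: a complete regular family on which the bracket has a constant number of annihilators $N^1,\dots,N^s$ with linearly independent variational derivatives $\delta N^l/\delta\varphi^i(x)$, equal to the number of independent annihilators in a neighborhood of $\Lambda$ (this number on $\Lambda$ is identified with the number of linearly independent quasiperiodic solutions $v_j(x)$, with the same quasiperiods as $\varphi(x)=\Phi({\bf k}x+\theta_0,{\bf U})$, of $\sum_kB^{ij}_{(k)}|_\Lambda v_{j,kx}=0$). Averages: $\langle f\rangle({\bf U})=\int f(\Phi,k^\beta\Phi_{\theta^\beta},\dots)\,d^m\theta/(2\pi)^m$; the value of $I^\nu$ on $\Lambda$ is $\langle P^\nu\rangle$. Complete Hamiltonian set: functionals with $\{I^\nu,H\}=0$, $\{I^\nu,I^\mu\}=0$ such that (1) their values on $\Lambda$ give a complete set of parameters $(U^1,\dots,U^N)$ (the Jacobian of $({\bf k},\omega,{\bf n})\mapsto{\bf U}$ is nonzero); (2) the flows $\varphi^i_{t^\nu}=\{\varphi^i,I^\nu\}$ generate on $\Lambda$ linear shifts of $\theta_0$ with frequencies $\omega^{\alpha\nu}({\bf U})$, $\mathrm{rank}\,\|\omega^{\alpha\nu}\|=m$; (3) on $\Lambda$, $\delta N^l/\delta\varphi^i(x)=\sum_\nu\gamma^l_\nu({\bf U})\,\delta I^\nu/\delta\varphi^i(x)$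 for smooth $\gamma^l_\nu$ and all annihilators $N^l$. Dubrovin--Novikov data: $\{P^\nu(x),P^\mu(y)\}=\sum_{k\ge0}A^{\nu\mu}_k(\varphi,\varphi_x,\dots)\delta^{(k)}(x-y)$ with $A^{\nu\mu}_0=\partial_xQ^{\nu\mu}(\varphi,\varphi_x,\dots)$. *)

theory Defs
  imports "HOL-Analysis.Analysis"
begin

section \<open>Smooth functions and functions of finitely many derivatives\<close>

primrec higher_differentiable_on ::
  "'a::real_normed_vector set \<Rightarrow> ('a \<Rightarrow> 'b::real_normed_vector) \<Rightarrow> nat \<Rightarrow> bool" where
  "higher_differentiable_on S f 0 \<longleftrightarrow> continuous_on S f"
| "higher_differentiable_on S f (Suc r) \<longleftrightarrow>
     (\<forall>x\<in>S. f differentiable (at x)) \<and>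
     (\<forall>v. higher_differentiable_on S (\<lambda>x. frechet_derivative f (at x) v) r)"

text \<open>Only used for open \<open>S\<close>.\<close>

definition smooth_on :: "'a::real_normed_vector set \<Rightarrow> ('a \<Rightarrow> 'b::real_normed_vector) \<Rightarrow> bool" where
  "smooth_on S f \<longleftrightarrow> (\<forall>r. higher_differentiable_on S f r)"

text \<open>
  \<open>dird \<kappa> g\<close> is \<open>\<kappa>\<^sup>\<alpha> \<partial>g/\<partial>\<theta>\<^sup>\<alpha>\<close>. All operators below are written for a direction \<open>\<kappa>\<close> in the space
  of arguments, so that they serve both for fields on the line
  (argument \<open>x :: real\<close>, \<open>\<kappa> = 1\<close>, \<open>dird 1 = \<partial>\<^sub>x\<close>) and for functions on the torus, where \<open>\<partial>\<^sub>x\<close> is replaced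
  by \<open>k\<^sup>\<beta> \<partial>/\<partial>\<theta>\<^sup>\<beta>\<close> (argument \<open>\<theta> :: real ^ 'm\<close>, \<open>\<kappa> = k\<close>).
\<close>

definition dird :: "'a::real_normed_vector \<Rightarrow> ('a \<Rightarrow> 'b::real_normed_vector) \<Rightarrow> 'a \<Rightarrow> 'b" where
  "dird \<kappa> g x = vector_derivative (\<lambda>h. g (x + h *\<^sub>R \<kappa>)) (at 0)"

text \<open>In a jet \<open>u\<close>, the component \<open>u l $ i\<close> stands for the \<open>l\<close>-th \<open>x\<close>-derivative of \<open>\<phi>\<^sup>i\<close>.\<close>

type_synonym 'n jet = "nat \<Rightarrow> real ^ 'n"

definition jet :: "'a::real_normed_vector \<Rightarrow> ('a \<Rightarrow> real ^ 'n) \<Rightarrow> 'a \<Rightarrow> 'n jet" where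
  "jet \<kappa> \<psi> x l = (dird \<kappa> ^^ l) \<psi> x"

definition pd :: "nat \<Rightarrow> 'n::finite \<Rightarrow> ('n jet \<Rightarrow> 'b::real_normed_vector) \<Rightarrow> 'n jet \<Rightarrow> 'b" where
  "pd l i f u = vector_derivative (\<lambda>h. f (u(l := u l + h *\<^sub>R axis i 1))) (at 0)"

text \<open>
  Smooth functions \<open>f(\<phi>, \<phi>\<^sub>x, \<dots>)\<close>: finitely many derivatives enter, and all iterated partial
  derivatives exist and are continuous.
\<close>

definition diff_fun :: "('n::finite jet \<Rightarrow> 'b::real_normed_vector) \<Rightarrow> bool" where
  "diff_fun f \<longleftrightarrow>
     (\<exists>K. \<forall>u v. (\<forall>l\<le>K. u l = v l) \<longrightarrow> f u = f v) \<and>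
     (\<forall>ds. let g = foldr (\<lambda>(l, i). pd l i) ds f in
        continuous_on UNIV g \<and>
        (\<forall>u l i. (\<lambda>h::real. g (u(l := u l + h *\<^sub>R axis i 1))) differentiable (at 0)))"

text \<open>
  Linearization of \<open>f(\<psi>, \<psi>\<^sub>x, \<dots>)\<close> at \<open>\<psi>\<close> in the direction \<open>\<eta>\<close>, and its formal adjoint. The series
  over \<open>l\<close> have only finitely many nonzero terms when \<open>f\<close> is a
  smooth function of finitely many derivatives.
\<close>

definition lin ::
  "'a::real_normed_vector \<Rightarrow> ('n::finite jet \<Rightarrow> 'b::real_normed_vector)
    \<Rightarrow> ('a \<Rightarrow> real ^ 'n) \<Rightarrow> ('a \<Rightarrow> real ^ 'n) \<Rightarrow> 'a \<Rightarrow> 'b" where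
  "lin \<kappa> f \<psi> \<eta> x = (\<Sum>l. \<Sum>i\<in>UNIV. ((dird \<kappa> ^^ l) \<eta> x $ i) *\<^sub>R pd l i f (jet \<kappa> \<psi> x))"

definition lin_adj ::
  "'a::real_normed_vector \<Rightarrow> ('n::finite jet \<Rightarrow> 'b::real_inner)
    \<Rightarrow> ('a \<Rightarrow> real ^ 'n) \<Rightarrow> ('a \<Rightarrow> 'b) \<Rightarrow> 'a \<Rightarrow> real ^ 'n" where
  "lin_adj \<kappa> f \<psi> \<xi> x =
     (\<Sum>l. (- 1) ^ l *\<^sub>R (dird \<kappa> ^^ l) (\<lambda>y. \<chi> i. pd l i f (jet \<kappa> \<psi> y) \<bullet> \<xi> y) x)"

text \<open>The variational derivative of \<open>\<integral> P(\<phi>, \<phi>\<^sub>x, \<dots>) dx\<close>: \<open>\<Sum>\<^sub>l (-\<partial>\<^sub>x)\<^sup>l (\<partial>P/\<partial>\<phi>\<^sup>i\<^sub>l\<^sub>x)\<close>.\<close>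

definition var_deriv ::
  "'a::real_normed_vector \<Rightarrow> ('n::finite jet \<Rightarrow> real) \<Rightarrow> ('a \<Rightarrow> real ^ 'n) \<Rightarrow> 'a \<Rightarrow> real ^ 'n" where
  "var_deriv \<kappa> P \<psi> = lin_adj \<kappa> P \<psi> (\<lambda>_. 1)"


section \<open>Local Poisson brackets\<close>

text \<open>
  A bracket \<open>{\<phi>\<^sup>i(x), \<phi>\<^sup>j(y)} = \<Sum>\<^sub>k B\<^sup>i\<^sup>j\<^sub>(\<^sub>k\<^sub>) \<delta>\<^sup>(\<^sup>k\<^sup>)(x - y)\<close> is given by its matrix coefficients
  \<open>B k\<close>; integrating the second argument against \<open>\<xi>\<^sub>j(y)\<close> gives the operator \<open>ham_op\<close>.
\<close>

type_synonym 'n coeffs = "nat \<Rightarrow> 'n jet \<Rightarrow> real ^ 'n ^ 'n"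

definition ham_op ::
  "'a::real_normed_vector \<Rightarrow> 'n::finite coeffs
    \<Rightarrow> ('a \<Rightarrow> real ^ 'n) \<Rightarrow> ('a \<Rightarrow> real ^ 'n) \<Rightarrow> 'a \<Rightarrow> real ^ 'n" where
  "ham_op \<kappa> B \<psi> \<xi> x = (\<Sum>k. B k (jet \<kappa> \<psi> x) *v (dird \<kappa> ^^ k) \<xi> x)"

text \<open>The right-hand side \<open>{\<phi>\<^sup>i, H}\<close> of the flow generated by \<open>H = \<integral> P(\<phi>, \<phi>\<^sub>x, \<dots>) dx\<close>.\<close>

definition ham_flow ::
  "'a::real_normed_vector \<Rightarrow> 'n::finite coeffs \<Rightarrow> ('n jet \<Rightarrow> real)
    \<Rightarrow> ('a \<Rightarrow> real ^ 'n) \<Rightarrow> 'a \<Rightarrow> real ^ 'n" where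
  "ham_flow \<kappa> B P \<psi> = ham_op \<kappa> B \<psi> (var_deriv \<kappa> P \<psi>)"

definition test_fun :: "(real \<Rightarrow> real ^ 'n) \<Rightarrow> bool" where
  "test_fun p \<longleftrightarrow> smooth_on UNIV p \<and> (\<exists>R. \<forall>x. \<bar>x\<bar> > R \<longrightarrow> p x = 0)"

text \<open>
  With \<open>\<phi>[p] = \<integral> p\<^sub>i(x) \<phi>\<^sup>i(x) dx\<close>, the first definition is \<open>{\<phi>[p], \<phi>[q]}\<close> and the second one is
  \<open>{{\<phi>[p], \<phi>[q]}, \<phi>[r]}\<close>; the latter is the derivative of the functional \<open>{\<phi>[p], \<phi>[q]}\<close> along
  \<open>{\<phi>\<^sup>i(x), \<phi>[r]}\<close>.
\<close>

definition smeared_bracket ::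
  "'n::finite coeffs \<Rightarrow> (real \<Rightarrow> real ^ 'n) \<Rightarrow> (real \<Rightarrow> real ^ 'n) \<Rightarrow> (real \<Rightarrow> real ^ 'n) \<Rightarrow> real" where
  "smeared_bracket B \<phi> p q = integral UNIV (\<lambda>x. p x \<bullet> ham_op 1 B \<phi> q x)"

definition smeared_bracket2 ::
  "'n::finite coeffs \<Rightarrow> (real \<Rightarrow> real ^ 'n) \<Rightarrow> (real \<Rightarrow> real ^ 'n) \<Rightarrow> (real \<Rightarrow> real ^ 'n)
    \<Rightarrow> (real \<Rightarrow> real ^ 'n) \<Rightarrow> real" where
  "smeared_bracket2 B \<phi> p q r =
     deriv (\<lambda>\<epsilon>. smeared_bracket B (\<lambda>x. \<phi> x + \<epsilon> *\<^sub>R ham_op 1 B \<phi> r x) p q) 0"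

definition local_poisson_bracket :: "'n::finite coeffs \<Rightarrow> bool" where
  "local_poisson_bracket B \<longleftrightarrow>
     (\<forall>k. diff_fun (B k)) \<and> (\<exists>K. \<forall>k>K. \<forall>u. B k u = 0) \<and>
     (\<forall>\<phi> p q. smooth_on UNIV \<phi> \<and> test_fun p \<and> test_fun q \<longrightarrow>
        smeared_bracket B \<phi> p q = - smeared_bracket B \<phi> q p) \<and>
     (\<forall>\<phi> p q r. smooth_on UNIV \<phi> \<and> test_fun p \<and> test_fun q \<and> test_fun r \<longrightarrow>
        smeared_bracket2 B \<phi> p q r + smeared_bracket2 B \<phi> q r p + smeared_bracket2 B \<phi> r p q = 0)"

definition hamiltonian_system ::
  "'n::finite coeffs \<Rightarrow> ('n jet \<Rightarrow> real) \<Rightarrow> ('n jet \<Rightarrow> real ^ 'n) \<Rightarrow> bool" where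
  "hamiltonian_system B P_H F \<longleftrightarrow> diff_fun P_H \<and> diff_fun F \<and>
     (\<forall>(\<phi> :: real \<Rightarrow> real ^ 'n) x. smooth_on UNIV \<phi> \<longrightarrow> F (jet 1 \<phi> x) = ham_flow 1 B P_H \<phi> x)"

text \<open>\<open>P\<^sub>t = Q\<^sub>x\<close> by virtue of \<open>\<phi>\<^sub>t = F\<close>.\<close>

definition conservation_law ::
  "('n::finite jet \<Rightarrow> real ^ 'n) \<Rightarrow> ('n jet \<Rightarrow> real) \<Rightarrow> ('n jet \<Rightarrow> real) \<Rightarrow> bool" where
  "conservation_law F P Q \<longleftrightarrow> diff_fun P \<and> diff_fun Q \<and>
     (\<forall>(\<phi> :: real \<Rightarrow> real ^ 'n) x. smooth_on UNIV \<phi> \<longrightarrow>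
        lin 1 P \<phi> (\<lambda>y. F (jet 1 \<phi> y)) x = dird 1 (\<lambda>y. Q (jet 1 \<phi> y)) x)"

text \<open>
  \<open>{\<integral> P dx, \<integral> R dx} = \<integral> (\<delta>P/\<delta>\<phi>\<^sup>i) B\<^sup>i\<^sup>j (\<delta>R/\<delta>\<phi>\<^sup>j) dx = 0\<close>, where a functional \<open>\<integral> f(\<phi>, \<phi>\<^sub>x, \<dots>) dx\<close> vanishes
  when its density is a total \<open>x\<close>-derivative.
\<close>

definition in_involution ::
  "'n::finite coeffs \<Rightarrow> ('n jet \<Rightarrow> real) \<Rightarrow> ('n jet \<Rightarrow> real) \<Rightarrow> bool" where
  "in_involution B P R \<longleftrightarrow> (\<exists>J. diff_fun J \<and>
     (\<forall>(\<phi> :: real \<Rightarrow> real ^ 'n) x. smooth_on UNIV \<phi> \<longrightarrow>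
        var_deriv 1 P \<phi> x \<bullet> ham_flow 1 B R \<phi> x = dird 1 (\<lambda>y. J (jet 1 \<phi> y)) x))"

text \<open>
  \<open>{P(x), R(y)} = \<Sum>\<^sub>k A\<^sub>k(\<phi>, \<phi>\<^sub>x, \<dots>) \<delta>\<^sup>(\<^sup>k\<^sup>)(x - y)\<close>, integrated against a function \<open>g(y)\<close>:
  \<open>lin_adj 1 R \<phi> g\<close> is the variational derivative of \<open>\<integral> g(y) R(\<phi>, \<phi>\<^sub>y, \<dots>) dy\<close>.
\<close>

definition density_bracket ::
  "'n::finite coeffs \<Rightarrow> ('n jet \<Rightarrow> real) \<Rightarrow> ('n jet \<Rightarrow> real) \<Rightarrow> (nat \<Rightarrow> 'n jet \<Rightarrow> real) \<Rightarrow> bool" where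
  "density_bracket B P R A \<longleftrightarrow>
     (\<forall>k. diff_fun (A k)) \<and> (\<exists>K. \<forall>k>K. \<forall>u. A k u = 0) \<and>
     (\<forall>(\<phi> :: real \<Rightarrow> real ^ 'n) g x. smooth_on UNIV \<phi> \<and> smooth_on UNIV g \<longrightarrow>
        lin 1 P \<phi> (ham_op 1 B \<phi> (lin_adj 1 R \<phi> g)) x
          = (\<Sum>k. A k (jet 1 \<phi> x) * (dird 1 ^^ k) g x))"

definition dubrovin_novikov_data ::
  "'n::finite coeffs \<Rightarrow> ('N \<Rightarrow> 'n jet \<Rightarrow> real)
    \<Rightarrow> (nat \<Rightarrow> 'N \<Rightarrow> 'N \<Rightarrow> 'n jet \<Rightarrow> real) \<Rightarrow> ('N \<Rightarrow> 'N \<Rightarrow> 'n jet \<Rightarrow> real) \<Rightarrow> bool" where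
  "dubrovin_novikov_data B P A QQ \<longleftrightarrow>
     (\<forall>\<nu> \<mu>. density_bracket B (P \<nu>) (P \<mu>) (\<lambda>k. A k \<nu> \<mu>) \<and> diff_fun (QQ \<nu> \<mu>) \<and>
        (\<forall>(\<phi> :: real \<Rightarrow> real ^ 'n) x. smooth_on UNIV \<phi> \<longrightarrow>
           A 0 \<nu> \<mu> (jet 1 \<phi> x) = dird 1 (\<lambda>y. QQ \<nu> \<mu> (jet 1 \<phi> y)) x))"


section \<open>Families of m-phase solutions\<close>

definition periodic :: "(real ^ 'm::finite \<Rightarrow> 'b) \<Rightarrow> bool" where
  "periodic g \<longleftrightarrow> (\<forall>\<theta> \<alpha>. g (\<theta> + (2 * pi) *\<^sub>R axis \<alpha> 1) = g \<theta>)"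

definition torus_mean :: "(real ^ 'm::finite \<Rightarrow> real) \<Rightarrow> real" where
  "torus_mean g = integral (cbox 0 (\<chi> \<alpha>. 2 * pi)) g / (2 * pi) ^ CARD('m)"

text \<open>
  The parameters \<open>(k, \<omega>, n)\<close> are the components of a vector \<open>p :: real ^ 'N\<close>; the bijection \<open>\<iota>\<close>
  says which component is which, so that \<open>N = 2m + s\<close>. The number \<open>s\<close> may be zero, hence it
  is not the cardinality of a type.
\<close>

type_synonym ('m, 'N) labels = "'m + 'm + nat \<Rightarrow> 'N"

definition parameter_labels :: "('m::finite, 'N::finite) labels \<Rightarrow> nat \<Rightarrow> bool" where
  "parameter_labels \<iota> s \<longleftrightarrow> bij_betw \<iota> (UNIV <+> UNIV <+> {..<s}) UNIV"

definition wave_numbers :: "('m::finite, 'N::finite) labels \<Rightarrow> real ^ 'N \<Rightarrow> real ^ 'm" where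
  "wave_numbers \<iota> p = (\<chi> \<alpha>. p $ \<iota> (Inl \<alpha>))"

definition frequencies :: "('m::finite, 'N::finite) labels \<Rightarrow> real ^ 'N \<Rightarrow> real ^ 'm" where
  "frequencies \<iota> p = (\<chi> \<alpha>. p $ \<iota> (Inr (Inl \<alpha>)))"

type_synonym ('m, 'N, 'n) family = "real ^ 'm \<Rightarrow> real ^ 'N \<Rightarrow> real ^ 'n"

text \<open>\<open>W\<close> is the set of values of the parameters.\<close>

definition smooth_family ::
  "(real ^ 'N::finite) set \<Rightarrow> ('m::finite, 'N, 'n::finite) family \<Rightarrow> bool" where
  "smooth_family W \<psi> \<longleftrightarrow>
     smooth_on (UNIV \<times> W) (\<lambda>(\<theta>, p). \<psi> \<theta> p) \<and> (\<forall>p\<in>W. periodic (\<lambda>\<theta>. \<psi> \<theta> p))"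

definition m_phase_family ::
  "('n::finite jet \<Rightarrow> real ^ 'n) \<Rightarrow> ('m::finite, 'N::finite) labels \<Rightarrow> (real ^ 'N) set
    \<Rightarrow> ('m, 'N, 'n) family \<Rightarrow> bool" where
  "m_phase_family F \<iota> W \<Phi> \<longleftrightarrow> open W \<and> smooth_family W \<Phi> \<and>
     (\<forall>p\<in>W. \<forall>\<theta>. dird (frequencies \<iota> p) (\<lambda>\<theta>. \<Phi> \<theta> p) \<theta>
        = F (jet (wave_numbers \<iota> p) (\<lambda>\<theta>. \<Phi> \<theta> p) \<theta>))"

text \<open>
  \<open>\<Psi>\<close> is the periodic function at which the linearization is taken. Shifting \<open>\<Psi>\<close> by \<open>\<theta>\<^sub>0\<close> shifts
  the kernels by \<open>\<theta>\<^sub>0\<close>, so the conditions on the kernels are imposed at \<open>\<theta>\<^sub>0 = 0\<close>.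
\<close>

definition Lhat ::
  "('n::finite jet \<Rightarrow> real ^ 'n) \<Rightarrow> real ^ 'm::finite \<Rightarrow> real ^ 'm
    \<Rightarrow> (real ^ 'm \<Rightarrow> real ^ 'n) \<Rightarrow> (real ^ 'm \<Rightarrow> real ^ 'n) \<Rightarrow> real ^ 'm \<Rightarrow> real ^ 'n" where
  "Lhat F k \<omega> \<Psi> \<psi> \<theta> = dird \<omega> \<psi> \<theta> - lin k F \<Psi> \<psi> \<theta>"

definition Lhat_adj ::
  "('n::finite jet \<Rightarrow> real ^ 'n) \<Rightarrow> real ^ 'm::finite \<Rightarrow> real ^ 'm
    \<Rightarrow> (real ^ 'm \<Rightarrow> real ^ 'n) \<Rightarrow> (real ^ 'm \<Rightarrow> real ^ 'n) \<Rightarrow> real ^ 'm \<Rightarrow> real ^ 'n" where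
  "Lhat_adj F k \<omega> \<Psi> \<kappa> \<theta> = - dird \<omega> \<kappa> \<theta> - lin_adj k F \<Psi> \<kappa> \<theta>"

definition kernel_families ::
  "('n::finite jet \<Rightarrow> real ^ 'n) \<Rightarrow> ('m::finite, 'N::finite) labels \<Rightarrow> (real ^ 'N) set
    \<Rightarrow> ('m, 'N, 'n) family \<Rightarrow> ('m, 'N, 'n) family set" where
  "kernel_families F \<iota> W \<Phi> = {\<psi>. smooth_family W \<psi> \<and>
     (\<forall>p\<in>W. \<forall>\<theta>. Lhat F (wave_numbers \<iota> p) (frequencies \<iota> p) (\<lambda>\<theta>. \<Phi> \<theta> p) (\<lambda>\<theta>. \<psi> \<theta> p) \<theta> = 0)}"

definition left_kernel_families ::
  "('n::finite jet \<Rightarrow> real ^ 'n) \<Rightarrow> ('m::finite, 'N::finite) labels \<Rightarrow> (real ^ 'N) set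
    \<Rightarrow> ('m, 'N, 'n) family \<Rightarrow> ('m, 'N, 'n) family set" where
  "left_kernel_families F \<iota> W \<Phi> = {\<psi>. smooth_family W \<psi> \<and>
     (\<forall>p\<in>W. \<forall>\<theta>. Lhat_adj F (wave_numbers \<iota> p) (frequencies \<iota> p) (\<lambda>\<theta>. \<Phi> \<theta> p) (\<lambda>\<theta>. \<psi> \<theta> p) \<theta> = 0)}"

definition fun_basis :: "'a set \<Rightarrow> ('a \<Rightarrow> 'x \<Rightarrow> 'v::real_vector) \<Rightarrow> ('x \<Rightarrow> 'v) set \<Rightarrow> bool" where
  "fun_basis I e S \<longleftrightarrow> e ` I \<subseteq> S \<and>
     (\<forall>c. (\<forall>x. (\<Sum>a\<in>I. c a *\<^sub>R e a x) = 0) \<longrightarrow> (\<forall>a\<in>I. c a = 0)) \<and>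
     (\<forall>v\<in>S. \<exists>c. \<forall>x. v x = (\<Sum>a\<in>I. c a *\<^sub>R e a x))"

text \<open>
  Families that are linearly independent for every value of the parameters, and such that every
  family in \<open>S\<close> is, for every value of the parameters, a linear combination of them.
\<close>

definition family_basis ::
  "(real ^ 'N::finite) set \<Rightarrow> 'a set \<Rightarrow> ('a \<Rightarrow> ('m::finite, 'N, 'n::finite) family) \<Rightarrow> ('m, 'N, 'n) family set \<Rightarrow> bool" where
  "family_basis W I e S \<longleftrightarrow> e ` I \<subseteq> S \<and>
     (\<forall>p\<in>W. fun_basis I (\<lambda>a \<theta>. e a \<theta> p) {\<lambda>\<theta>. \<psi> \<theta> p | \<psi>. \<psi> \<in> S})"

text \<open>The functions \<open>\<Phi>\<^sub>\<theta>\<^sub>\<alpha>\<close> (label \<open>Inl \<alpha>\<close>) and \<open>\<Phi>\<^sub>n\<^sub>l\<close> (label \<open>Inr l\<close>).\<close>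

definition tangent_family ::
  "('m::finite, 'N::finite) labels \<Rightarrow> ('m, 'N, 'n::finite) family
    \<Rightarrow> 'm + nat \<Rightarrow> ('m, 'N, 'n) family" where
  "tangent_family \<iota> \<Phi> a \<theta> p = (case a of
      Inl \<alpha> \<Rightarrow> dird (axis \<alpha> 1) (\<lambda>\<theta>. \<Phi> \<theta> p) \<theta>
    | Inr l \<Rightarrow> dird (axis (\<iota> (Inr (Inr l))) 1) (\<lambda>p. \<Phi> \<theta> p) p)"

definition complete_regular_family ::
  "('n::finite jet \<Rightarrow> real ^ 'n) \<Rightarrow> ('m::finite, 'N::finite) labels \<Rightarrow> nat \<Rightarrow> (real ^ 'N) set
    \<Rightarrow> ('m, 'N, 'n) family \<Rightarrow> bool" where
  "complete_regular_family F \<iota> s W \<Phi> \<longleftrightarrow>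
     m_phase_family F \<iota> W \<Phi> \<and>
     parameter_labels \<iota> s \<and>
     family_basis W (UNIV <+> {..<s}) (tangent_family \<iota> \<Phi>) (kernel_families F \<iota> W \<Phi>) \<and>
     (\<exists>\<kappa>. family_basis W {..<CARD('m) + s} \<kappa> (left_kernel_families F \<iota> W \<Phi>))"


section \<open>Annihilators and complete sets of commuting integrals\<close>

text \<open>
  Annihilators need not be integrals of local densities. A quasiperiodic field \<open>\<Psi>(k x)\<close> is given
  by the pair \<open>(k, \<Psi>)\<close>, and a functional by its mean value \<open>N k \<Psi>\<close> per unit length, which is
  \<open>torus_mean (\<lambda>\<theta>. f (jet k \<Psi> \<theta>))\<close> for a local density \<open>f\<close>. Its variational derivative at the
  field is the function \<open>x \<mapsto> dN k \<Psi> (k x)\<close>. Sets of fields are neighbourhoods with respect to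
  finitely many derivatives, uniformly in \<open>\<theta>\<close>.
\<close>

type_synonym ('m, 'n) qp_field = "(real ^ 'm) \<times> (real ^ 'm \<Rightarrow> real ^ 'n)"
type_synonym ('m, 'n) qp_functional = "real ^ 'm \<Rightarrow> (real ^ 'm \<Rightarrow> real ^ 'n) \<Rightarrow> real"
type_synonym ('m, 'n) qp_covector =
  "real ^ 'm \<Rightarrow> (real ^ 'm \<Rightarrow> real ^ 'n) \<Rightarrow> real ^ 'm \<Rightarrow> real ^ 'n"

definition neighbourhood_of_family ::
  "('m::finite, 'N::finite) labels \<Rightarrow> (real ^ 'N) set \<Rightarrow> ('m, 'N, 'n::finite) family
    \<Rightarrow> ('m, 'n) qp_field set \<Rightarrow> bool" where
  "neighbourhood_of_family \<iota> W \<Phi> \<V> \<longleftrightarrow>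
     (\<forall>(k, \<Psi>)\<in>\<V>. smooth_on UNIV \<Psi> \<and> periodic \<Psi>) \<and>
     (\<forall>p\<in>W. \<forall>\<theta>\<^sub>0. \<exists>r. \<exists>\<delta>>0. \<forall>k \<Psi>.
        smooth_on UNIV \<Psi> \<and> periodic \<Psi> \<and> norm (k - wave_numbers \<iota> p) < \<delta> \<and>
        (\<forall>\<alpha>s. length \<alpha>s \<le> r \<longrightarrow>
          (\<forall>\<theta>. norm (foldr (\<lambda>\<alpha>. dird (axis \<alpha> 1)) \<alpha>s (\<lambda>\<theta>. \<Psi> \<theta> - \<Phi> (\<theta> + \<theta>\<^sub>0) p) \<theta>) < \<delta>))
        \<longrightarrow> (k, \<Psi>) \<in> \<V>)"

definition annihilator_on ::
  "'n::finite coeffs \<Rightarrow> ('m::finite, 'n) qp_field set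
    \<Rightarrow> ('m, 'n) qp_functional \<Rightarrow> ('m, 'n) qp_covector \<Rightarrow> bool" where
  "annihilator_on B \<V> N dN \<longleftrightarrow> (\<forall>(k, \<Psi>)\<in>\<V>.
     smooth_on UNIV (dN k \<Psi>) \<and> periodic (dN k \<Psi>) \<and>
     (\<forall>\<eta>. smooth_on UNIV \<eta> \<and> periodic \<eta> \<longrightarrow>
        ((\<lambda>\<epsilon>. N k (\<lambda>\<theta>. \<Psi> \<theta> + \<epsilon> *\<^sub>R \<eta> \<theta>)) has_real_derivative
           torus_mean (\<lambda>\<theta>. dN k \<Psi> \<theta> \<bullet> \<eta> \<theta>)) (at 0)) \<and>
     (\<forall>\<theta>. ham_op k B \<Psi> (dN k \<Psi>) \<theta> = 0))"

text \<open>
  Solutions \<open>v(x)\<close>, with the quasiperiods of \<open>\<phi>(x) = \<Psi>(k x)\<close>, of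
  \<open>\<Sum>\<^sub>k B\<^sup>i\<^sup>j\<^sub>(\<^sub>k\<^sub>)(\<phi>, \<phi>\<^sub>x, \<dots>) v\<^sub>j\<^sub>,\<^sub>k\<^sub>x = 0\<close>. These are functions on the line, not on the torus: for
  rationally dependent \<open>k\<close> different functions on the torus may restrict to the same \<open>v\<close>.
\<close>

definition qp_kernel ::
  "'n::finite coeffs \<Rightarrow> real ^ 'm::finite \<Rightarrow> (real ^ 'm \<Rightarrow> real ^ 'n) \<Rightarrow> (real \<Rightarrow> real ^ 'n) set" where
  "qp_kernel B k \<Psi> = {v. (\<exists>V. smooth_on UNIV V \<and> periodic V \<and> (\<forall>x. v x = V (x *\<^sub>R k))) \<and>
     (\<forall>x. ham_op 1 B (\<lambda>y. \<Psi> (y *\<^sub>R k)) v x = 0)}"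

text \<open>
  On \<open>\<Lambda>\<close> the variational derivatives of the \<open>s\<close> annihilators form a basis of \<open>qp_kernel\<close>: they are
  linearly independent, and their number is the number of quasiperiodic solutions. There are then
  no further annihilators near \<open>\<Lambda>\<close> that are independent of these on \<open>\<Lambda>\<close>, since the variational
  derivative of any annihilator lies in \<open>qp_kernel\<close>.
\<close>

definition regular_hamiltonian_family ::
  "'n::finite coeffs \<Rightarrow> ('n jet \<Rightarrow> real ^ 'n) \<Rightarrow> ('m::finite, 'N::finite) labels \<Rightarrow> nat
    \<Rightarrow> (real ^ 'N) set \<Rightarrow> ('m, 'N, 'n) family
    \<Rightarrow> (nat \<Rightarrow> ('m, 'n) qp_functional) \<Rightarrow> (nat \<Rightarrow> ('m, 'n) qp_covector) \<Rightarrow> bool" where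
  "regular_hamiltonian_family B F \<iota> s W \<Phi> N dN \<longleftrightarrow>
     complete_regular_family F \<iota> s W \<Phi> \<and>
     (\<exists>\<V>. neighbourhood_of_family \<iota> W \<Phi> \<V> \<and> (\<forall>l<s. annihilator_on B \<V> (N l) (dN l))) \<and>
     (\<forall>p\<in>W. \<forall>\<theta>\<^sub>0. let k = wave_numbers \<iota> p; \<Psi> = (\<lambda>\<theta>. \<Phi> (\<theta> + \<theta>\<^sub>0) p) in
        fun_basis {..<s} (\<lambda>l x. dN l k \<Psi> (x *\<^sub>R k)) (qp_kernel B k \<Psi>))"

definition average ::
  "('m::finite, 'N::finite) labels \<Rightarrow> ('m, 'N, 'n::finite) family \<Rightarrow> ('n jet \<Rightarrow> real)
    \<Rightarrow> real ^ 'N \<Rightarrow> real" where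
  "average \<iota> \<Phi> f p = torus_mean (\<lambda>\<theta>. f (jet (wave_numbers \<iota> p) (\<lambda>\<theta>. \<Phi> \<theta> p) \<theta>))"

definition integral_values ::
  "('m::finite, 'N::finite) labels \<Rightarrow> ('m, 'N, 'n::finite) family \<Rightarrow> ('N \<Rightarrow> 'n jet \<Rightarrow> real)
    \<Rightarrow> real ^ 'N \<Rightarrow> real ^ 'N" where
  "integral_values \<iota> \<Phi> P p = (\<chi> \<nu>. average \<iota> \<Phi> (P \<nu>) p)"

text \<open>
  In the matrix \<open>\<Omega> p\<close> of the frequencies \<open>\<omega>\<^sup>\<alpha>\<^sup>\<nu>\<close>, the row index is \<open>\<alpha>\<close>; \<open>column \<nu> (\<Omega> p)\<close> is the
  frequency vector of the flow generated by \<open>I\<^sup>\<nu>\<close>.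
\<close>

definition complete_hamiltonian_set ::
  "'n::finite coeffs \<Rightarrow> ('n jet \<Rightarrow> real) \<Rightarrow> ('m::finite, 'N::finite) labels \<Rightarrow> nat
    \<Rightarrow> (real ^ 'N) set \<Rightarrow> ('m, 'N, 'n) family \<Rightarrow> (nat \<Rightarrow> ('m, 'n) qp_covector)
    \<Rightarrow> ('N \<Rightarrow> 'n jet \<Rightarrow> real) \<Rightarrow> bool" where
  "complete_hamiltonian_set B P_H \<iota> s W \<Phi> dN P \<longleftrightarrow>
     (\<forall>\<nu>. diff_fun (P \<nu>)) \<and>
     (\<forall>\<nu>. in_involution B (P \<nu>) P_H) \<and>
     (\<forall>\<nu> \<mu>. in_involution B (P \<nu>) (P \<mu>)) \<and>
     (\<forall>p\<in>W. det (matrix (frechet_derivative (integral_values \<iota> \<Phi> P) (at p))) \<noteq> 0) \<and>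
     (\<exists>\<Omega> :: real ^ 'N \<Rightarrow> real ^ 'N ^ 'm. smooth_on W \<Omega> \<and>
        (\<forall>p\<in>W. rank (\<Omega> p) = CARD('m) \<and>
          (\<forall>\<nu> \<theta>. ham_flow (wave_numbers \<iota> p) B (P \<nu>) (\<lambda>\<theta>. \<Phi> \<theta> p) \<theta>
             = dird (column \<nu> (\<Omega> p)) (\<lambda>\<theta>. \<Phi> \<theta> p) \<theta>))) \<and>
     (\<exists>\<gamma> :: nat \<Rightarrow> 'N \<Rightarrow> real ^ 'N \<Rightarrow> real. (\<forall>l<s. \<forall>\<nu>. smooth_on W (\<gamma> l \<nu>)) \<and>
        (\<forall>l<s. \<forall>p\<in>W. \<forall>\<theta>\<^sub>0 x. let k = wave_numbers \<iota> p; \<Psi> = (\<lambda>\<theta>. \<Phi> (\<theta> + \<theta>\<^sub>0) p) in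
           dN l k \<Psi> (x *\<^sub>R k) = (\<Sum>\<nu>\<in>UNIV. \<gamma> l \<nu> p *\<^sub>R var_deriv k (P \<nu>) \<Psi> (x *\<^sub>R k))))"


section \<open>The Whitham system and the Dubrovin--Novikov bracket\<close>

text \<open>
  The average as a function of the coordinates \<open>U\<^sup>\<nu> = \<langle>P\<^sup>\<nu>\<rangle>\<close>. A nonzero Jacobian gives coordinates
  only locally, so \<open>V\<close> is a set of parameters on which \<open>U\<close> is injective.
\<close>

definition average_U ::
  "('m::finite, 'N::finite) labels \<Rightarrow> ('m, 'N, 'n::finite) family \<Rightarrow> ('N \<Rightarrow> 'n jet \<Rightarrow> real)
    \<Rightarrow> (real ^ 'N) set \<Rightarrow> ('n jet \<Rightarrow> real) \<Rightarrow> real ^ 'N \<Rightarrow> real" where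
  "average_U \<iota> \<Phi> P V f U = average \<iota> \<Phi> f (inv_into V (integral_values \<iota> \<Phi> P) U)"

text \<open>
  Coefficients of \<open>a\<^sup>\<nu>\<^sup>\<mu>(U) \<delta>'(X - Y) + (\<partial>q\<^sup>\<nu>\<^sup>\<mu>/\<partial>U\<^sup>\<gamma>) U\<^sup>\<gamma>\<^sub>X \<delta>(X - Y)\<close>; in a jet \<open>u\<close> of the field \<open>U(X)\<close>,
  \<open>u 0\<close> is \<open>U\<close> and \<open>u 1\<close> is \<open>U\<^sub>X\<close>.
\<close>

definition DN_bracket ::
  "('N::finite \<Rightarrow> 'N \<Rightarrow> real ^ 'N \<Rightarrow> real) \<Rightarrow> ('N \<Rightarrow> 'N \<Rightarrow> real ^ 'N \<Rightarrow> real) \<Rightarrow> 'N coeffs" where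
  "DN_bracket a q k u = (\<chi> \<nu> \<mu>.
     if k = 0 then \<Sum>\<gamma>\<in>UNIV. dird (axis \<gamma> 1) (q \<nu> \<mu>) (u 0) * u 1 $ \<gamma>
     else if k = 1 then a \<nu> \<mu> (u 0)
     else 0)"

text \<open>Fields \<open>U T X\<close>.\<close>

definition whitham_system ::
  "('N::finite \<Rightarrow> real ^ 'N \<Rightarrow> real) \<Rightarrow> ('N \<Rightarrow> real ^ 'N \<Rightarrow> real)
    \<Rightarrow> (real \<Rightarrow> real \<Rightarrow> real ^ 'N) \<Rightarrow> bool" where
  "whitham_system p q U \<longleftrightarrow>
     (\<forall>\<nu> T X. deriv (\<lambda>T. p \<nu> (U T X)) T = deriv (\<lambda>X. q \<nu> (U T X)) X)"

definition hamiltonian_evolution ::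
  "'N::finite coeffs \<Rightarrow> ('N jet \<Rightarrow> real) \<Rightarrow> (real \<Rightarrow> real \<Rightarrow> real ^ 'N) \<Rightarrow> bool" where
  "hamiltonian_evolution C h U \<longleftrightarrow>
     (\<forall>\<nu> T X. deriv (\<lambda>T. U T X $ \<nu>) T = ham_flow 1 C h (U T) X $ \<nu>)"

end

(*
  On the family, the variational derivative of H is a combination of those of the I^mu with
  coefficients h_mu = d<P_H>/dU^mu. For rationally independent wave numbers this follows from a
  dimension count: the flows of the I^nu span the shifts of theta_0, so up to annihilators (which are
  themselves combinations of the I^nu) H acts as a combination of the I^nu; the m-dimensional freedom
  left is fixed by the derivatives of the averages in the directions other than the wave numbers.
  The general case follows by continuity.

  Next insert a field whose parameters vary slowly along a curve p(X), X = epsilon x, into the exact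
  conservation law {P^nu, H} = d_x Q^nu and subtract the exact brackets {P^nu, int h_mu(p(X)) P^mu dX}.
  Since the variational derivatives match on the family, what remains on the left is of the form
  lin P^nu (B w) with w of first order in epsilon. Averaged over theta, skew-symmetry of B turns the
  first order into a combination of the means of Phi_theta . w, which are total derivatives of
  T_H - h_mu T_mu, where T_f is the derivative of <f> with respect to k at fixed Phi. This vanishes
  identically, again because h_mu = d<P_H>/dU^mu, and the right-hand side gives the Whitham system.
*)

theory Submission
  imports Defs
begin

section \<open>Smooth functions\<close>

text \<open>The hypotheses concern fields on the line, the conclusion means over tori. Both are read
  off from one calculus on the bundle of phases and parameters, where a vector field
  \<open>X\<close> plays the role of the total x-derivative: along an integral curve an identity on
  the bundle is one for a field on the line, and on a torus to which \<open>X\<close> is tangent it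
  is one for periodic functions. In the modulated bundle epsilon is a coordinate. The identities
  hold exactly for every epsilon and are differentiated once at epsilon = 0, so there are no
  remainders to estimate. Only means of Phi_theta . w arise because, once B is moved onto grad P^nu,
  there stands the flow of I^nu, which shifts the phases; w itself need not be known. Rational
  independence enters because the quasiperiodic kernel consists of functions on the line; these
  determine continuous functions on the torus only if the line is dense. Skew-symmetry is given in
  integrated form, against compactly supported test functions, and is first made pointwise so that
  it applies to quasiperiodic fields.\<close>

lemmas frechet_derivative_worksI = frechet_derivative_works[THEN iffD1]

lemma has_derivative_frechet_chain:
  assumes "(c has_derivative c') (at x within T)" "f differentiable (at (c x))"
  shows "((\<lambda>x. f (c x)) has_derivative (\<lambda>v. frechet_derivative f (at (c x)) (c' v))) (at x within T)"
  using has_derivative_compose[OF assms(1) frechet_derivative_worksI[OF assms(2)]] .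

lemma frechet_derivative_eq:
  "(f has_derivative f') (at x) \<Longrightarrow> frechet_derivative f (at x) v = f' v"
  using frechet_derivative_at[of f f' x] by simp

lemma frechet_derivative_chain:
  assumes "(c has_derivative c') (at x)" "f differentiable (at (c x))"
  shows "frechet_derivative (\<lambda>x. f (c x)) (at x) v = frechet_derivative f (at (c x)) (c' v)"
  by (rule frechet_derivative_eq[OF has_derivative_frechet_chain[OF assms]])

text \<open>\<open>frechet_derivative\<close> is a choice from the predicate
  \<open>has_derivative\<close>. The two predicates coincide, hence so do the choices, even where
  neither function is differentiable; congruence rules for \<open>vd\<close> therefore need no
  smoothness.\<close>

lemma frechet_derivative_transform_open:
  assumes "open S" "x \<in> S" "\<And>y. y \<in> S \<Longrightarrow> f y = g y"
  shows "frechet_derivative f (at x) = frechet_derivative g (at x)"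
proof -
  have "(f has_derivative D) (at x) = (g has_derivative D) (at x)" for D
    using has_derivative_transform_within_open[OF _ assms(1,2), where f = f and g = g and f' = D and t = UNIV]
      has_derivative_transform_within_open[OF _ assms(1,2), where f = g and g = f and f' = D and t = UNIV] assms(3)
    by auto
  then show ?thesis
    by (simp add: frechet_derivative_def)
qed

lemma differentiable_transform_open:
  assumes "open S" "x \<in> S" "\<And>y. y \<in> S \<Longrightarrow> f y = g y" "f differentiable (at x)"
  shows "g differentiable (at x)"
  using assms has_derivative_transform_within_open[OF _ assms(1,2), where f = f and g = g and t = UNIV]
  unfolding differentiable_def by blast

lemma higher_differentiable_on_cong:
  assumes "open S" "\<And>x. x \<in> S \<Longrightarrow> f x = g x" "higher_differentiable_on S f r"
  shows "higher_differentiable_on S g r"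
  using assms
proof (induction r arbitrary: f g)
  case 0
  then show ?case
    by (auto cong: continuous_on_cong)
next
  case (Suc r)
  have *: "frechet_derivative f (at x) v = frechet_derivative g (at x) v" if "x \<in> S" for x v
    using frechet_derivative_transform_open[OF \<open>open S\<close> that Suc.prems(2)] by simp
  show ?case
    using Suc.prems differentiable_transform_open[OF \<open>open S\<close> _ Suc.prems(2)] Suc.IH[OF _ *]
    by auto
qed

lemma higher_differentiable_on_Suc_imp:
  "higher_differentiable_on S f (Suc r) \<Longrightarrow> higher_differentiable_on S f r"
proof (induction r arbitrary: f)
  case 0
  then show ?case
    by (auto intro!: continuous_at_imp_continuous_on differentiable_imp_continuous_within)
next
  case (Suc r)
  then show ?case
    by (metis higher_differentiable_on.simps(2))
qed

lemma higher_differentiable_on_const [simp]: "higher_differentiable_on S (\<lambda>x. c) r"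
  by (induction r arbitrary: c) (auto simp: frechet_derivative_const)

lemma higher_differentiable_on_bounded_linear:
  assumes "open S" "bounded_linear L" "higher_differentiable_on S f r"
  shows "higher_differentiable_on S (\<lambda>x. L (f x)) r"
  using assms(3)
proof (induction r arbitrary: f)
  case 0
  then show ?case
    using bounded_linear.continuous_on[OF assms(2)] by auto
next
  case (Suc r)
  have *: "((\<lambda>x. L (f x)) has_derivative (\<lambda>v. L (frechet_derivative f (at x) v))) (at x)" if "x \<in> S" for x
    using Suc.prems that by (intro bounded_linear.has_derivative[OF assms(2)] frechet_derivative_worksI) auto
  have "higher_differentiable_on S (\<lambda>x. frechet_derivative (\<lambda>x. L (f x)) (at x) v) r" for v
    by (rule higher_differentiable_on_cong[OF assms(1) _ Suc.IH[of "\<lambda>x. frechet_derivative f (at x) v"]])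
      (use Suc.prems in \<open>auto simp: frechet_derivative_at[OF *, symmetric]\<close>)
  then show ?case
    using * by (auto simp: differentiable_def)
qed

lemma higher_differentiable_on_add:
  assumes "open S" "higher_differentiable_on S f r" "higher_differentiable_on S g r"
  shows "higher_differentiable_on S (\<lambda>x. f x + g x) r"
  using assms(2,3)
proof (induction r arbitrary: f g)
  case 0
  then show ?case
    by (auto intro: continuous_intros)
next
  case (Suc r)
  have *: "((\<lambda>x. f x + g x) has_derivative
      (\<lambda>v. frechet_derivative f (at x) v + frechet_derivative g (at x) v)) (at x)" if "x \<in> S" for x
    using Suc.prems that by (auto intro!: derivative_intros frechet_derivative_worksI)
  have "higher_differentiable_on S (\<lambda>x. frechet_derivative (\<lambda>x. f x + g x) (at x) v) r" for v
    by (rule higher_differentiable_on_cong[OF assms(1) _ Suc.IH[of "\<lambda>x. frechet_derivative f (at x) v"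
            "\<lambda>x. frechet_derivative g (at x) v"]])
      (use Suc.prems in \<open>auto simp: frechet_derivative_at[OF *, symmetric]\<close>)
  then show ?case
    using * by (auto simp: differentiable_def)
qed

lemma higher_differentiable_on_sum:
  assumes "open S" "\<And>i. i \<in> I \<Longrightarrow> higher_differentiable_on S (f i) r"
  shows "higher_differentiable_on S (\<lambda>x. \<Sum>i\<in>I. f i x) r"
  using assms(2) by (induction I rule: infinite_finite_induct) (auto intro: higher_differentiable_on_add[OF assms(1)])

lemma higher_differentiable_on_bilinear:
  assumes "open S" "bounded_bilinear pr" "higher_differentiable_on S f r" "higher_differentiable_on S g r"
  shows "higher_differentiable_on S (\<lambda>x. pr (f x) (g x)) r"
  using assms(3,4)
proof (induction r arbitrary: f g)
  case 0
  then show ?case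
    using bounded_bilinear.continuous_on[OF assms(2)] by auto
next
  case (Suc r)
  have *: "((\<lambda>x. pr (f x) (g x)) has_derivative
      (\<lambda>v. pr (f x) (frechet_derivative g (at x) v) + pr (frechet_derivative f (at x) v) (g x))) (at x)"
    if "x \<in> S" for x
    using Suc.prems that by (auto intro!: bounded_bilinear.FDERIV[OF assms(2)] frechet_derivative_worksI)
  have "higher_differentiable_on S (\<lambda>x. frechet_derivative (\<lambda>x. pr (f x) (g x)) (at x) v) r" for v
    by (rule higher_differentiable_on_cong[OF assms(1) _ higher_differentiable_on_add[OF assms(1)
          Suc.IH[of f "\<lambda>x. frechet_derivative g (at x) v"] Suc.IH[of "\<lambda>x. frechet_derivative f (at x) v" g]]])
      (use Suc.prems in \<open>auto simp: frechet_derivative_at[OF *, symmetric] simp del: higher_differentiable_on.simps(2)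
        dest: higher_differentiable_on_Suc_imp\<close>, use Suc.prems in auto)
  then show ?case
    using * by (auto simp: differentiable_def)
qed

text \<open>The function stays fixed in the induction: the derivative of 1/f is a product of two
  factors 1/f and a derivative of f, so the induction hypothesis for 1/f itself suffices.\<close>

lemma higher_differentiable_on_inverse:
  fixes f :: "'a::real_normed_vector \<Rightarrow> real"
  assumes "open S" "\<And>x. x \<in> S \<Longrightarrow> f x \<noteq> 0" "higher_differentiable_on S f r"
  shows "higher_differentiable_on S (\<lambda>x. inverse (f x)) r"
  using assms(3)
proof (induction r)
  case 0
  then show ?case
    using assms(2) by (auto intro!: continuous_intros)
next
  case (Suc r)
  have *: "((\<lambda>x. inverse (f x)) has_derivative
      (\<lambda>v. - (inverse (f x) * frechet_derivative f (at x) v * inverse (f x)))) (at x)" if "x \<in> S" for x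
    using Suc.prems that assms(2) by (intro Deriv.has_derivative_inverse frechet_derivative_worksI) auto
  have IH: "higher_differentiable_on S (\<lambda>x. inverse (f x)) r"
    using Suc higher_differentiable_on_Suc_imp by blast
  have "higher_differentiable_on S (\<lambda>x. - (inverse (f x) * frechet_derivative f (at x) v * inverse (f x))) r" for v
    by (intro higher_differentiable_on_bounded_linear[OF assms(1) bounded_linear_minus[OF bounded_linear_ident]]
        higher_differentiable_on_bilinear[OF assms(1) bounded_bilinear_mult] IH)
      (use Suc.prems in auto)
  then have "higher_differentiable_on S (\<lambda>x. frechet_derivative (\<lambda>x. inverse (f x)) (at x) v) r" for v
    by (rule higher_differentiable_on_cong[OF assms(1), rotated]) (auto simp: frechet_derivative_at[OF *, symmetric])
  then show ?case
    using * by (auto simp: differentiable_def)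
qed

lemma linear_sum_Basis:
  fixes v :: "'a::euclidean_space"
  assumes "linear L"
  shows "L v = (\<Sum>b\<in>Basis. (v \<bullet> b) *\<^sub>R L b)"
  by (subst euclidean_representation[of v, symmetric])
    (simp only: linear_sum[OF assms] linear_scale[OF assms])

text \<open>Higher derivatives are taken in fixed directions, while the chain rule differentiates
  \<open>f\<close> in the varying direction Dg(x) v. Expanding that direction in a basis reduces it
  to fixed ones; this is why \<open>g\<close> takes values in a Euclidean space.\<close>

lemma higher_differentiable_on_compose:
  fixes g :: "'a::real_normed_vector \<Rightarrow> 'b::euclidean_space"
  assumes "open S" "open T" "g ` S \<subseteq> T" "higher_differentiable_on T f r" "higher_differentiable_on S g r"
  shows "higher_differentiable_on S (\<lambda>x. f (g x)) r"
  using assms(4,5)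
proof (induction r arbitrary: f)
  case 0
  then show ?case
    using assms(3) continuous_on_compose2 by (metis higher_differentiable_on.simps(1))
next
  case (Suc r)
  have gT: "g x \<in> T" if "x \<in> S" for x
    using assms(3) that by auto
  have df: "(f has_derivative frechet_derivative f (at (g x))) (at (g x))" if "x \<in> S" for x
    using Suc.prems gT[OF that] by (auto intro: frechet_derivative_worksI)
  have *: "((\<lambda>x. f (g x)) has_derivative (\<lambda>v. frechet_derivative f (at (g x)) (frechet_derivative g (at x) v))) (at x)"
    if "x \<in> S" for x
    using Suc.prems that gT by (intro has_derivative_frechet_chain) (auto intro: frechet_derivative_worksI)
  have "higher_differentiable_on S (\<lambda>x. \<Sum>b\<in>Basis. (frechet_derivative g (at x) v \<bullet> b) *\<^sub>R frechet_derivative f (at (g x)) b) r" for v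
    by (intro higher_differentiable_on_sum[OF assms(1)] Suc.IH
        higher_differentiable_on_bounded_linear[OF assms(1) bounded_linear_inner_left]
        higher_differentiable_on_bilinear[OF assms(1) bounded_bilinear_scaleR])
      (use Suc.prems in \<open>auto simp: higher_differentiable_on_Suc_imp simp del: higher_differentiable_on.simps(2)\<close>,
       use Suc.prems in auto)
  then have "higher_differentiable_on S (\<lambda>x. frechet_derivative (\<lambda>x. f (g x)) (at x) v) r" for v
    by (rule higher_differentiable_on_cong[OF assms(1), rotated])
      (simp add: frechet_derivative_at[OF *, symmetric] linear_sum_Basis[OF has_derivative_linear[OF df]])
  then show ?case
    using * by (auto simp: differentiable_def)
qed

lemma smooth_onI_derivative:
  assumes "\<And>x. x \<in> S \<Longrightarrow> f differentiable (at x)" "\<And>v. smooth_on S (\<lambda>x. frechet_derivative f (at x) v)"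
  shows "smooth_on S f"
proof -
  have "higher_differentiable_on S f r" for r
    by (cases r) (use assms in \<open>auto simp: smooth_on_def intro!: continuous_at_imp_continuous_on differentiable_imp_continuous_within\<close>)
  then show ?thesis
    by (simp add: smooth_on_def)
qed

lemma smooth_on_imp_differentiable: "smooth_on S f \<Longrightarrow> x \<in> S \<Longrightarrow> f differentiable (at x)"
  unfolding smooth_on_def by (metis higher_differentiable_on.simps(2))

lemma smooth_on_has_derivative:
  "smooth_on S f \<Longrightarrow> x \<in> S \<Longrightarrow> (f has_derivative frechet_derivative f (at x)) (at x)"
  using smooth_on_imp_differentiable frechet_derivative_worksI by blast

lemma smooth_on_frechet_linear: "smooth_on S f \<Longrightarrow> x \<in> S \<Longrightarrow> linear (frechet_derivative f (at x))"
  using smooth_on_has_derivative has_derivative_linear by blast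

lemma smooth_on_imp_continuous_on: "smooth_on S f \<Longrightarrow> continuous_on S f"
  unfolding smooth_on_def by (metis higher_differentiable_on.simps(1))

lemma smooth_on_frechet_derivative: "smooth_on S f \<Longrightarrow> smooth_on S (\<lambda>x. frechet_derivative f (at x) v)"
  unfolding smooth_on_def by (metis higher_differentiable_on.simps(2))

lemma smooth_on_cong:
  assumes "open S" "\<And>x. x \<in> S \<Longrightarrow> f x = g x" "smooth_on S f"
  shows "smooth_on S g"
  using assms higher_differentiable_on_cong unfolding smooth_on_def by blast

lemma higher_differentiable_on_subset:
  "higher_differentiable_on S f r \<Longrightarrow> T \<subseteq> S \<Longrightarrow> higher_differentiable_on T f r"
  by (induction r arbitrary: f) (auto intro: continuous_on_subset)

lemma smooth_on_subset: "smooth_on S f \<Longrightarrow> T \<subseteq> S \<Longrightarrow> smooth_on T f"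
  unfolding smooth_on_def by (blast intro: higher_differentiable_on_subset)

lemma smooth_on_const: "smooth_on S (\<lambda>x. c)"
  by (simp add: smooth_on_def)

lemma smooth_on_bounded_linear:
  "open S \<Longrightarrow> bounded_linear L \<Longrightarrow> smooth_on S f \<Longrightarrow> smooth_on S (\<lambda>x. L (f x))"
  unfolding smooth_on_def by (blast intro: higher_differentiable_on_bounded_linear)

lemma smooth_on_linear_map: "bounded_linear L \<Longrightarrow> smooth_on S L"
  by (rule smooth_onI_derivative)
    (auto simp: bounded_linear_imp_differentiable smooth_on_const
      frechet_derivative_at[OF bounded_linear_imp_has_derivative, symmetric])

lemma smooth_on_ident: "smooth_on S (\<lambda>x. x)"
  by (rule smooth_on_linear_map) (rule bounded_linear_ident)

lemma smooth_on_add: "open S \<Longrightarrow> smooth_on S f \<Longrightarrow> smooth_on S g \<Longrightarrow> smooth_on S (\<lambda>x. f x + g x)"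
  unfolding smooth_on_def by (blast intro: higher_differentiable_on_add)

lemma smooth_on_sum: "open S \<Longrightarrow> (\<And>i. i \<in> I \<Longrightarrow> smooth_on S (f i)) \<Longrightarrow> smooth_on S (\<lambda>x. \<Sum>i\<in>I. f i x)"
  unfolding smooth_on_def by (blast intro: higher_differentiable_on_sum)

lemma smooth_on_bilinear:
  "open S \<Longrightarrow> bounded_bilinear pr \<Longrightarrow> smooth_on S f \<Longrightarrow> smooth_on S g \<Longrightarrow> smooth_on S (\<lambda>x. pr (f x) (g x))"
  unfolding smooth_on_def by (blast intro: higher_differentiable_on_bilinear)

lemma smooth_on_minus: "open S \<Longrightarrow> smooth_on S f \<Longrightarrow> smooth_on S (\<lambda>x. - f x)"
  by (rule smooth_on_bounded_linear[OF _ bounded_linear_minus[OF bounded_linear_ident]])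

lemma smooth_on_diff: "open S \<Longrightarrow> smooth_on S f \<Longrightarrow> smooth_on S g \<Longrightarrow> smooth_on S (\<lambda>x. f x - g x)"
  using smooth_on_add[OF _ _ smooth_on_minus, of S f g] by simp

lemma smooth_on_scaleR:
  "open S \<Longrightarrow> smooth_on S f \<Longrightarrow> smooth_on S g \<Longrightarrow> smooth_on S (\<lambda>x. f x *\<^sub>R g x)"
  by (rule smooth_on_bilinear[OF _ bounded_bilinear_scaleR])

lemma smooth_on_mult:
  fixes f g :: "_ \<Rightarrow> real"
  shows "open S \<Longrightarrow> smooth_on S f \<Longrightarrow> smooth_on S g \<Longrightarrow> smooth_on S (\<lambda>x. f x * g x)"
  by (rule smooth_on_bilinear[OF _ bounded_bilinear_mult])

lemma smooth_on_inner:
  "open S \<Longrightarrow> smooth_on S f \<Longrightarrow> smooth_on S g \<Longrightarrow> smooth_on S (\<lambda>x. f x \<bullet> g x)"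
  by (rule smooth_on_bilinear[OF _ bounded_bilinear_inner])

lemma smooth_on_nth: "open S \<Longrightarrow> smooth_on S f \<Longrightarrow> smooth_on S (\<lambda>x. f x $ i)"
  by (rule smooth_on_bounded_linear[OF _ bounded_linear_vec_nth])

lemma vec_lambda_sum_axis: "(\<chi> i. f i) = (\<Sum>i\<in>UNIV. f i *\<^sub>R axis i (1::real))"
  by (simp add: vec_eq_iff axis_def if_distrib sum.delta cong: if_cong)

lemma smooth_on_vec_lambda:
  fixes f :: "'i::finite \<Rightarrow> 'a::real_normed_vector \<Rightarrow> real"
  assumes "open S" "\<And>i. smooth_on S (f i)"
  shows "smooth_on S (\<lambda>x. \<chi> i. f i x)"
  unfolding vec_lambda_sum_axis by (intro smooth_on_sum smooth_on_scaleR smooth_on_const assms)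

lemma smooth_on_prod:
  fixes f :: "'i \<Rightarrow> 'a::real_normed_vector \<Rightarrow> real"
  assumes "open S" "\<And>i. i \<in> I \<Longrightarrow> smooth_on S (f i)"
  shows "smooth_on S (\<lambda>x. \<Prod>i\<in>I. f i x)"
  using assms(2)
  by (induction I rule: infinite_finite_induct) (auto intro: smooth_on_const smooth_on_mult[OF assms(1)])

lemma smooth_on_inverse:
  fixes f :: "'a::real_normed_vector \<Rightarrow> real"
  shows "open S \<Longrightarrow> (\<And>x. x \<in> S \<Longrightarrow> f x \<noteq> 0) \<Longrightarrow> smooth_on S f \<Longrightarrow> smooth_on S (\<lambda>x. inverse (f x))"
  unfolding smooth_on_def by (blast intro: higher_differentiable_on_inverse)

lemma smooth_on_compose:
  fixes g :: "'a::real_normed_vector \<Rightarrow> 'b::euclidean_space"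
  shows "open S \<Longrightarrow> open T \<Longrightarrow> g ` S \<subseteq> T \<Longrightarrow> smooth_on T f \<Longrightarrow> smooth_on S g \<Longrightarrow> smooth_on S (\<lambda>x. f (g x))"
  unfolding smooth_on_def by (blast intro: higher_differentiable_on_compose)

lemma smooth_on_Pair:
  assumes "open S" "smooth_on S f" "smooth_on S g"
  shows "smooth_on S (\<lambda>x. (f x, g x))"
proof -
  have "smooth_on S (\<lambda>x. (f x, 0) + (0, g x))"
    using bounded_linear_Pair[OF bounded_linear_ident bounded_linear_zero]
      bounded_linear_Pair[OF bounded_linear_zero bounded_linear_ident]
    by (intro smooth_on_add assms smooth_on_bounded_linear[where L = "\<lambda>a. (a, 0)"]
        smooth_on_bounded_linear[where L = "\<lambda>a. (0, a)"])
  then show ?thesis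
    by simp
qed

lemma smooth_on_fst: "open S \<Longrightarrow> smooth_on S f \<Longrightarrow> smooth_on S (\<lambda>x. fst (f x))"
  by (rule smooth_on_bounded_linear[OF _ bounded_linear_fst])

lemma smooth_on_snd: "open S \<Longrightarrow> smooth_on S f \<Longrightarrow> smooth_on S (\<lambda>x. snd (f x))"
  by (rule smooth_on_bounded_linear[OF _ bounded_linear_snd])

section \<open>Symmetry of second derivatives\<close>

lemma mixed_difference_mvt:
  fixes f :: "'a::real_normed_vector \<Rightarrow> real"
  assumes ball: "\<And>s t. 0 \<le> s \<Longrightarrow> s \<le> h \<Longrightarrow> 0 \<le> t \<Longrightarrow> t \<le> h \<Longrightarrow> x + s *\<^sub>R v + t *\<^sub>R w \<in> S"
    and f: "smooth_on S f" and "h > 0"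
  obtains s t where "0 < s" "s < h" "0 < t" "t < h"
    "f (x + h *\<^sub>R v + h *\<^sub>R w) - f (x + h *\<^sub>R v) - (f (x + h *\<^sub>R w) - f x)
      = h * h * frechet_derivative (\<lambda>y. frechet_derivative f (at y) v) (at (x + s *\<^sub>R v + t *\<^sub>R w)) w"
proof -
  let ?fv = "\<lambda>y. frechet_derivative f (at y) v"
  have d1: "((\<lambda>s. f (x + s *\<^sub>R v + t *\<^sub>R w)) has_real_derivative ?fv (x + s *\<^sub>R v + t *\<^sub>R w)) (at s)"
    if "0 \<le> s" "s \<le> h" "0 \<le> t" "t \<le> h" for s t
  proof -
    have "((\<lambda>s. f (x + s *\<^sub>R v + t *\<^sub>R w)) has_derivative
        (\<lambda>k. frechet_derivative f (at (x + s *\<^sub>R v + t *\<^sub>R w)) (k *\<^sub>R v))) (at s)"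
      by (rule has_derivative_frechet_chain[where f = f and c = "\<lambda>s. x + s *\<^sub>R v + t *\<^sub>R w"])
        (auto intro!: derivative_eq_intros smooth_on_imp_differentiable[OF f] ball that)
    then show ?thesis
      by (simp add: has_field_derivative_def linear_scale[OF smooth_on_frechet_linear[OF f ball[OF that]]] mult_commute_abs)
  qed
  have d2: "((\<lambda>t. ?fv (x + s *\<^sub>R v + t *\<^sub>R w)) has_real_derivative
      frechet_derivative ?fv (at (x + s *\<^sub>R v + t *\<^sub>R w)) w) (at t)"
    if "0 \<le> s" "s \<le> h" "0 \<le> t" "t \<le> h" for s t
  proof -
    note fv = smooth_on_frechet_derivative[OF f, of v]
    have "((\<lambda>t. ?fv (x + s *\<^sub>R v + t *\<^sub>R w)) has_derivative
        (\<lambda>k. frechet_derivative ?fv (at (x + s *\<^sub>R v + t *\<^sub>R w)) (k *\<^sub>R w))) (at t)"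
      by (rule has_derivative_frechet_chain[where f = ?fv and c = "\<lambda>t. x + s *\<^sub>R v + t *\<^sub>R w"])
        (auto intro!: derivative_eq_intros smooth_on_imp_differentiable[OF fv] ball that)
    then show ?thesis
      by (simp add: has_field_derivative_def linear_scale[OF smooth_on_frechet_linear[OF fv ball[OF that]]] mult_commute_abs)
  qed
  have "\<exists>s. 0 < s \<and> s < h \<and> (f (x + h *\<^sub>R v + h *\<^sub>R w) - f (x + h *\<^sub>R v + 0 *\<^sub>R w)) - (f (x + 0 *\<^sub>R v + h *\<^sub>R w) - f (x + 0 *\<^sub>R v + 0 *\<^sub>R w))
    = (h - 0) * (?fv (x + s *\<^sub>R v + h *\<^sub>R w) - ?fv (x + s *\<^sub>R v + 0 *\<^sub>R w))"
    by (rule MVT2[OF \<open>h > 0\<close>, where f = "\<lambda>s. f (x + s *\<^sub>R v + h *\<^sub>R w) - f (x + s *\<^sub>R v + 0 *\<^sub>R w)"])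
      (intro derivative_intros d1, use \<open>h > 0\<close> in auto)
  then obtain s where s: "0 < s" "s < h"
    "(f (x + h *\<^sub>R v + h *\<^sub>R w) - f (x + h *\<^sub>R v)) - (f (x + h *\<^sub>R w) - f x)
      = h * (?fv (x + s *\<^sub>R v + h *\<^sub>R w) - ?fv (x + s *\<^sub>R v))"
    by auto
  have "\<exists>t. 0 < t \<and> t < h \<and> ?fv (x + s *\<^sub>R v + h *\<^sub>R w) - ?fv (x + s *\<^sub>R v + 0 *\<^sub>R w)
     = (h - 0) * frechet_derivative ?fv (at (x + s *\<^sub>R v + t *\<^sub>R w)) w"
    by (rule MVT2[OF \<open>h > 0\<close>]) (use s d2 in auto)
  then obtain t where "0 < t" "t < h" "?fv (x + s *\<^sub>R v + h *\<^sub>R w) - ?fv (x + s *\<^sub>R v)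
     = h * frechet_derivative ?fv (at (x + s *\<^sub>R v + t *\<^sub>R w)) w"
    by auto
  then show ?thesis
    using that[OF s(1,2)] s(3) by (simp add: mult.assoc)
qed

text \<open>Both mixed derivatives, each at some intermediate point, equal the same second
  difference over a small parallelogram. By continuity they cannot differ at the corner
  \<open>x\<close>.\<close>

lemma frechet_derivative_commute_real:
  fixes f :: "'a::real_normed_vector \<Rightarrow> real"
  assumes S: "open S" "x \<in> S" and f: "smooth_on S f"
  shows "frechet_derivative (\<lambda>y. frechet_derivative f (at y) v) (at x) w
    = frechet_derivative (\<lambda>y. frechet_derivative f (at y) w) (at x) v" (is "?l x = ?r x")
proof (rule ccontr)
  assume ne: "?l x \<noteq> ?r x"
  define e where "e = \<bar>?l x - ?r x\<bar> / 2"
  have "e > 0"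
    using ne by (simp add: e_def)
  have "continuous (at x) ?l" "continuous (at x) ?r"
    using smooth_on_imp_continuous_on[OF smooth_on_frechet_derivative[OF smooth_on_frechet_derivative[OF f]]]
      S continuous_on_eq_continuous_at by blast+
  then obtain d1 d2 where d: "d1 > 0" "d2 > 0" "\<And>y. dist y x < d1 \<Longrightarrow> dist (?l y) (?l x) < e"
      "\<And>y. dist y x < d2 \<Longrightarrow> dist (?r y) (?r x) < e"
    using \<open>e > 0\<close> unfolding continuous_at_eps_delta by metis
  obtain d3 where d3: "d3 > 0" "ball x d3 \<subseteq> S"
    using S open_contains_ball by blast
  define d where "d = min d1 (min d2 d3)"
  \<comment> \<open>The summand 1 keeps \<open>c\<close> positive when both directions vanish; with
    h = d/(2c) the whole parallelogram stays within distance \<open>d\<close> of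
    \<open>x\<close>.\<close>
  define c where "c = norm v + norm w + 1"
  have cpos: "c > 0"
    unfolding c_def by (intro add_nonneg_pos) auto
  define h where "h = d / c / 2"
  have "d > 0"
    using d d3 by (simp add: d_def)
  then have "h > 0"
    using cpos by (simp add: h_def)
  have near: "dist (x + s *\<^sub>R v + t *\<^sub>R w) x < d" if "0 \<le> s" "s \<le> h" "0 \<le> t" "t \<le> h" for s t
  proof -
    have "norm (s *\<^sub>R v + t *\<^sub>R w) \<le> s * norm v + t * norm w"
      using norm_triangle_ineq[of "s *\<^sub>R v" "t *\<^sub>R w"] that by simp
    also have "\<dots> \<le> h * norm v + h * norm w"
      using that by (intro add_mono mult_right_mono) auto
    also have "\<dots> < h * c"
      using \<open>h > 0\<close> by (simp add: c_def algebra_simps)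
    also have "\<dots> = d / 2"
      using cpos by (simp add: h_def)
    also have "\<dots> < d"
      using \<open>d > 0\<close> by simp
    finally show ?thesis
      by (simp add: dist_norm add.assoc)
  qed
  have inS: "x + s *\<^sub>R v + t *\<^sub>R w \<in> S" if "0 \<le> s" "s \<le> h" "0 \<le> t" "t \<le> h" for s t
    using near[OF that] d3(2) by (auto simp: d_def dist_commute)
  have inS': "x + s *\<^sub>R w + t *\<^sub>R v \<in> S" if "0 \<le> s" "s \<le> h" "0 \<le> t" "t \<le> h" for s t
    using inS[of t s] that by (simp add: algebra_simps)
  obtain s t where st: "0 < s" "s < h" "0 < t" "t < h"
    "f (x + h *\<^sub>R v + h *\<^sub>R w) - f (x + h *\<^sub>R v) - (f (x + h *\<^sub>R w) - f x) = h * h * ?l (x + s *\<^sub>R v + t *\<^sub>R w)"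
    by (rule mixed_difference_mvt[OF inS f \<open>h > 0\<close>])
  obtain s' t' where st': "0 < s'" "s' < h" "0 < t'" "t' < h"
    "f (x + h *\<^sub>R w + h *\<^sub>R v) - f (x + h *\<^sub>R w) - (f (x + h *\<^sub>R v) - f x) = h * h * ?r (x + s' *\<^sub>R w + t' *\<^sub>R v)"
    by (rule mixed_difference_mvt[OF inS' f \<open>h > 0\<close>])
  \<comment> \<open>The second difference is symmetric in \<open>v\<close> and \<open>w\<close>, so
    the two mean values agree although they are attained at different points.\<close>
  have "h * h * ?l (x + s *\<^sub>R v + t *\<^sub>R w) = h * h * ?r (x + t' *\<^sub>R v + s' *\<^sub>R w)"
    using st(5) st'(5) by (simp add: algebra_simps)
  then have eq: "?l (x + s *\<^sub>R v + t *\<^sub>R w) = ?r (x + t' *\<^sub>R v + s' *\<^sub>R w)"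
    using \<open>h > 0\<close> by simp
  define a where "a = ?l (x + s *\<^sub>R v + t *\<^sub>R w)"
  have "dist (?l x) a < e"
    unfolding a_def by (subst dist_commute, rule d(3)) (use near[of s t] st in \<open>auto simp: d_def\<close>)
  moreover have "dist a (?r x) < e"
    unfolding a_def eq by (rule d(4)) (use near[of t' s'] st' in \<open>auto simp: d_def\<close>)
  ultimately have "dist (?l x) (?r x) < e + e"
    using dist_triangle[of "?l x" "?r x" a] by simp
  then show False
    by (simp add: e_def dist_real_def)
qed

lemma frechet_derivative_inner:
  assumes "f differentiable (at x)"
  shows "frechet_derivative (\<lambda>y. f y \<bullet> b) (at x) v = frechet_derivative f (at x) v \<bullet> b"
  using frechet_derivative_at[OF has_derivative_inner_left[OF frechet_derivative_worksI[OF assms], of b]]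
  by metis

lemma frechet_derivative_commute:
  fixes f :: "'a::real_normed_vector \<Rightarrow> 'b::euclidean_space"
  assumes S: "open S" "x \<in> S" and f: "smooth_on S f"
  shows "frechet_derivative (\<lambda>y. frechet_derivative f (at y) v) (at x) w
    = frechet_derivative (\<lambda>y. frechet_derivative f (at y) w) (at x) v"
proof (rule euclidean_eqI)
  fix b :: 'b
  have fb: "smooth_on S (\<lambda>y. f y \<bullet> b)"
    by (intro smooth_on_inner smooth_on_const S f)
  have *: "frechet_derivative (\<lambda>y. frechet_derivative f (at y) v) (at x) w \<bullet> b
      = frechet_derivative (\<lambda>y. frechet_derivative (\<lambda>y. f y \<bullet> b) (at y) v) (at x) w" for v w
  proof -
    have "frechet_derivative (\<lambda>y. frechet_derivative f (at y) v) (at x) w \<bullet> b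
        = frechet_derivative (\<lambda>y. frechet_derivative f (at y) v \<bullet> b) (at x) w"
      using frechet_derivative_inner[OF smooth_on_imp_differentiable[OF smooth_on_frechet_derivative[OF f] S(2)]]
      by metis
    also have "\<dots> = frechet_derivative (\<lambda>y. frechet_derivative (\<lambda>y. f y \<bullet> b) (at y) v) (at x) w"
      using frechet_derivative_transform_open[OF S, of "\<lambda>y. frechet_derivative f (at y) v \<bullet> b"
          "\<lambda>y. frechet_derivative (\<lambda>y. f y \<bullet> b) (at y) v"]
        frechet_derivative_inner[OF smooth_on_imp_differentiable[OF f]] by simp
    finally show ?thesis .
  qed
  show "frechet_derivative (\<lambda>y. frechet_derivative f (at y) v) (at x) w \<bullet> b
    = frechet_derivative (\<lambda>y. frechet_derivative f (at y) w) (at x) v \<bullet> b"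
    unfolding * by (rule frechet_derivative_commute_real[OF S fb])
qed

section \<open>Functions of finitely many derivatives\<close>

definition jet_order :: "nat \<Rightarrow> ('n::finite jet \<Rightarrow> 'b) \<Rightarrow> bool" where
  "jet_order K f \<longleftrightarrow> (\<forall>u v. (\<forall>l\<le>K. u l = v l) \<longrightarrow> f u = f v)"

lemma jet_order_mono: "jet_order K f \<Longrightarrow> K \<le> L \<Longrightarrow> jet_order L f"
  unfolding jet_order_def by (meson order_trans)

lemma diff_fun_order: "diff_fun f \<Longrightarrow> \<exists>K. jet_order K f"
  by (simp add: diff_fun_def jet_order_def)

lemma diff_fun_finite_order:
  assumes "finite I" "\<And>i. i \<in> I \<Longrightarrow> diff_fun (f i)"
  shows "\<exists>K. \<forall>i\<in>I. jet_order K (f i)"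
  using assms
proof (induction I rule: finite_induct)
  case (insert i I)
  then obtain K L where "\<forall>i\<in>I. jet_order K (f i)" "jet_order L (f i)"
    using diff_fun_order by (metis insertCI)
  then show ?case
    by (intro exI[of _ "max K L"]) (auto intro: jet_order_mono)
qed auto

lemma diff_fun_iterated_pd:
  assumes "diff_fun f"
  shows "continuous_on UNIV (foldr (\<lambda>(l, i). pd l i) ds f)"
    and "(\<lambda>h::real. foldr (\<lambda>(l, i). pd l i) ds f (u(l := u l + h *\<^sub>R axis i 1))) differentiable (at 0)"
  using conjunct2[OF assms[unfolded diff_fun_def], rule_format, of ds] by (simp_all add: Let_def)

lemma diff_fun_continuous: "diff_fun f \<Longrightarrow> continuous_on UNIV f"
  using diff_fun_iterated_pd(1)[of f "[]"] by simp

lemma diff_fun_has_pd: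
  assumes "diff_fun f"
  shows "((\<lambda>h. f (u(l := u l + h *\<^sub>R axis i 1))) has_vector_derivative
    pd l i f (u(l := u l + y *\<^sub>R axis i 1))) (at y)"
proof -
  let ?u = "u(l := u l + y *\<^sub>R axis i 1)"
  have "(\<lambda>h. f (?u(l := ?u l + h *\<^sub>R axis i 1))) differentiable (at 0)"
    using diff_fun_iterated_pd(2)[OF assms, of "[]" ?u l i] by simp
  then have "((\<lambda>h. f (?u(l := ?u l + h *\<^sub>R axis i 1))) has_vector_derivative pd l i f ?u) (at (y - y))"
    unfolding pd_def by (simp only: vector_derivative_works diff_self)
  moreover have "((\<lambda>h. h - y) has_vector_derivative 1) (at y)"
    by (auto intro!: derivative_eq_intros)
  ultimately have "(((\<lambda>h. f (?u(l := ?u l + h *\<^sub>R axis i 1))) \<circ> (\<lambda>h. h - y)) has_vector_derivative 1 *\<^sub>R pd l i f ?u) (at y)"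
    by (intro vector_diff_chain_at)
  then show ?thesis
    by (simp add: o_def algebra_simps)
qed

lemma jet_order_pd:
  assumes "jet_order K f"
  shows "jet_order K (pd l i f)"
proof -
  have "(\<lambda>h::real. f (u(l := u l + h *\<^sub>R axis i 1))) = (\<lambda>h. f (v(l := v l + h *\<^sub>R axis i 1)))"
    if "\<forall>l\<le>K. u l = v l" for u v
    by (rule ext, rule assms[unfolded jet_order_def, rule_format]) (use that in auto)
  then show ?thesis
    unfolding jet_order_def pd_def by (intro allI impI) (simp only:)
qed

lemma diff_fun_pd:
  assumes "diff_fun f"
  shows "diff_fun (pd l i f)"
proof -
  obtain K where "jet_order K f"
    using assms diff_fun_order by blast
  then have "jet_order K (pd l i f)"
    by (rule jet_order_pd)
  moreover have "continuous_on UNIV (foldr (\<lambda>(l, i). pd l i) ds (pd l i f))"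
    "(\<lambda>h::real. foldr (\<lambda>(l, i). pd l i) ds (pd l i f) (u(k := u k + h *\<^sub>R axis j 1))) differentiable (at 0)" for ds u k j
    using diff_fun_iterated_pd[OF assms, of "ds @ [(l, i)]"] by simp_all
  ultimately show ?thesis
    unfolding diff_fun_def jet_order_def Let_def by blast
qed

lemma pd_above_order:
  assumes "jet_order K f" "K < l"
  shows "pd l i f u = 0"
proof -
  have "f (u(l := u l + h *\<^sub>R axis i 1)) = f u" for h :: real
    by (rule assms(1)[unfolded jet_order_def, rule_format]) (use assms(2) in auto)
  then show ?thesis
    by (simp add: pd_def)
qed

lemma continuous_on_diff_fun:
  assumes "diff_fun f" "\<And>l. continuous_on S (\<psi> l)"
  shows "continuous_on S (\<lambda>e. f (\<lambda>l. \<psi> l e))"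
  by (rule continuous_on_compose2[OF diff_fun_continuous[OF assms(1)]])
    (auto intro!: continuous_on_coordinatewise_then_product assms(2))

text \<open>The coordinates \<open>(l, i)\<close> of the jet are released one after the other.\<close>

lemma diff_fun_has_derivative_coordinates:
  fixes f :: "'n::finite jet \<Rightarrow> 'b::real_normed_vector" and \<psi> :: "nat \<Rightarrow> 'a::real_normed_vector \<Rightarrow> real ^ 'n"
  assumes f: "diff_fun f" and S: "open S" "e0 \<in> S"
    and cont: "\<And>l. continuous_on S (\<psi> l)"
    and deriv: "\<And>l. (\<psi> l has_derivative \<psi>' l) (at e0)"
    and "finite J"
  shows "((\<lambda>e. f (\<lambda>l. \<chi> i. if (l, i) \<in> J then \<psi> l e $ i else \<psi> l e0 $ i)) has_derivative
    (\<lambda>v. \<Sum>(l, i)\<in>J. (\<psi>' l v $ i) *\<^sub>R pd l i f (\<lambda>l. \<psi> l e0))) (at e0)"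
  using \<open>finite J\<close>
proof (induction J rule: finite_induct)
  case empty
  then show ?case by simp
next
  case (insert li J)
  obtain l i where li: "li = (l, i)"
    by (cases li)
  define u where "u = (\<lambda>e l. \<chi> i. if (l, i) \<in> J then \<psi> l e $ i else \<psi> l e0 $ i)"
  define h where "h = (\<lambda>e. \<psi> l e $ i - \<psi> l e0 $ i)"
  define \<phi> where "\<phi> = (\<lambda>e y. f ((u e)(l := u e l + y *\<^sub>R axis i 1)))"
  have u0': "(u e0)(l := u e0 l + 0 *\<^sub>R axis i 1) = (\<lambda>l. \<psi> l e0)"
    by (auto simp: u_def vec_eq_iff fun_eq_iff)
  have cu: "continuous_on S (\<lambda>e. u e k)" for k
    unfolding u_def by (intro continuous_on_vec_lambda, case_tac "(k, i) \<in> J") (auto intro!: continuous_intros cont)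
  have eq: "f (\<lambda>l. \<chi> i. if (l, i) \<in> insert li J then \<psi> l e $ i else \<psi> l e0 $ i) = \<phi> e (h e)" for e
    unfolding \<phi>_def
    by (rule arg_cong[where f = f])
      (use insert.hyps in \<open>auto simp: fun_eq_iff vec_eq_iff u_def h_def li axis_def\<close>)
  \<comment> \<open>The newly released coordinate becomes an independent variable \<open>y\<close>.
    Differentiability in \<open>e\<close> at y = 0 (the induction hypothesis) and a continuous
    partial derivative in \<open>y\<close> give joint differentiability; then y = \<open>h e\<close>
    is substituted.\<close>
  have "((\<lambda>(e, y). \<phi> e y) has_derivative (\<lambda>(te, ty).
      (\<Sum>(l, i)\<in>J. (\<psi>' l te $ i) *\<^sub>R pd l i f (\<lambda>l. \<psi> l e0))
      + blinfun_scaleR_left (pd l i f ((u e0)(l := u e0 l + 0 *\<^sub>R axis i 1))) ty)) (at (e0, 0) within S \<times> UNIV)"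
  proof (rule has_derivative_partialsI)
    show "((\<lambda>e. \<phi> e 0) has_derivative (\<lambda>v. \<Sum>(l, i)\<in>J. (\<psi>' l v $ i) *\<^sub>R pd l i f (\<lambda>l. \<psi> l e0))) (at e0 within S)"
    proof -
      have "(\<lambda>e. \<phi> e 0) = (\<lambda>e. f (u e))"
        by (simp add: \<phi>_def)
      then show ?thesis
        using has_derivative_at_withinI[OF insert.IH] by (simp add: u_def)
    qed
    show "(\<phi> e has_derivative blinfun_apply (blinfun_scaleR_left (pd l i f ((u e)(l := u e l + y *\<^sub>R axis i 1)))))
      (at y within UNIV)" for e y
      using diff_fun_has_pd[OF f, of "u e" l i y] by (simp add: \<phi>_def has_vector_derivative_def)
    have "continuous_on (S \<times> UNIV) (\<lambda>z. pd l i f (\<lambda>k. ((u (fst z))(l := u (fst z) l + snd z *\<^sub>R axis i 1)) k))"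
    proof (rule continuous_on_diff_fun[OF diff_fun_pd[OF f]])
      fix k
      have "continuous_on (S \<times> UNIV) (\<lambda>z. u (fst z) k)" for k
        by (rule continuous_on_compose2[OF cu]) (auto intro: continuous_intros)
      then show "continuous_on (S \<times> UNIV) (\<lambda>z. ((u (fst z))(l := u (fst z) l + snd z *\<^sub>R axis i 1)) k)"
        by (cases "k = l") (auto intro!: continuous_intros)
    qed
    then have "continuous_on (S \<times> UNIV)
        (\<lambda>z. blinfun_scaleR_left (pd l i f ((u (fst z))(l := u (fst z) l + snd z *\<^sub>R axis i 1))))"
      by (rule bounded_linear.continuous_on[OF bounded_linear_blinfun_scaleR_left])
    then show "continuous (at (e0, 0) within S \<times> UNIV)
        (\<lambda>(e, y). blinfun_scaleR_left (pd l i f ((u e)(l := u e l + y *\<^sub>R axis i 1))))"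
      using S(2) by (auto simp: continuous_on_eq_continuous_within case_prod_unfold)
  qed auto
  then have *: "((\<lambda>(e, y). \<phi> e y) has_derivative (\<lambda>(te, ty).
      (\<Sum>(l, i)\<in>J. (\<psi>' l te $ i) *\<^sub>R pd l i f (\<lambda>l. \<psi> l e0)) + ty *\<^sub>R pd l i f (\<lambda>l. \<psi> l e0))) (at (e0, h e0))"
    using S unfolding u0' by (simp add: at_within_open[OF _ open_Times] h_def)
  have "((\<lambda>e. (e, h e)) has_derivative (\<lambda>v. (v, \<psi>' l v $ i))) (at e0)"
    unfolding h_def using deriv
    by (auto intro!: derivative_eq_intros bounded_linear.has_derivative[OF bounded_linear_vec_nth])
  from has_derivative_compose[OF this *] show ?case
    unfolding eq using insert.hyps by (simp add: li add.commute)
qed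

lemma diff_fun_has_derivative:
  fixes f :: "'n::finite jet \<Rightarrow> 'b::real_normed_vector" and \<psi> :: "nat \<Rightarrow> 'a::real_normed_vector \<Rightarrow> real ^ 'n"
  assumes f: "diff_fun f" "jet_order K f" and S: "open S" "e \<in> S" and \<psi>: "\<And>l. smooth_on S (\<psi> l)"
  shows "((\<lambda>e. f (\<lambda>l. \<psi> l e)) has_derivative
    (\<lambda>v. \<Sum>l\<le>K. \<Sum>i\<in>UNIV. (frechet_derivative (\<psi> l) (at e) v $ i) *\<^sub>R pd l i f (\<lambda>l. \<psi> l e))) (at e)"
proof -
  let ?J = "{..K} \<times> (UNIV :: 'n set)"
  have "f (\<lambda>l. \<chi> i. if (l, i) \<in> ?J then \<psi> l x $ i else \<psi> l e $ i) = f (\<lambda>l. \<psi> l x)" for x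
  proof -
    have "(\<chi> i. if (l, i) \<in> ?J then \<psi> l x $ i else \<psi> l e $ i) = \<psi> l x" if "l \<le> K" for l
      using that by (simp add: vec_eq_iff)
    then show ?thesis
      by (intro f(2)[unfolded jet_order_def, rule_format]) simp
  qed
  then show ?thesis
    using diff_fun_has_derivative_coordinates[OF f(1) S, of \<psi> "\<lambda>l. frechet_derivative (\<psi> l) (at e)" ?J]
      smooth_on_imp_continuous_on[OF \<psi>] smooth_on_has_derivative[OF \<psi> S(2)]
    by (simp add: sum.cartesian_product)
qed

lemma smooth_on_diff_fun:
  fixes f :: "'n::finite jet \<Rightarrow> 'b::real_normed_vector" and \<psi> :: "nat \<Rightarrow> 'a::real_normed_vector \<Rightarrow> real ^ 'n"
  assumes f: "diff_fun f" and S: "open S" and \<psi>: "\<And>l. smooth_on S (\<psi> l)"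
  shows "smooth_on S (\<lambda>e. f (\<lambda>l. \<psi> l e))"
proof -
  have "higher_differentiable_on S (\<lambda>e. f (\<lambda>l. \<psi> l e)) r" for r
    using f
  proof (induction r arbitrary: f)
    case 0
    then show ?case
      using smooth_on_imp_continuous_on[OF \<psi>] by (simp add: continuous_on_diff_fun)
  next
    case (Suc r)
    obtain K where K: "jet_order K f"
      using diff_fun_order[OF Suc.prems] by blast
    have D: "((\<lambda>e. f (\<lambda>l. \<psi> l e)) has_derivative (\<lambda>v. \<Sum>l\<le>K. \<Sum>i\<in>UNIV.
        (frechet_derivative (\<psi> l) (at e) v $ i) *\<^sub>R pd l i f (\<lambda>l. \<psi> l e))) (at e)" if "e \<in> S" for e
      by (rule diff_fun_has_derivative[OF Suc.prems K S that \<psi>])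
    have "higher_differentiable_on S (\<lambda>e. \<Sum>l\<le>K. \<Sum>i\<in>UNIV.
        (frechet_derivative (\<psi> l) (at e) v $ i) *\<^sub>R pd l i f (\<lambda>l. \<psi> l e)) r" for v
      using smooth_on_nth[OF S smooth_on_frechet_derivative[OF \<psi>]]
      by (intro higher_differentiable_on_sum[OF S] higher_differentiable_on_bilinear[OF S bounded_bilinear_scaleR]
          Suc.IH diff_fun_pd Suc.prems) (simp add: smooth_on_def)
    then have "higher_differentiable_on S (\<lambda>e. frechet_derivative (\<lambda>e. f (\<lambda>l. \<psi> l e)) (at e) v) r" for v
      by (rule higher_differentiable_on_cong[OF S, rotated]) (simp add: frechet_derivative_at[OF D, symmetric])
    then show ?case
      using D by (auto simp: differentiable_def)
  qed
  then show ?thesis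
    by (simp add: smooth_on_def)
qed

section \<open>Differential operators along a vector field\<close>

text \<open>
  These are the operators \<open>dird\<close>, \<open>jet\<close>, \<open>lin\<close>, \<open>lin_adj\<close> and \<open>ham_op\<close> with the constant direction replaced
  by a vector field.
\<close>

definition vd :: "('a::real_normed_vector \<Rightarrow> 'a) \<Rightarrow> ('a \<Rightarrow> 'b::real_normed_vector) \<Rightarrow> 'a \<Rightarrow> 'b" where
  "vd X g e = frechet_derivative g (at e) (X e)"

definition vjet :: "('a::real_normed_vector \<Rightarrow> 'a) \<Rightarrow> ('a \<Rightarrow> real ^ 'n) \<Rightarrow> 'a \<Rightarrow> 'n jet" where
  "vjet X \<psi> e l = (vd X ^^ l) \<psi> e"

definition vlin ::
  "('a::real_normed_vector \<Rightarrow> 'a) \<Rightarrow> ('n::finite jet \<Rightarrow> 'b::real_normed_vector)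
    \<Rightarrow> ('a \<Rightarrow> real ^ 'n) \<Rightarrow> ('a \<Rightarrow> real ^ 'n) \<Rightarrow> 'a \<Rightarrow> 'b" where
  "vlin X f \<psi> \<eta> e = (\<Sum>l. \<Sum>i\<in>UNIV. ((vd X ^^ l) \<eta> e $ i) *\<^sub>R pd l i f (vjet X \<psi> e))"

definition vadj ::
  "('a::real_normed_vector \<Rightarrow> 'a) \<Rightarrow> ('n::finite jet \<Rightarrow> real)
    \<Rightarrow> ('a \<Rightarrow> real ^ 'n) \<Rightarrow> ('a \<Rightarrow> real) \<Rightarrow> 'a \<Rightarrow> real ^ 'n" where
  "vadj X f \<psi> g e = (\<Sum>l. (- 1) ^ l *\<^sub>R (vd X ^^ l) (\<lambda>e. \<chi> i. pd l i f (vjet X \<psi> e) * g e) e)"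

definition vham ::
  "('a::real_normed_vector \<Rightarrow> 'a) \<Rightarrow> 'n::finite coeffs
    \<Rightarrow> ('a \<Rightarrow> real ^ 'n) \<Rightarrow> ('a \<Rightarrow> real ^ 'n) \<Rightarrow> 'a \<Rightarrow> real ^ 'n" where
  "vham X B \<psi> \<xi> e = (\<Sum>k. B k (vjet X \<psi> e) *v (vd X ^^ k) \<xi> e)"

lemma suminf_atMost:
  fixes f :: "nat \<Rightarrow> 'b::{comm_monoid_add,t2_space}"
  assumes "\<And>l. K < l \<Longrightarrow> f l = 0"
  shows "(\<Sum>l. f l) = (\<Sum>l\<le>K. f l)"
  by (rule suminf_finite) (use assms in auto)

lemma vlin_eq_sum:
  "jet_order K f \<Longrightarrow> vlin X f \<psi> \<eta> e = (\<Sum>l\<le>K. \<Sum>i\<in>UNIV. ((vd X ^^ l) \<eta> e $ i) *\<^sub>R pd l i f (vjet X \<psi> e))"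
  unfolding vlin_def by (rule suminf_atMost) (simp add: pd_above_order)

lemma funpow_const_fixed: "f x = x \<Longrightarrow> (f ^^ l) x = x"
  by (induction l) auto

lemma vd_const: "vd X (\<lambda>e. c) = (\<lambda>e. 0)"
  by (simp add: vd_def fun_eq_iff frechet_derivative_const)

lemma vd_pow_zero: "(vd X ^^ l) (\<lambda>e. 0) = (\<lambda>e. 0)"
  by (rule funpow_const_fixed) (rule vd_const)

lemma vadj_eq_sum:
  "jet_order K f \<Longrightarrow> vadj X f \<psi> g e =
    (\<Sum>l\<le>K. (- 1) ^ l *\<^sub>R (vd X ^^ l) (\<lambda>e. \<chi> i. pd l i f (vjet X \<psi> e) * g e) e)"
  unfolding vadj_def by (rule suminf_atMost) (simp add: pd_above_order zero_vec_def[symmetric] vd_pow_zero)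

lemma vham_eq_sum:
  "(\<And>k u. K < k \<Longrightarrow> B k u = 0) \<Longrightarrow> vham X B \<psi> \<xi> e = (\<Sum>k\<le>K. B k (vjet X \<psi> e) *v (vd X ^^ k) \<xi> e)"
  unfolding vham_def by (rule suminf_atMost) simp

lemma bounded_bilinear_matrix_vector: "bounded_bilinear ((*v) :: real ^ 'n ^ 'm \<Rightarrow> real ^ 'n \<Rightarrow> real ^ 'm)"
  unfolding bilinear_conv_bounded_bilinear[symmetric] bilinear_def
  by (auto intro!: linearI simp: matrix_vector_right_distrib matrix_vector_mult_add_rdistrib
      matrix_vector_mult_scaleR scaleR_matrix_vector_assoc)

locale vector_field =
  fixes S :: "'a::euclidean_space set" and X :: "'a \<Rightarrow> 'a"
  assumes open_S: "open S" and smooth_X: "smooth_on S X"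
begin

lemma smooth_vd:
  assumes "smooth_on S g"
  shows "smooth_on S (vd X g)"
proof (rule smooth_on_cong[OF open_S])
  show "smooth_on S (\<lambda>e. \<Sum>b\<in>Basis. (X e \<bullet> b) *\<^sub>R frechet_derivative g (at e) b)"
    by (intro smooth_on_sum smooth_on_scaleR smooth_on_inner smooth_on_const
        smooth_on_frechet_derivative open_S smooth_X assms)
qed (simp add: vd_def linear_sum_Basis[OF smooth_on_frechet_linear[OF assms]])

lemma smooth_vd_pow: "smooth_on S g \<Longrightarrow> smooth_on S ((vd X ^^ l) g)"
  by (induction l) (auto intro: smooth_vd)

lemma smooth_diff_fun_vjet:
  "diff_fun f \<Longrightarrow> smooth_on S \<psi> \<Longrightarrow> smooth_on S (\<lambda>e. f (vjet X \<psi> e))"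
  unfolding vjet_def by (rule smooth_on_diff_fun[OF _ open_S smooth_vd_pow])

lemma vd_cong: "(\<And>e. e \<in> S \<Longrightarrow> f e = g e) \<Longrightarrow> e \<in> S \<Longrightarrow> vd X f e = vd X g e"
  unfolding vd_def using frechet_derivative_transform_open[OF open_S] by metis

lemma vd_pow_cong: "(\<And>e. e \<in> S \<Longrightarrow> f e = g e) \<Longrightarrow> e \<in> S \<Longrightarrow> (vd X ^^ l) f e = (vd X ^^ l) g e"
  by (induction l arbitrary: e) (auto intro: vd_cong)

lemma vd_bounded_linear:
  assumes "bounded_linear L" "smooth_on S f" "e \<in> S"
  shows "vd X (\<lambda>e. L (f e)) e = L (vd X f e)"
  unfolding vd_def
  using frechet_derivative_at[OF bounded_linear.has_derivative[OF assms(1) smooth_on_has_derivative[OF assms(2,3)]]]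
  by metis

lemma vd_pow_bounded_linear:
  assumes "bounded_linear L" "smooth_on S f" "e \<in> S"
  shows "(vd X ^^ l) (\<lambda>e. L (f e)) e = L ((vd X ^^ l) f e)"
  using assms(3)
proof (induction l arbitrary: e)
  case (Suc l)
  then show ?case
    using vd_cong[OF Suc.IH] vd_bounded_linear[OF assms(1) smooth_vd_pow[OF assms(2)]] by simp
qed simp

lemma vd_bilinear:
  assumes "bounded_bilinear pr" "smooth_on S f" "smooth_on S g" "e \<in> S"
  shows "vd X (\<lambda>e. pr (f e) (g e)) e = pr (f e) (vd X g e) + pr (vd X f e) (g e)"
  unfolding vd_def
  using frechet_derivative_at[OF bounded_bilinear.FDERIV[OF assms(1) smooth_on_has_derivative[OF assms(2,4)]
        smooth_on_has_derivative[OF assms(3,4)]]]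
  by metis

lemma vd_add:
  assumes "smooth_on S f" "smooth_on S g" "e \<in> S"
  shows "vd X (\<lambda>e. f e + g e) e = vd X f e + vd X g e"
  unfolding vd_def
  using frechet_derivative_at[OF has_derivative_add[OF smooth_on_has_derivative[OF assms(1,3)]
        smooth_on_has_derivative[OF assms(2,3)]]]
  by metis

lemma vd_sum:
  assumes "\<And>i. i \<in> I \<Longrightarrow> smooth_on S (f i)" "e \<in> S"
  shows "vd X (\<lambda>e. \<Sum>i\<in>I. f i e) e = (\<Sum>i\<in>I. vd X (f i) e)"
  using assms(1)
proof (induction I rule: infinite_finite_induct)
  case (insert i I)
  then show ?case
    using vd_add[of "f i" "\<lambda>e. \<Sum>i\<in>I. f i e", OF _ _ assms(2)] smooth_on_sum[OF open_S, of I f] by simp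
qed (simp_all add: vd_const)

lemma vd_pow_sum:
  assumes "\<And>i. i \<in> I \<Longrightarrow> smooth_on S (f i)" "e \<in> S"
  shows "(vd X ^^ l) (\<lambda>e. \<Sum>i\<in>I. f i e) e = (\<Sum>i\<in>I. (vd X ^^ l) (f i) e)"
  using assms(2)
proof (induction l arbitrary: e)
  case (Suc l)
  then show ?case
    using vd_cong[OF Suc.IH] vd_sum[OF smooth_vd_pow[OF assms(1)]] by simp
qed simp

text \<open>Chain rule through the jet for an arbitrary direction \<open>v\<close>. If
  differentiation along \<open>v\<close> commutes with that along \<open>X\<close>, the series is
  \<open>vlin\<close> of the derivative of \<psi>; otherwise commutators appear, and for a change of
  the wave numbers these make up \<open>vmom\<close>.\<close>

lemma frechet_diff_fun_vjet:
  assumes "diff_fun f" "smooth_on S \<psi>" "e \<in> S"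
  shows "frechet_derivative (\<lambda>e. f (vjet X \<psi> e)) (at e) v
    = (\<Sum>l. \<Sum>i\<in>UNIV. (frechet_derivative ((vd X ^^ l) \<psi>) (at e) v $ i) *\<^sub>R pd l i f (vjet X \<psi> e))"
proof -
  obtain K where K: "jet_order K f"
    using diff_fun_order[OF assms(1)] by blast
  have "frechet_derivative (\<lambda>e. f (vjet X \<psi> e)) (at e) v
    = (\<Sum>l\<le>K. \<Sum>i\<in>UNIV. (frechet_derivative ((vd X ^^ l) \<psi>) (at e) v $ i) *\<^sub>R pd l i f (vjet X \<psi> e))"
    using frechet_derivative_at[OF diff_fun_has_derivative[where \<psi> = "\<lambda>l. (vd X ^^ l) \<psi>",
        OF assms(1) K open_S assms(3) smooth_vd_pow[OF assms(2)]], symmetric]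
    by (simp add: vjet_def[abs_def])
  then show ?thesis
    by (subst suminf_atMost[of K]) (simp_all add: pd_above_order[OF K])
qed

lemma smooth_vlin:
  assumes "diff_fun f" "smooth_on S \<psi>" "smooth_on S \<eta>"
  shows "smooth_on S (vlin X f \<psi> \<eta>)"
proof -
  obtain K where K: "jet_order K f"
    using diff_fun_order[OF assms(1)] by blast
  show ?thesis
    unfolding vlin_eq_sum[OF K, abs_def]
    by (intro smooth_on_sum smooth_on_scaleR smooth_on_nth smooth_vd_pow smooth_diff_fun_vjet diff_fun_pd assms open_S)
qed

lemma smooth_vadj_term:
  fixes f :: "'n::finite jet \<Rightarrow> real"
  assumes "diff_fun f" "smooth_on S \<psi>" "smooth_on S g"
  shows "smooth_on S (\<lambda>e. \<chi> i. pd l i f (vjet X \<psi> e) * g e)"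
  by (intro smooth_on_vec_lambda smooth_on_mult smooth_diff_fun_vjet diff_fun_pd assms open_S)

lemma smooth_vadj:
  assumes "diff_fun f" "smooth_on S \<psi>" "smooth_on S g"
  shows "smooth_on S (vadj X f \<psi> g)"
proof -
  obtain K where K: "jet_order K f"
    using diff_fun_order[OF assms(1)] by blast
  show ?thesis
    unfolding vadj_eq_sum[OF K, abs_def]
    by (intro smooth_on_sum smooth_on_scaleR smooth_on_const smooth_vd_pow smooth_vadj_term assms open_S)
qed

lemma smooth_vham:
  assumes "\<And>k. diff_fun (B k)" "\<And>k u. K < k \<Longrightarrow> B k u = 0" "smooth_on S \<psi>" "smooth_on S \<xi>"
  shows "smooth_on S (vham X B \<psi> \<xi>)"
proof -
  have "vham X B \<psi> \<xi> = (\<lambda>e. \<Sum>k\<le>K. B k (vjet X \<psi> e) *v (vd X ^^ k) \<xi> e)"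
    by (intro ext vham_eq_sum assms(2))
  then show ?thesis
    by (simp only:) (intro smooth_on_sum smooth_on_bilinear[OF _ bounded_bilinear_matrix_vector]
      smooth_vd_pow smooth_diff_fun_vjet assms open_S)
qed

text \<open>
  Along a map \<open>c\<close> that carries the direction \<open>\<kappa>\<close> to \<open>X\<close>, in particular along an integral curve,
  the operators with direction \<open>\<kappa>\<close> are pulled back from those along \<open>X\<close>.
\<close>

context
  fixes c :: "'c::real_normed_vector \<Rightarrow> 'a" and c' :: "'c \<Rightarrow> 'c \<Rightarrow> 'a" and \<kappa> :: 'c
  assumes c: "\<And>a. (c has_derivative c' a) (at a)" "\<And>a. c' a \<kappa> = X (c a)" "\<And>a. c a \<in> S"
begin

lemma dird_compose:
  assumes "smooth_on S g"
  shows "dird \<kappa> (\<lambda>a. g (c a)) a = vd X g (c a)"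
proof -
  have lin: "linear (c' a)"
    using c(1) has_derivative_linear by blast
  have "((\<lambda>h. a + h *\<^sub>R \<kappa>) has_derivative (\<lambda>h. h *\<^sub>R \<kappa>)) (at 0)"
    by (auto intro!: derivative_eq_intros)
  moreover have "((\<lambda>a. g (c a)) has_derivative (\<lambda>v. frechet_derivative g (at (c a)) (c' a v))) (at (a + 0 *\<^sub>R \<kappa>))"
    using has_derivative_frechet_chain[OF c(1) smooth_on_imp_differentiable[OF assms c(3)]] by simp
  ultimately have "((\<lambda>h. g (c (a + h *\<^sub>R \<kappa>))) has_derivative (\<lambda>h. frechet_derivative g (at (c a)) (c' a (h *\<^sub>R \<kappa>)))) (at 0)"
    by (rule has_derivative_compose[where f = "\<lambda>h. a + h *\<^sub>R \<kappa>" and g = "\<lambda>a. g (c a)"])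
  then have "((\<lambda>h. g (c (a + h *\<^sub>R \<kappa>))) has_vector_derivative vd X g (c a)) (at 0)"
    by (simp add: has_vector_derivative_def linear_scale[OF lin]
        linear_scale[OF smooth_on_frechet_linear[OF assms c(3)]] c(2) vd_def)
  then show ?thesis
    unfolding dird_def by (rule vector_derivative_at)
qed

lemma dird_pow_compose:
  "smooth_on S g \<Longrightarrow> (dird \<kappa> ^^ l) (\<lambda>a. g (c a)) = (\<lambda>a. (vd X ^^ l) g (c a))"
  by (induction l) (auto simp: dird_compose[OF smooth_vd_pow])

lemma jet_compose: "smooth_on S \<psi> \<Longrightarrow> jet \<kappa> (\<lambda>a. \<psi> (c a)) a = vjet X \<psi> (c a)"
  by (simp add: fun_eq_iff jet_def vjet_def dird_pow_compose)

lemma lin_compose: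
  "smooth_on S \<psi> \<Longrightarrow> smooth_on S \<eta> \<Longrightarrow> lin \<kappa> f (\<lambda>a. \<psi> (c a)) (\<lambda>a. \<eta> (c a)) a = vlin X f \<psi> \<eta> (c a)"
  by (simp add: lin_def vlin_def dird_pow_compose jet_compose)

lemma lin_adj_compose:
  assumes "diff_fun f" "smooth_on S \<psi>" "smooth_on S g"
  shows "lin_adj \<kappa> f (\<lambda>a. \<psi> (c a)) (\<lambda>a. g (c a)) a = vadj X f \<psi> g (c a)"
proof -
  have "(dird \<kappa> ^^ l) (\<lambda>a. \<chi> i. pd l i f (jet \<kappa> (\<lambda>a. \<psi> (c a)) a) \<bullet> g (c a))
      = (\<lambda>a. (vd X ^^ l) (\<lambda>e. \<chi> i. pd l i f (vjet X \<psi> e) * g e) (c a))" for l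
    using dird_pow_compose[OF smooth_vadj_term[OF assms]] by (simp add: jet_compose assms)
  then show ?thesis
    by (simp add: lin_adj_def vadj_def)
qed

lemma ham_op_compose:
  "smooth_on S \<psi> \<Longrightarrow> smooth_on S \<xi> \<Longrightarrow> ham_op \<kappa> B (\<lambda>a. \<psi> (c a)) (\<lambda>a. \<xi> (c a)) a = vham X B \<psi> \<xi> (c a)"
  by (simp add: ham_op_def vham_def dird_pow_compose jet_compose)

lemma var_deriv_compose:
  "diff_fun f \<Longrightarrow> smooth_on S \<psi> \<Longrightarrow> var_deriv \<kappa> f (\<lambda>a. \<psi> (c a)) = (\<lambda>a. vadj X f \<psi> (\<lambda>_. 1) (c a))"
  unfolding var_deriv_def fun_eq_iff using lin_adj_compose[OF _ _ smooth_on_const] by blast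

lemma ham_flow_compose:
  "diff_fun f \<Longrightarrow> smooth_on S \<psi> \<Longrightarrow>
    ham_flow \<kappa> B f (\<lambda>a. \<psi> (c a)) a = vham X B \<psi> (vadj X f \<psi> (\<lambda>_. 1)) (c a)"
  unfolding ham_flow_def
  by (simp add: var_deriv_compose ham_op_compose smooth_vadj smooth_on_const)

end

end

section \<open>Test functions\<close>

text \<open>The powers of 1/x are included so that the span of the family is closed under
  differentiation; smoothness of all members is then one induction.\<close>

definition flat_exp :: "nat \<Rightarrow> real \<Rightarrow> real" where
  "flat_exp k x = (if 0 < x then inverse x ^ k * exp (- inverse x) else 0)"

lemma flat_exp_tendsto: "(flat_exp k \<longlongrightarrow> 0) (at 0)"
proof (rule filterlim_split_at)
  show "(flat_exp k \<longlongrightarrow> 0) (at_left 0)"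
    by (rule tendsto_eventually) (auto simp: flat_exp_def eventually_at_left_field intro!: exI[of _ "- 1"])
  have "((\<lambda>x. inverse x ^ k / exp (inverse x)) \<longlongrightarrow> 0) (at_right (0 :: real))"
    using filterlim_compose[OF tendsto_power_div_exp_0 filterlim_inverse_at_top_right] .
  moreover have "\<forall>\<^sub>F x in at_right 0. inverse x ^ k / exp (inverse x) = flat_exp k x"
    by (auto simp: flat_exp_def eventually_at_right_field exp_minus divide_inverse intro!: exI[of _ 1])
  ultimately show "(flat_exp k \<longlongrightarrow> 0) (at_right 0)"
    by (rule Lim_transform_eventually)
qed

lemma flat_exp_has_derivative:
  "(flat_exp k has_real_derivative flat_exp (k + 2) x - real k * flat_exp (k + 1) x) (at x)"
proof -
  consider "x < 0" | "x = 0" | "x > 0"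
    by linarith
  then show ?thesis
  proof cases
    case 1
    have "((\<lambda>_. 0) has_real_derivative 0) (at x)"
      by simp
    then have "(flat_exp k has_real_derivative 0) (at x)"
      by (rule has_field_derivative_transform_within_open[where S = "{..<0}"]) (use 1 in \<open>auto simp: flat_exp_def\<close>)
    then show ?thesis
      using 1 by (simp add: flat_exp_def)
  next
    case 2
    \<comment> \<open>At the origin the difference quotient of one member of the family is the next
      member, which tends to 0.\<close>
    have "\<forall>\<^sub>F h in at 0. flat_exp (k + 1) h = (flat_exp k (0 + h) - flat_exp k 0) / h"
      by (auto simp: flat_exp_def eventually_at_filter divide_inverse)
    from Lim_transform_eventually[OF flat_exp_tendsto this] show ?thesis
      unfolding 2 DERIV_def by (simp add: flat_exp_def)
  next
    case 3
    have "((\<lambda>x. inverse x ^ k * exp (- inverse x)) has_real_derivative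
        inverse x ^ k * (exp (- inverse x) * (inverse x * inverse x))
          - real k * inverse x ^ (k - 1) * (inverse x * inverse x) * exp (- inverse x)) (at x)"
      using 3 by (auto intro!: derivative_eq_intros simp: algebra_simps)
    moreover have "inverse x ^ k * (exp (- inverse x) * (inverse x * inverse x))
          - real k * inverse x ^ (k - 1) * (inverse x * inverse x) * exp (- inverse x)
        = flat_exp (k + 2) x - real k * flat_exp (k + 1) x"
      using 3 by (cases k) (simp_all add: flat_exp_def algebra_simps)
    ultimately have "((\<lambda>x. inverse x ^ k * exp (- inverse x)) has_real_derivative
        flat_exp (k + 2) x - real k * flat_exp (k + 1) x) (at x)"
      by (simp only:)
    then show ?thesis
      by (rule has_field_derivative_transform_within_open[where S = "{0<..}"]) (use 3 in \<open>auto simp: flat_exp_def\<close>)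
  qed
qed

lemma smooth_flat_exp: "smooth_on UNIV (flat_exp k)"
proof -
  have "higher_differentiable_on UNIV (flat_exp k) r" for r
  proof (induction r arbitrary: k)
    case 0
    show ?case
      using flat_exp_has_derivative[THEN DERIV_isCont] by (auto intro!: continuous_at_imp_continuous_on)
  next
    case (Suc r)
    have "frechet_derivative (flat_exp k) (at x) v = v *\<^sub>R (flat_exp (k + 2) x + (- real k) *\<^sub>R flat_exp (k + 1) x)" for x v
      using frechet_derivative_at[OF flat_exp_has_derivative[unfolded has_field_derivative_def], symmetric]
      by (simp add: mult.commute)
    moreover have "higher_differentiable_on UNIV (\<lambda>x. v *\<^sub>R (flat_exp (k + 2) x + (- real k) *\<^sub>R flat_exp (k + 1) x)) r" for v
      by (intro higher_differentiable_on_bounded_linear[OF open_UNIV bounded_linear_scaleR_right]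
          higher_differentiable_on_add Suc.IH open_UNIV)
    moreover have "flat_exp k differentiable (at x)" for x
      using flat_exp_has_derivative[of k x] by (auto simp: has_field_derivative_def differentiable_def)
    ultimately show ?case
      by (simp only: higher_differentiable_on.simps) auto
  qed
  then show ?thesis
    by (simp add: smooth_on_def)
qed

lemma smooth_on_flat_exp_compose: "smooth_on UNIV f \<Longrightarrow> smooth_on UNIV (\<lambda>x. flat_exp k (f x))"
  by (rule smooth_on_compose[OF _ open_UNIV _ smooth_flat_exp]) auto

lemma exists_smooth_bump:
  obtains \<beta> :: "real \<Rightarrow> real" where "smooth_on UNIV \<beta>" "\<And>x. 0 \<le> \<beta> x" "0 < \<beta> 0" "\<And>x. 1 < \<bar>x\<bar> \<Longrightarrow> \<beta> x = 0"
proof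
  let ?\<beta> = "\<lambda>x. flat_exp 0 (x + 1) * flat_exp 0 (1 - x)"
  show "smooth_on UNIV ?\<beta>"
    by (intro smooth_on_mult smooth_on_flat_exp_compose smooth_on_add smooth_on_diff smooth_on_const smooth_on_ident) auto
qed (auto simp: flat_exp_def)

lemma exists_smooth_plateau:
  obtains \<rho> :: "real \<Rightarrow> real" where "smooth_on UNIV \<rho>" "\<And>x. \<bar>x\<bar> \<le> 2 \<Longrightarrow> \<rho> x = 1" "\<And>x. 3 < \<bar>x\<bar> \<Longrightarrow> \<rho> x = 0"
proof
  \<comment> \<open>A smooth step, 0 for x \<le> 0 and 1 for x \<ge> 1. The product of its
    translates at 3 + x and 3 - x is the plateau.\<close>
  let ?s = "\<lambda>x::real. flat_exp 0 x * inverse (flat_exp 0 x + flat_exp 0 (1 - x))"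
  have pos: "0 < flat_exp 0 x + flat_exp 0 (1 - x)" for x
    by (auto simp: flat_exp_def add_pos_pos)
  have s: "smooth_on UNIV (\<lambda>x. ?s (f x))" if "smooth_on UNIV f" for f :: "real \<Rightarrow> real"
    using pos by (intro smooth_on_mult smooth_on_inverse smooth_on_flat_exp_compose smooth_on_add smooth_on_diff
        smooth_on_const that) (auto simp: less_le)
  show "smooth_on UNIV (\<lambda>x. ?s (3 + x) * ?s (3 - x))"
    by (intro smooth_on_mult s smooth_on_add smooth_on_diff smooth_on_const smooth_on_ident) auto
qed (auto simp: flat_exp_def)

section \<open>Skew-symmetry of a local Poisson bracket\<close>

lemma bounded_bilinear_vector_matrix: "bounded_bilinear ((v*) :: real ^ 'm \<Rightarrow> real ^ 'n ^ 'm \<Rightarrow> real ^ 'n)"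
  unfolding bilinear_conv_bounded_bilinear[symmetric] bilinear_def
  by (auto intro!: linearI simp: vector_matrix_mult_def vec_eq_iff sum.distrib algebra_simps sum_distrib_left)

text \<open>The formal adjoint of \<open>vham\<close>: transposed coefficients, which is what the
  product with a row vector means, and derivatives outside. The bound \<open>K\<close> makes the sum
  finite by construction.\<close>

definition vham_adj ::
  "nat \<Rightarrow> ('a::real_normed_vector \<Rightarrow> 'a) \<Rightarrow> 'n::finite coeffs
    \<Rightarrow> ('a \<Rightarrow> real ^ 'n) \<Rightarrow> ('a \<Rightarrow> real ^ 'n) \<Rightarrow> 'a \<Rightarrow> real ^ 'n" where
  "vham_adj K X B \<psi> \<xi> e = (\<Sum>k\<le>K. (- 1) ^ k *\<^sub>R (vd X ^^ k) (\<lambda>e. \<xi> e v* B k (vjet X \<psi> e)) e)"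

context vector_field
begin

lemma smooth_vham_adj_term:
  fixes B :: "'n::finite coeffs"
  shows "diff_fun (B k) \<Longrightarrow> smooth_on S \<psi> \<Longrightarrow> smooth_on S \<xi> \<Longrightarrow> smooth_on S (\<lambda>e. \<xi> e v* B k (vjet X \<psi> e))"
  by (intro smooth_on_bilinear[OF _ bounded_bilinear_vector_matrix] smooth_diff_fun_vjet open_S)

lemma smooth_vham_adj:
  fixes B :: "'n::finite coeffs"
  assumes "\<And>k. diff_fun (B k)" "smooth_on S \<psi>" "smooth_on S \<xi>"
  shows "smooth_on S (vham_adj K X B \<psi> \<xi>)"
  unfolding vham_adj_def[abs_def]
  by (intro smooth_on_sum smooth_on_scaleR smooth_on_const smooth_vd_pow smooth_vham_adj_term assms open_S)

end

interpretation line: vector_field UNIV "\<lambda>_::real. 1 :: real"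
  by standard (auto intro: smooth_on_const)

abbreviation line_d :: "(real \<Rightarrow> 'b::real_normed_vector) \<Rightarrow> real \<Rightarrow> 'b" where
  "line_d \<equiv> vd (\<lambda>_. 1)"

lemma line_has_derivative: "((\<lambda>a::real. a) has_derivative (\<lambda>v. v)) (at a)"
  by (rule has_derivative_ident)

lemmas line_dird_pow = line.dird_pow_compose[OF line_has_derivative refl UNIV_I]
  and line_ham_op = line.ham_op_compose[OF line_has_derivative refl UNIV_I]

lemma line_d_has_vector_derivative:
  assumes "smooth_on UNIV g"
  shows "(g has_vector_derivative line_d g x) (at x)"
proof -
  have "frechet_derivative g (at x) h = h *\<^sub>R line_d g x" for h
    using linear_scale[OF smooth_on_frechet_linear[OF assms UNIV_I], of x h 1] by (simp add: vd_def)
  then have eq: "frechet_derivative g (at x) = (\<lambda>h. h *\<^sub>R line_d g x)"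
    by (rule ext)
  show ?thesis
    using smooth_on_has_derivative[OF assms UNIV_I, of x] by (simp only: has_vector_derivative_def eq)
qed

lemma line_d_zero_outside:
  assumes "\<And>x. R < \<bar>x\<bar> \<Longrightarrow> b x = 0" "R < \<bar>x\<bar>"
  shows "(line_d ^^ k) b x = 0"
proof -
  interpret out: vector_field "{x. R < \<bar>x\<bar>}" "\<lambda>_::real. 1 :: real"
    by standard (auto intro!: smooth_on_const open_Collect_less continuous_intros)
  have "(line_d ^^ k) b x = (line_d ^^ k) (\<lambda>_. 0) x"
    by (rule out.vd_pow_cong) (use assms in auto)
  then show ?thesis
    by (simp add: vd_pow_zero)
qed

lemma integral_supported:
  fixes f :: "real \<Rightarrow> real"
  assumes "\<And>x. R < \<bar>x\<bar> \<Longrightarrow> f x = 0"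
  shows "integral UNIV f = integral {-R..R} f"
proof -
  have "(\<lambda>x. if x \<in> {-R..R} then f x else 0) = f"
    using assms by (auto simp: fun_eq_iff abs_if not_le)
  then show ?thesis
    using Henstock_Kurzweil_Integration.integral_restrict_UNIV[of "{-R..R}" f] by simp
qed

lemma line_integration_by_parts:
  fixes a b :: "real \<Rightarrow> real ^ 'n"
  assumes a: "smooth_on UNIV a" and b: "smooth_on UNIV b" and R: "0 < R" "\<And>x. R \<le> \<bar>x\<bar> \<Longrightarrow> a x \<bullet> b x = 0"
  shows "integral {-R..R} (\<lambda>x. a x \<bullet> line_d b x) = - integral {-R..R} (\<lambda>x. line_d a x \<bullet> b x)"
proof -
  have "((\<lambda>x. a x \<bullet> b x) has_vector_derivative a x \<bullet> line_d b x + line_d a x \<bullet> b x) (at x)" for x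
    using line_d_has_vector_derivative[OF smooth_on_inner[OF open_UNIV a b], of x]
      line.vd_bilinear[OF bounded_bilinear_inner a b, of x] by simp
  then have "((\<lambda>x. a x \<bullet> line_d b x + line_d a x \<bullet> b x) has_integral a R \<bullet> b R - a (- R) \<bullet> b (- R)) {-R..R}"
    using R(1) by (intro fundamental_theorem_of_calculus[where f = "\<lambda>x. a x \<bullet> b x"]) (simp, rule has_vector_derivative_at_within)
  then have "integral {-R..R} (\<lambda>x. a x \<bullet> line_d b x + line_d a x \<bullet> b x) = 0"
    using R(1) R(2)[of R] R(2)[of "- R"] by (simp add: integral_unique)
  moreover have "integral {-R..R} (\<lambda>x. a x \<bullet> line_d b x + line_d a x \<bullet> b x)
    = integral {-R..R} (\<lambda>x. a x \<bullet> line_d b x) + integral {-R..R} (\<lambda>x. line_d a x \<bullet> b x)"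
    by (intro integral_add integrable_continuous_real continuous_on_subset[OF smooth_on_imp_continuous_on, OF _ subset_UNIV]
        smooth_on_inner line.smooth_vd a b open_UNIV)
  ultimately show ?thesis
    by simp
qed

text \<open>The strict inequality \<open>R' < R\<close> puts both endpoints into the open set on
  which \<open>b\<close>, and with it every derivative of \<open>b\<close>, vanishes.\<close>

lemma line_integration_by_parts_pow:
  fixes a b :: "real \<Rightarrow> real ^ 'n"
  assumes a: "smooth_on UNIV a" and b: "smooth_on UNIV b" and R: "0 < R" "\<And>x. R' < \<bar>x\<bar> \<Longrightarrow> b x = 0" "R' < R"
  shows "integral {-R..R} (\<lambda>x. a x \<bullet> (line_d ^^ k) b x)
    = (- 1) ^ k * integral {-R..R} (\<lambda>x. (line_d ^^ k) a x \<bullet> b x)"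
  using a
proof (induction k arbitrary: a)
  case (Suc k)
  have "a x \<bullet> (line_d ^^ k) b x = 0" if "R \<le> \<bar>x\<bar>" for x
    using line_d_zero_outside[OF R(2)] that R(3) by simp
  then have "integral {-R..R} (\<lambda>x. a x \<bullet> (line_d ^^ Suc k) b x)
      = - integral {-R..R} (\<lambda>x. line_d a x \<bullet> (line_d ^^ k) b x)"
    using line_integration_by_parts[OF Suc.prems line.smooth_vd_pow[OF b] R(1), of k] by simp
  also have "\<dots> = (- 1) ^ Suc k * integral {-R..R} (\<lambda>x. (line_d ^^ k) (line_d a) x \<bullet> b x)"
    using Suc.IH[OF line.smooth_vd[OF Suc.prems]] by simp
  finally show ?case
    by (simp add: funpow_swap1)
qed simp

text \<open>The bracket is skew only after smearing with test functions. The pointwise statement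
  follows by localization: cut \<eta> off to a test function, let \<open>u\<close> be the sum of the
  operator and its adjoint applied to it, and smear against a bump times \<open>u\<close>
  itself.\<close>

lemma line_vham_skew:
  fixes B :: "'n::finite coeffs" and \<phi> \<eta> :: "real \<Rightarrow> real ^ 'n"
  assumes B: "local_poisson_bracket B" and K: "\<And>k u. K < k \<Longrightarrow> B k u = 0"
    and \<phi>: "smooth_on UNIV \<phi>" and \<eta>: "smooth_on UNIV \<eta>"
  shows "vham (\<lambda>_. 1) B \<phi> \<eta> 0 = - vham_adj K (\<lambda>_. 1) B \<phi> \<eta> 0"
proof -
  have Bk: "diff_fun (B k)" for k
    using B by (simp add: local_poisson_bracket_def)
  have skew: "smeared_bracket B \<phi> p q = - smeared_bracket B \<phi> q p" if "test_fun p" "test_fun q" for p q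
    using B \<phi> that unfolding local_poisson_bracket_def by blast
  obtain \<rho> :: "real \<Rightarrow> real" where \<rho>: "smooth_on UNIV \<rho>" "\<And>x. \<bar>x\<bar> \<le> 2 \<Longrightarrow> \<rho> x = 1" "\<And>x. 3 < \<bar>x\<bar> \<Longrightarrow> \<rho> x = 0"
    using exists_smooth_plateau by blast
  obtain \<beta> :: "real \<Rightarrow> real" where \<beta>: "smooth_on UNIV \<beta>" "\<And>x. 0 \<le> \<beta> x" "0 < \<beta> 0" "\<And>x. 1 < \<bar>x\<bar> \<Longrightarrow> \<beta> x = 0"
    using exists_smooth_bump by blast
  \<comment> \<open>The plateau makes \<open>q\<close> a test function that equals \<eta> on (-2,
    2), hence has the same jet as \<eta> at 0.\<close>
  define q where "q = (\<lambda>x. \<rho> x *\<^sub>R \<eta> x)"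
  have q: "smooth_on UNIV q"
    unfolding q_def by (intro smooth_on_scaleR \<rho> \<eta> open_UNIV)
  define u where "u = (\<lambda>x. vham (\<lambda>_. 1) B \<phi> q x + vham_adj K (\<lambda>_. 1) B \<phi> q x)"
  have u: "smooth_on UNIV u"
    unfolding u_def by (intro smooth_on_add line.smooth_vham[OF Bk K] line.smooth_vham_adj Bk \<phi> q open_UNIV)
  \<comment> \<open>With this choice the integrand \<open>p x \<bullet> u x\<close> is \<beta> times
    the square of the norm of \<open>u\<close>. A vanishing integral of a continuous nonnegative
    function forces it to vanish, and \<beta> is positive at 0.\<close>
  define p where "p = (\<lambda>x. \<beta> x *\<^sub>R u x)"
  have p: "smooth_on UNIV p"
    unfolding p_def by (intro smooth_on_scaleR \<beta> u open_UNIV)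
  have p0: "p x = 0" if "1 < \<bar>x\<bar>" for x
    using \<beta>(4)[OF that] by (simp add: p_def)
  have q0: "q x = 0" if "3 < \<bar>x\<bar>" for x
    using \<rho>(3)[OF that] by (simp add: q_def)
  have "test_fun p" "test_fun q"
    using p q p0 q0 by (auto simp: test_fun_def)
  \<comment> \<open>The interval [-4, 4] contains the supports of \<open>p\<close> (in [-1, 1]) and
    \<open>q\<close> (in [-3, 3]) in its interior, so no boundary terms arise.\<close>
  have cont: "(\<lambda>x. f x \<bullet> g x) integrable_on {-4..4}" if "smooth_on UNIV f" "smooth_on UNIV g"
    for f g :: "real \<Rightarrow> real ^ 'n"
    by (intro integrable_continuous_real continuous_on_subset[OF smooth_on_imp_continuous_on, OF _ subset_UNIV]
        smooth_on_inner that open_UNIV)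
  have "integral {-4..4} (\<lambda>x. p x \<bullet> vham (\<lambda>_. 1) B \<phi> q x) = smeared_bracket B \<phi> p q"
    unfolding smeared_bracket_def line_ham_op[OF \<phi> q] by (rule integral_supported[symmetric]) (use p0 in auto)
  also have "\<dots> = - integral {-4..4} (\<lambda>x. q x \<bullet> vham (\<lambda>_. 1) B \<phi> p x)"
    unfolding skew[OF \<open>test_fun p\<close> \<open>test_fun q\<close>]
    unfolding smeared_bracket_def line_ham_op[OF \<phi> p] by (subst integral_supported[of 4]) (use q0 in auto)
  also have "integral {-4..4} (\<lambda>x. q x \<bullet> vham (\<lambda>_. 1) B \<phi> p x)
      = integral {-4..4} (\<lambda>x. \<Sum>k\<le>K. (q x v* B k (vjet (\<lambda>_. 1) \<phi> x)) \<bullet> (line_d ^^ k) p x)"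
    by (simp add: vham_eq_sum[OF K] inner_sum_right dot_lmul_matrix)
  also have "\<dots> = (\<Sum>k\<le>K. integral {-4..4} (\<lambda>x. (q x v* B k (vjet (\<lambda>_. 1) \<phi> x)) \<bullet> (line_d ^^ k) p x))"
    by (intro integral_sum cont line.smooth_vham_adj_term line.smooth_vd_pow Bk \<phi> p q) auto
  also have "\<dots> = (\<Sum>k\<le>K. integral {-4..4} (\<lambda>x. ((- 1) ^ k *\<^sub>R (line_d ^^ k) (\<lambda>x. q x v* B k (vjet (\<lambda>_. 1) \<phi> x)) x) \<bullet> p x))"
    by (intro sum.cong refl, subst line_integration_by_parts_pow[where R' = 1])
      (auto intro!: line.smooth_vham_adj_term Bk \<phi> p q p0)
  also have "\<dots> = integral {-4..4} (\<lambda>x. \<Sum>k\<le>K. ((- 1) ^ k *\<^sub>R (line_d ^^ k) (\<lambda>x. q x v* B k (vjet (\<lambda>_. 1) \<phi> x)) x) \<bullet> p x)"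
    by (intro integral_sum[symmetric] cont smooth_on_scaleR smooth_on_const line.smooth_vham_adj_term line.smooth_vd_pow Bk \<phi> p q) auto
  also have "\<dots> = integral {-4..4} (\<lambda>x. p x \<bullet> vham_adj K (\<lambda>_. 1) B \<phi> q x)"
    by (simp add: vham_adj_def inner_sum_right inner_commute)
  finally have "integral {-4..4} (\<lambda>x. p x \<bullet> vham (\<lambda>_. 1) B \<phi> q x)
      + integral {-4..4} (\<lambda>x. p x \<bullet> vham_adj K (\<lambda>_. 1) B \<phi> q x) = 0"
    by simp
  then have "integral {-4..4} (\<lambda>x. p x \<bullet> u x) = 0"
    unfolding u_def inner_add_right
    by (subst integral_add) (auto intro!: cont line.smooth_vham[OF Bk K] line.smooth_vham_adj Bk \<phi> p q)
  moreover have "continuous_on {-4..4} (\<lambda>x. p x \<bullet> u x)"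
    by (intro continuous_on_subset[OF smooth_on_imp_continuous_on, OF _ subset_UNIV] smooth_on_inner p u open_UNIV)
  ultimately have "\<forall>x\<in>{-4..4}. p x \<bullet> u x = 0"
    by (subst (asm) integral_eq_0_iff) (auto simp: p_def \<beta>(2))
  then have "p 0 \<bullet> u 0 = 0"
    by (rule bspec) auto
  then have "u 0 = 0"
    using \<beta>(3) by (simp add: p_def)
  moreover have "vham (\<lambda>_. 1) B \<phi> q 0 = vham (\<lambda>_. 1) B \<phi> \<eta> 0"
    "vham_adj K (\<lambda>_. 1) B \<phi> q 0 = vham_adj K (\<lambda>_. 1) B \<phi> \<eta> 0"
  proof -
    interpret near: vector_field "{-2<..<2}" "\<lambda>_::real. 1 :: real"
      by standard (auto intro: smooth_on_const)
    have eq: "q x = \<eta> x" if "x \<in> {-2<..<2}" for x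
      using that \<rho>(2)[of x] by (auto simp: q_def)
    have "(line_d ^^ k) q 0 = (line_d ^^ k) \<eta> 0" for k
      by (rule near.vd_pow_cong) (use eq in auto)
    then show "vham (\<lambda>_. 1) B \<phi> q 0 = vham (\<lambda>_. 1) B \<phi> \<eta> 0"
      by (simp add: vham_def)
    have "(line_d ^^ k) (\<lambda>x. q x v* B k (vjet (\<lambda>_. 1) \<phi> x)) 0 = (line_d ^^ k) (\<lambda>x. \<eta> x v* B k (vjet (\<lambda>_. 1) \<phi> x)) 0" for k
      by (rule near.vd_pow_cong) (use eq in auto)
    then show "vham_adj K (\<lambda>_. 1) B \<phi> q 0 = vham_adj K (\<lambda>_. 1) B \<phi> \<eta> 0"
      by (simp add: vham_adj_def)
  qed
  ultimately show ?thesis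
    by (simp add: u_def add_eq_0_iff)
qed

section \<open>Means over the torus\<close>

lemma torus_mean_add:
  assumes "continuous_on UNIV f" "continuous_on UNIV g"
  shows "torus_mean (\<lambda>\<theta>. f \<theta> + g \<theta>) = torus_mean f + torus_mean g"
  unfolding torus_mean_def
  by (subst integral_add) (auto intro!: integrable_continuous continuous_on_subset[OF assms(1)]
      continuous_on_subset[OF assms(2)] simp: add_divide_distrib)

lemma torus_mean_cmult: "torus_mean (\<lambda>\<theta>. c * f \<theta>) = c * torus_mean f"
  by (simp add: torus_mean_def)

lemma torus_mean_zero [simp]: "torus_mean (\<lambda>\<theta>. 0) = 0"
  by (simp add: torus_mean_def)

lemma torus_mean_sum:
  assumes "\<And>i. i \<in> I \<Longrightarrow> continuous_on UNIV (f i)"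
  shows "torus_mean (\<lambda>\<theta>. \<Sum>i\<in>I. f i \<theta>) = (\<Sum>i\<in>I. torus_mean (f i))"
  using assms
  by (induction I rule: infinite_finite_induct) (auto simp: torus_mean_add continuous_on_sum)

text \<open>Cut the translated box where the coordinate \<alpha> equals 2 pi and move the part
  beyond the cut back by one period; the two pieces fill the original box.\<close>

lemma torus_mean_shift_axis:
  fixes g :: "real ^ 'm::finite \<Rightarrow> real"
  assumes g: "continuous_on UNIV g" "periodic g" and t: "0 \<le> t" "t \<le> 2 * pi"
  shows "torus_mean (\<lambda>\<theta>. g (t *\<^sub>R axis \<alpha> 1 + \<theta>)) = torus_mean g"
proof -
  define e :: "real ^ 'm" where "e = axis \<alpha> 1"
  define c :: "real ^ 'm" where "c = (\<chi> \<alpha>. 2 * pi)"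
  \<comment> \<open>The upper corner of the slab of the original box in which the coordinate
    \<alpha> is at most \<open>t\<close>.\<close>
  define d where "d = c + (t - 2 * pi) *\<^sub>R e"
  have e: "e $ \<beta> = (if \<beta> = \<alpha> then 1 else 0)" for \<beta>
    by (simp add: e_def axis_def)
  have eB: "e \<in> Basis" and inner_e: "x \<bullet> e = x $ \<alpha>" for x
    by (auto simp: e_def inner_axis axis_in_Basis_iff)
  have mem: "x \<in> cbox a b \<longleftrightarrow> (a $ \<alpha> \<le> x $ \<alpha> \<and> x $ \<alpha> \<le> b $ \<alpha>) \<and> (\<forall>i. i \<noteq> \<alpha> \<longrightarrow> a $ i \<le> x $ i \<and> x $ i \<le> b $ i)"
    for x a b :: "real ^ 'm"
    unfolding mem_box_cart by metis
  have int: "g integrable_on cbox a b" for a b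
    by (intro integrable_continuous continuous_on_subset[OF g(1)]) auto
  have sets: "cbox 0 c \<inter> {x. x \<bullet> e \<le> t} = cbox 0 d" "cbox 0 c \<inter> {x. x \<bullet> e \<ge> t} = cbox (t *\<^sub>R e) c"
    "cbox (t *\<^sub>R e) (c + t *\<^sub>R e) \<inter> {x. x \<bullet> e \<le> 2 * pi} = cbox (t *\<^sub>R e) c"
    "cbox (t *\<^sub>R e) (c + t *\<^sub>R e) \<inter> {x. x \<bullet> e \<ge> 2 * pi} = cbox (0 + (2 * pi) *\<^sub>R e) (d + (2 * pi) *\<^sub>R e)"
    using t by (auto simp: set_eq_iff mem inner_e e d_def c_def)
  have "integral (cbox 0 c) (\<lambda>\<theta>. g (t *\<^sub>R e + \<theta>)) = integral (cbox (t *\<^sub>R e) (c + t *\<^sub>R e)) g"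
    using integral_shift_cbox_plus[of 0 c g "t *\<^sub>R e"] by (simp add: o_def)
  also have "\<dots> = integral (cbox (t *\<^sub>R e) c) g + integral (cbox (0 + (2 * pi) *\<^sub>R e) (d + (2 * pi) *\<^sub>R e)) g"
    using integral_split[OF int eB, of "t *\<^sub>R e" "c + t *\<^sub>R e" "2 * pi"] by (simp only: sets)
  also have "integral (cbox (0 + (2 * pi) *\<^sub>R e) (d + (2 * pi) *\<^sub>R e)) g = integral (cbox 0 d) g"
    unfolding integral_shift_cbox_plus[symmetric]
    using g(2) by (simp add: periodic_def e_def o_def add.commute)
  also have "integral (cbox (t *\<^sub>R e) c) g + integral (cbox 0 d) g = integral (cbox 0 c) g"
    using integral_split[OF int eB, of 0 c t] by (simp only: sets)
  finally show ?thesis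
    by (simp add: torus_mean_def c_def e_def)
qed

lemma periodic_shift: "periodic g \<Longrightarrow> periodic (\<lambda>\<theta>. g (a + \<theta>))"
  unfolding periodic_def by (metis add.assoc)

text \<open>The mean is invariant under translation, so its derivative in the translation is zero.
  Together with differentiation under the integral this yields integration by parts on the torus
  without iterated integrals.\<close>

lemma torus_mean_shift_derivative:
  fixes g :: "real ^ 'm::finite \<Rightarrow> real"
  assumes D: "((\<lambda>t. torus_mean (\<lambda>\<theta>. g (t *\<^sub>R axis \<alpha> 1 + \<theta>))) has_real_derivative d) (at 0)"
    and g: "continuous_on UNIV g" "periodic g"
  shows "d = 0"
proof -
  let ?f = "\<lambda>t. torus_mean (\<lambda>\<theta>. g (t *\<^sub>R axis \<alpha> 1 + \<theta>))"
  have "?f t = torus_mean g" if "\<bar>t\<bar> < 2 * pi" for t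
  proof (cases "0 \<le> t")
    case True
    then show ?thesis
      using torus_mean_shift_axis[OF g] that by simp
  next
    case False
    have "continuous_on UNIV (\<lambda>\<theta>. g (t *\<^sub>R axis \<alpha> 1 + \<theta>))"
      by (intro continuous_on_compose2[OF g(1)] continuous_intros) auto
    from torus_mean_shift_axis[OF this periodic_shift[OF g(2)], of "- t" \<alpha>] show ?thesis
      using False that by simp
  qed
  then have "((\<lambda>_. torus_mean g) has_real_derivative d) (at 0)"
    by (intro has_field_derivative_transform_within_open[OF D, of "{- 2 * pi <..< 2 * pi}"]) auto
  then show "d = 0"
    using DERIV_unique DERIV_const by blast
qed

definition fibre_mean :: "((real ^ 'm::finite) \<times> 'p \<Rightarrow> real) \<Rightarrow> 'p \<Rightarrow> real" where
  "fibre_mean f p = torus_mean (\<lambda>\<theta>. f (\<theta>, p))"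

text \<open>
  The component \<open>\<kappa>\<close> of the vector field is tangent to the tori. For the \<open>m\<close>-phase family \<open>\<zeta> = 0\<close>; a modulated
  field also moves in the base.
\<close>

locale torus_bundle =
  fixes W :: "'p::euclidean_space set" and \<kappa> :: "'p \<Rightarrow> real ^ 'm::finite" and \<zeta> :: "'p \<Rightarrow> 'p"
  assumes open_W: "open W" and smooth_\<kappa>: "smooth_on W \<kappa>" and smooth_\<zeta>: "smooth_on W \<zeta>"
begin

abbreviation S :: "((real ^ 'm) \<times> 'p) set" where "S \<equiv> UNIV \<times> W"

definition X :: "(real ^ 'm) \<times> 'p \<Rightarrow> (real ^ 'm) \<times> 'p" where "X e = (\<kappa> (snd e), \<zeta> (snd e))"

lemma open_S: "open S"
  by (intro open_Times open_W open_UNIV)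

lemma smooth_on_base: "smooth_on W g \<Longrightarrow> smooth_on S (\<lambda>e. g (snd e))"
  by (rule smooth_on_compose[OF open_S open_W, where f = g])
    (auto intro: smooth_on_linear_map bounded_linear_snd)

sublocale vector_field S X
  unfolding X_def[abs_def]
  by standard (intro open_S smooth_on_Pair smooth_on_base smooth_\<kappa> smooth_\<zeta>)+

lemma has_derivative_base:
  assumes "smooth_on W g" "e \<in> S"
  shows "((\<lambda>e. g (snd e)) has_derivative (\<lambda>v. frechet_derivative g (at (snd e)) (snd v))) (at e)"
  by (rule has_derivative_frechet_chain) (use assms in \<open>auto intro: smooth_on_imp_differentiable derivative_eq_intros\<close>)

definition fibre_periodic :: "((real ^ 'm) \<times> 'p \<Rightarrow> 'b) \<Rightarrow> bool" where
  "fibre_periodic f \<longleftrightarrow> (\<forall>p\<in>W. periodic (\<lambda>\<theta>. f (\<theta>, p)))"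

text \<open>Translation by a period leaves \<open>f\<close> and therefore its derivative unchanged.
  The direction may vary over the base but not along the fibre, which covers both constant
  directions and \<open>X\<close>.\<close>

lemma fibre_periodic_frechet:
  fixes f :: "(real ^ 'm) \<times> 'p \<Rightarrow> 'b::real_normed_vector"
  assumes f: "smooth_on S f" "fibre_periodic f" and v: "\<And>\<theta> \<theta>' p. p \<in> W \<Longrightarrow> v (\<theta>, p) = v (\<theta>', p)"
  shows "fibre_periodic (\<lambda>e. frechet_derivative f (at e) (v e))"
  unfolding fibre_periodic_def periodic_def
proof (intro ballI allI)
  fix p \<theta> and \<alpha> :: 'm
  assume p: "p \<in> W"
  let ?a = "((2 * pi) *\<^sub>R axis \<alpha> 1, 0) :: (real ^ 'm) \<times> 'p"
  have per: "f (e + ?a) = f e" if "e \<in> S" for e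
    using f(2) that by (cases e) (auto simp: fibre_periodic_def periodic_def)
  have "((\<lambda>e. f (e + ?a)) has_derivative frechet_derivative f (at ((\<theta>, p) + ?a))) (at (\<theta>, p))"
    by (rule has_derivative_eq_rhs[OF has_derivative_frechet_chain[where f = f and c = "\<lambda>e. e + ?a" and c' = "\<lambda>v. v"]])
      (use p in \<open>auto intro!: smooth_on_imp_differentiable[OF f(1)] derivative_eq_intros\<close>)
  then have "(f has_derivative frechet_derivative f (at ((\<theta>, p) + ?a))) (at (\<theta>, p))"
    by (rule has_derivative_transform_within_open[OF _ open_S]) (use p per in auto)
  then have "frechet_derivative f (at (\<theta> + (2 * pi) *\<^sub>R axis \<alpha> 1, p)) = frechet_derivative f (at (\<theta>, p))"
    using frechet_derivative_at by fastforce
  then show "frechet_derivative f (at (\<theta> + (2 * pi) *\<^sub>R axis \<alpha> 1, p)) (v (\<theta> + (2 * pi) *\<^sub>R axis \<alpha> 1, p))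
      = frechet_derivative f (at (\<theta>, p)) (v (\<theta>, p))"
    using v[OF p] by metis
qed

lemma fibre_periodic_vd:
  "smooth_on S f \<Longrightarrow> fibre_periodic f \<Longrightarrow> fibre_periodic (vd X f)"
  unfolding vd_def[abs_def] by (rule fibre_periodic_frechet) (auto simp: X_def)

lemma fibre_periodic_vd_pow: "smooth_on S f \<Longrightarrow> fibre_periodic f \<Longrightarrow> fibre_periodic ((vd X ^^ l) f)"
  by (induction l) (auto intro: fibre_periodic_vd smooth_vd_pow)

lemma fibre_periodic_compose: "fibre_periodic f \<Longrightarrow> fibre_periodic (\<lambda>e. h (f e))"
  by (simp add: fibre_periodic_def periodic_def)

lemma fibre_periodic_compose2: "fibre_periodic f \<Longrightarrow> fibre_periodic g \<Longrightarrow> fibre_periodic (\<lambda>e. h (f e) (g e))"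
  by (simp add: fibre_periodic_def periodic_def)

lemma fibre_periodic_sum:
  "(\<And>i. i \<in> I \<Longrightarrow> fibre_periodic (f i)) \<Longrightarrow> fibre_periodic (\<lambda>e. \<Sum>i\<in>I. f i e)"
  by (simp add: fibre_periodic_def periodic_def)

lemma fibre_periodic_base: "fibre_periodic (\<lambda>e. g (snd e))"
  by (simp add: fibre_periodic_def periodic_def)

lemma fibre_periodic_const: "fibre_periodic (\<lambda>e. c)"
  by (simp add: fibre_periodic_def periodic_def)

lemma fibre_periodic_vjet: "smooth_on S \<psi> \<Longrightarrow> fibre_periodic \<psi> \<Longrightarrow> fibre_periodic (vjet X \<psi>)"
  using fibre_periodic_vd_pow unfolding fibre_periodic_def periodic_def vjet_def fun_eq_iff by blast

lemma continuous_on_fibre: "smooth_on S f \<Longrightarrow> p \<in> W \<Longrightarrow> continuous_on UNIV (\<lambda>\<theta>. f (\<theta>, p))"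
  by (rule continuous_on_compose2[OF smooth_on_imp_continuous_on]) (auto intro!: continuous_intros)

lemma fibre_mean_add:
  "smooth_on S f \<Longrightarrow> smooth_on S g \<Longrightarrow> p \<in> W \<Longrightarrow> fibre_mean (\<lambda>e. f e + g e) p = fibre_mean f p + fibre_mean g p"
  unfolding fibre_mean_def by (intro torus_mean_add continuous_on_fibre)

lemma fibre_mean_base_mult: "fibre_mean (\<lambda>e. g (snd e) * f e) p = g p * fibre_mean f p"
  by (simp add: fibre_mean_def torus_mean_cmult)

lemma fibre_mean_sum:
  "(\<And>i. i \<in> I \<Longrightarrow> smooth_on S (f i)) \<Longrightarrow> p \<in> W \<Longrightarrow> fibre_mean (\<lambda>e. \<Sum>i\<in>I. f i e) p = (\<Sum>i\<in>I. fibre_mean (f i) p)"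
  unfolding fibre_mean_def by (intro torus_mean_sum continuous_on_fibre)

lemma fibre_mean_diff:
  assumes "smooth_on S f" "smooth_on S g" "p \<in> W"
  shows "fibre_mean (\<lambda>e. f e - g e) p = fibre_mean f p - fibre_mean g p"
  using fibre_mean_add[OF assms(1) smooth_on_minus[OF open_S assms(2)] assms(3)]
    fibre_mean_base_mult[of "\<lambda>_. - 1" g p] by simp

lemma fibre_mean_cong: "(\<And>\<theta>. f (\<theta>, p) = g (\<theta>, p)) \<Longrightarrow> fibre_mean f p = fibre_mean g p"
  by (simp add: fibre_mean_def)

lemma fibre_mean_has_derivative:
  assumes f: "smooth_on S f" and p: "p \<in> W"
  shows "(fibre_mean f has_derivative (\<lambda>q. fibre_mean (\<lambda>e. frechet_derivative f (at e) (0, q)) p)) (at p)"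
proof -
  obtain d where d: "d > 0" "ball p d \<subseteq> W"
    using open_W p open_contains_ball by blast
  \<comment> \<open>A ball, because the Leibniz rule is applied on a convex set of
    parameters.\<close>
  let ?U = "ball p d" and ?B = "cbox 0 (\<chi> \<alpha>. 2 * pi) :: (real ^ 'm) set"
  define D where "D = (\<lambda>p \<theta>. Blinfun (\<lambda>q. frechet_derivative f (at (\<theta>, p)) (0, q)))"
  have fd: "((\<lambda>p. f (\<theta>, p)) has_derivative (\<lambda>q. frechet_derivative f (at (\<theta>, p)) (0, q))) (at p)"
    if "p \<in> ?U" for p \<theta>
    by (rule has_derivative_frechet_chain[where f = f and c = "\<lambda>p. (\<theta>, p)"])
      (use that d in \<open>auto intro!: smooth_on_imp_differentiable[OF f] derivative_eq_intros\<close>)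
  have D: "blinfun_apply (D p \<theta>) = (\<lambda>q. frechet_derivative f (at (\<theta>, p)) (0, q))" if "p \<in> ?U" for p \<theta>
    unfolding D_def by (rule bounded_linear_Blinfun_apply) (rule has_derivative_bounded_linear[OF fd[OF that]])
  have cD: "continuous_on (?U \<times> UNIV) (\<lambda>(p, \<theta>). D p \<theta>)"
  proof (rule continuous_on_blinfun_componentwise)
    fix b :: 'p
    have "continuous_on (?U \<times> UNIV) (\<lambda>z. frechet_derivative f (at (snd z, fst z)) (0, b))"
      by (rule continuous_on_compose2[OF smooth_on_imp_continuous_on[OF smooth_on_frechet_derivative[OF f]]])
        (use d in \<open>auto intro!: continuous_intros\<close>)
    then show "continuous_on (?U \<times> UNIV) (\<lambda>z. blinfun_apply (case z of (p, \<theta>) \<Rightarrow> D p \<theta>) b)"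
      by (rule continuous_on_cong[THEN iffD1, rotated -1]) (auto simp: D)
  qed
  have "((\<lambda>p. integral ?B (\<lambda>\<theta>. f (\<theta>, p))) has_derivative blinfun_apply (integral ?B (D p))) (at p within ?U)"
  proof (rule leibniz_rule)
    show "((\<lambda>p. f (\<theta>, p)) has_derivative blinfun_apply (D p \<theta>)) (at p within ?U)" if "p \<in> ?U" for p \<theta>
      unfolding D[OF that] using fd[OF that] has_derivative_at_withinI by blast
    show "(\<lambda>\<theta>. f (\<theta>, p)) integrable_on ?B" if "p \<in> ?U" for p
      using that d by (intro integrable_continuous continuous_on_subset[OF continuous_on_fibre[OF f]]) auto
    show "continuous_on (?U \<times> ?B) (\<lambda>(p, \<theta>). D p \<theta>)"
      by (rule continuous_on_subset[OF cD]) auto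
  qed (use d in auto)
  moreover have "blinfun_apply (integral ?B (D p)) = (\<lambda>q. integral ?B (\<lambda>\<theta>. frechet_derivative f (at (\<theta>, p)) (0, q)))"
  proof
    fix q
    have "continuous_on UNIV (\<lambda>\<theta>. case (p, \<theta>) of (p, \<theta>) \<Rightarrow> D p \<theta>)"
      by (rule continuous_on_compose2[OF cD])
        (use d in \<open>auto intro!: continuous_on_Pair continuous_on_const continuous_on_id\<close>)
    then have "continuous_on UNIV (D p)"
      by simp
    then have "D p integrable_on ?B"
      by (rule integrable_continuous[OF continuous_on_subset]) simp
    moreover have "blinfun_apply (D p \<theta>) q = frechet_derivative f (at (\<theta>, p)) (0, q)" for \<theta>
      using d by (subst D) auto
    ultimately show "blinfun_apply (integral ?B (D p)) q = integral ?B (\<lambda>\<theta>. frechet_derivative f (at (\<theta>, p)) (0, q))"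
      by (simp only: blinfun_apply_integral)
  qed
  moreover have "at p within ?U = at p"
    by (rule at_within_open) (use d in auto)
  ultimately have "((\<lambda>p. integral ?B (\<lambda>\<theta>. f (\<theta>, p))) has_derivative
      (\<lambda>q. integral ?B (\<lambda>\<theta>. frechet_derivative f (at (\<theta>, p)) (0, q)))) (at p)"
    by (simp only:)
  then show ?thesis
    unfolding fibre_mean_def[abs_def] torus_mean_def divide_inverse
    by (rule has_derivative_mult_left)
qed

lemma frechet_fibre_mean:
  assumes "smooth_on S f" "p \<in> W"
  shows "frechet_derivative (fibre_mean f) (at p) q = fibre_mean (\<lambda>e. frechet_derivative f (at e) (0, q)) p"
  by (rule frechet_derivative_eq[OF fibre_mean_has_derivative[OF assms]])

lemma smooth_fibre_mean:
  assumes "smooth_on S f"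
  shows "smooth_on W (fibre_mean f)"
proof -
  have "higher_differentiable_on W (fibre_mean f) r" for r
    using assms
  proof (induction r arbitrary: f)
    case 0
    then show ?case
      using has_derivative_continuous[OF fibre_mean_has_derivative[OF 0]]
      by (auto intro!: continuous_at_imp_continuous_on)
  next
    case (Suc r)
    have "higher_differentiable_on W (\<lambda>p. frechet_derivative (fibre_mean f) (at p) q) r" for q
      by (rule higher_differentiable_on_cong[OF open_W _ Suc.IH[OF smooth_on_frechet_derivative[OF Suc.prems, of "(0, q)"]]])
        (simp add: frechet_fibre_mean[OF Suc.prems])
    then show ?case
      using fibre_mean_has_derivative[OF Suc.prems] by (auto simp: differentiable_def)
  qed
  then show ?thesis
    by (simp add: smooth_on_def)
qed

lemma fibre_mean_frechet_fibre:
  assumes f: "smooth_on S f" "fibre_periodic f" and p: "p \<in> W"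
  shows "fibre_mean (\<lambda>e. frechet_derivative f (at e) (v, 0)) p = 0"
proof -
  have axis: "fibre_mean (\<lambda>e. frechet_derivative f (at e) (axis \<alpha> 1, 0)) p = 0" for \<alpha>
  proof -
    \<comment> \<open>An auxiliary bundle whose base coordinate is the amount of translation along
      the axis \<alpha>. Differentiating its fibre mean at 0 gives the mean of the derivative along
      that axis.\<close>
    interpret shift: torus_bundle "UNIV :: real set" "\<lambda>_. 0 :: real ^ 'm" "\<lambda>_. 0 :: real"
      by standard (auto intro: smooth_on_const)
    let ?c = "\<lambda>z :: (real ^ 'm) \<times> real. (snd z *\<^sub>R axis \<alpha> 1 + fst z, p)"
    have c': "(?c has_derivative (\<lambda>w. (snd w *\<^sub>R axis \<alpha> 1 + fst w, 0))) (at z)" for z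
      by (auto intro!: derivative_eq_intros)
    have sc: "smooth_on UNIV ?c"
      by (intro smooth_on_Pair smooth_on_add smooth_on_scaleR smooth_on_const smooth_on_linear_map
          bounded_linear_fst bounded_linear_snd open_UNIV)
    have g: "smooth_on UNIV (\<lambda>z. f (?c z))"
      by (rule smooth_on_compose[OF open_UNIV open_S _ f(1) sc]) (use p in auto)
    have fr: "frechet_derivative (\<lambda>z. f (?c z)) (at z) w
        = frechet_derivative f (at (?c z)) (snd w *\<^sub>R axis \<alpha> 1 + fst w, 0)" for z w
      by (rule frechet_derivative_chain[OF c' smooth_on_imp_differentiable[OF f(1)]]) (use p in auto)
    have "((\<lambda>t. torus_mean (\<lambda>\<theta>. f (t *\<^sub>R axis \<alpha> 1 + \<theta>, p))) has_derivative
        (\<lambda>q. fibre_mean (\<lambda>z. frechet_derivative f (at (?c z)) (q *\<^sub>R axis \<alpha> 1, 0)) 0)) (at 0)"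
      using shift.fibre_mean_has_derivative[of "\<lambda>z. f (?c z)" 0] g by (simp add: fr fibre_mean_def[abs_def])
    also have "(\<lambda>q. fibre_mean (\<lambda>z. frechet_derivative f (at (?c z)) (q *\<^sub>R axis \<alpha> 1, 0)) 0)
        = (*) (fibre_mean (\<lambda>e. frechet_derivative f (at e) (axis \<alpha> 1, 0)) p)"
    proof
      fix q
      have "frechet_derivative f (at (\<theta>, p)) (q *\<^sub>R axis \<alpha> 1, 0) = q * frechet_derivative f (at (\<theta>, p)) (axis \<alpha> 1, 0)" for \<theta>
        using linear_scale[OF smooth_on_frechet_linear[OF f(1)], of "(\<theta>, p)" q "(axis \<alpha> 1, 0)"] p by simp
      then show "fibre_mean (\<lambda>z. frechet_derivative f (at (?c z)) (q *\<^sub>R axis \<alpha> 1, 0)) 0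
          = fibre_mean (\<lambda>e. frechet_derivative f (at e) (axis \<alpha> 1, 0)) p * q"
        by (simp add: fibre_mean_def torus_mean_cmult mult.commute)
    qed
    finally have "((\<lambda>t. torus_mean (\<lambda>\<theta>. f (t *\<^sub>R axis \<alpha> 1 + \<theta>, p))) has_real_derivative
        fibre_mean (\<lambda>e. frechet_derivative f (at e) (axis \<alpha> 1, 0)) p) (at 0)"
      unfolding has_field_derivative_def .
    from torus_mean_shift_derivative[where g = "\<lambda>\<theta>. f (\<theta>, p)", OF this continuous_on_fibre[OF f(1) p]] show ?thesis
      using f(2) p by (simp add: fibre_periodic_def)
  qed
  have "frechet_derivative f (at (\<theta>, p)) (v, 0)
      = (\<Sum>\<alpha>\<in>UNIV. v $ \<alpha> * frechet_derivative f (at (\<theta>, p)) (axis \<alpha> 1, 0))" for \<theta>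
  proof -
    have lin: "linear (frechet_derivative f (at (\<theta>, p)))"
      using smooth_on_frechet_linear[OF f(1)] p by simp
    have "(v, 0 :: 'p) = (\<Sum>\<alpha>\<in>UNIV. v $ \<alpha> *\<^sub>R (axis \<alpha> 1, 0))"
      by (simp add: prod_eq_iff fst_sum snd_sum vec_lambda_sum_axis[symmetric])
    then show ?thesis
      by (simp only: linear_sum[OF lin] linear_scale[OF lin] real_scaleR_def)
  qed
  then have "fibre_mean (\<lambda>e. frechet_derivative f (at e) (v, 0)) p
      = fibre_mean (\<lambda>e. \<Sum>\<alpha>\<in>UNIV. v $ \<alpha> * frechet_derivative f (at e) (axis \<alpha> 1, 0)) p"
    by (intro fibre_mean_cong)
  also have "\<dots> = (\<Sum>\<alpha>\<in>UNIV. fibre_mean (\<lambda>e. v $ \<alpha> * frechet_derivative f (at e) (axis \<alpha> 1, 0)) p)"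
    by (intro fibre_mean_sum p smooth_on_mult smooth_on_const smooth_on_frechet_derivative f open_S)
  also have "\<dots> = 0"
    by (simp add: fibre_mean_base_mult[of "\<lambda>_. v $ _"] axis)
  finally show ?thesis .
qed

text \<open>The component of \<open>X\<close> along the torus averages to zero, so only the motion
  in the base is left. Where \<zeta> vanishes, nothing is left, and derivatives can be moved freely
  under the mean.\<close>

lemma fibre_mean_vd:
  assumes f: "smooth_on S f" "fibre_periodic f" and p: "p \<in> W"
  shows "fibre_mean (vd X f) p = frechet_derivative (fibre_mean f) (at p) (\<zeta> p)"
proof -
  have "vd X f (\<theta>, p) = frechet_derivative f (at (\<theta>, p)) (\<kappa> p, 0) + frechet_derivative f (at (\<theta>, p)) (0, \<zeta> p)" for \<theta>
    using linear_add[OF smooth_on_frechet_linear[OF f(1)], of "(\<theta>, p)" "(\<kappa> p, 0)" "(0, \<zeta> p)"] p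
    by (simp add: vd_def X_def)
  then have "fibre_mean (vd X f) p
    = fibre_mean (\<lambda>e. frechet_derivative f (at e) (\<kappa> p, 0) + frechet_derivative f (at e) (0, \<zeta> p)) p"
    by (intro fibre_mean_cong)
  also have "\<dots> = frechet_derivative (fibre_mean f) (at p) (\<zeta> p)"
    using fibre_mean_add[OF smooth_on_frechet_derivative[OF f(1)] smooth_on_frechet_derivative[OF f(1)] p]
    by (simp add: fibre_mean_frechet_fibre[OF f p] frechet_fibre_mean[OF f(1) p])
  finally show ?thesis .
qed

end

section \<open>Integration by parts\<close>

text \<open>
  \<open>vbdry\<close> is the flux produced by moving all derivatives in \<open>a \<bullet> vadj X f \<psi> g\<close> onto \<open>a\<close>. Its mean over
  a fibre is that of \<open>g * vmom\<close>, which is also the derivative of \<open>f\<close> with respect to the wave numbers.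
\<close>

definition vbdry ::
  "nat \<Rightarrow> ('a::real_normed_vector \<Rightarrow> 'a) \<Rightarrow> ('n::finite jet \<Rightarrow> real) \<Rightarrow> ('a \<Rightarrow> real ^ 'n)
    \<Rightarrow> ('a \<Rightarrow> real ^ 'n) \<Rightarrow> ('a \<Rightarrow> real) \<Rightarrow> 'a \<Rightarrow> real" where
  "vbdry K X f \<psi> a g e = (\<Sum>l\<le>K. \<Sum>j<l. (vd X ^^ j) a e \<bullet>
     ((- 1) ^ (l - 1 - j) *\<^sub>R (vd X ^^ (l - 1 - j)) (\<lambda>e. \<chi> i. pd l i f (vjet X \<psi> e) * g e) e))"

definition vmom ::
  "nat \<Rightarrow> ('a::real_normed_vector \<Rightarrow> 'a) \<Rightarrow> ('n::finite jet \<Rightarrow> real) \<Rightarrow> ('a \<Rightarrow> real ^ 'n)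
    \<Rightarrow> ('a \<Rightarrow> real ^ 'n) \<Rightarrow> 'a \<Rightarrow> real" where
  "vmom K X f \<psi> a e = (\<Sum>l\<le>K. real l * ((vd X ^^ (l - 1)) a e \<bullet> (\<chi> i. pd l i f (vjet X \<psi> e))))"

context vector_field
begin

lemma vd_pow_scaleR:
  "smooth_on S f \<Longrightarrow> e \<in> S \<Longrightarrow> (vd X ^^ l) (\<lambda>e. c *\<^sub>R f e) e = c *\<^sub>R (vd X ^^ l) f e"
  by (rule vd_pow_bounded_linear[OF bounded_linear_scaleR_right])

lemma vd_pow_minus:
  "smooth_on S f \<Longrightarrow> e \<in> S \<Longrightarrow> (vd X ^^ l) (\<lambda>e. - f e) e = - (vd X ^^ l) f e"
  by (rule vd_pow_bounded_linear[OF bounded_linear_minus[OF bounded_linear_ident]])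

lemma vd_pow_add:
  assumes "smooth_on S f" "smooth_on S g" "e \<in> S"
  shows "(vd X ^^ l) (\<lambda>e. f e + g e) e = (vd X ^^ l) f e + (vd X ^^ l) g e"
  using vd_pow_sum[of "UNIV :: bool set" "\<lambda>b. if b then f else g" e l] assms by (simp add: UNIV_bool add.commute)

lemma vd_pow_diff:
  assumes "smooth_on S f" "smooth_on S g" "e \<in> S"
  shows "(vd X ^^ l) (\<lambda>e. f e - g e) e = (vd X ^^ l) f e - (vd X ^^ l) g e"
  using vd_pow_add[OF assms(1) smooth_on_minus[OF open_S assms(2)] assms(3), of l] vd_pow_minus[OF assms(2,3), of l]
  by simp

text \<open>By symmetry of second derivatives, the commutator of a constant direction
  \<open>u\<close> with \<open>X\<close> is differentiation along the derivative of \<open>X\<close>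
  in the direction \<open>u\<close>. All corrections to naive commutation come from this
  term.\<close>

lemma vd_commute:
  fixes g :: "'a \<Rightarrow> 'b::euclidean_space"
  assumes g: "smooth_on S g" and e: "e \<in> S"
  shows "frechet_derivative (vd X g) (at e) u
    = vd X (\<lambda>e. frechet_derivative g (at e) u) e + frechet_derivative g (at e) (frechet_derivative X (at e) u)"
proof -
  have "((\<lambda>e. \<Sum>b\<in>Basis. (X e \<bullet> b) *\<^sub>R frechet_derivative g (at e) b) has_derivative
      (\<lambda>u. \<Sum>b\<in>Basis. (X e \<bullet> b) *\<^sub>R frechet_derivative (\<lambda>e. frechet_derivative g (at e) b) (at e) u
        + (frechet_derivative X (at e) u \<bullet> b) *\<^sub>R frechet_derivative g (at e) b)) (at e)"
    by (intro has_derivative_sum has_derivative_scaleR has_derivative_inner_left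
        smooth_on_has_derivative[OF smooth_X e] smooth_on_has_derivative[OF smooth_on_frechet_derivative[OF g] e])
  then have "(vd X g has_derivative
      (\<lambda>u. \<Sum>b\<in>Basis. (X e \<bullet> b) *\<^sub>R frechet_derivative (\<lambda>e. frechet_derivative g (at e) b) (at e) u
        + (frechet_derivative X (at e) u \<bullet> b) *\<^sub>R frechet_derivative g (at e) b)) (at e)"
    by (rule has_derivative_transform_within_open[OF _ open_S e])
      (simp add: vd_def linear_sum_Basis[OF smooth_on_frechet_linear[OF g]])
  from frechet_derivative_eq[OF this, of u] show ?thesis
    unfolding vd_def frechet_derivative_commute[OF open_S e g, of _ u]
    by (simp add: sum.distrib linear_sum_Basis[OF smooth_on_frechet_linear[OF g e], of "frechet_derivative X (at e) u"]
        linear_sum_Basis[OF smooth_on_frechet_linear[OF smooth_on_frechet_derivative[OF g] e], of u "X e"])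
qed

text \<open>Derivatives are moved from \<open>b\<close> to \<open>a\<close> one at a time by the
  product rule, each move leaving one term of the flux. The flux is kept explicit because its mean
  is needed later at first order.\<close>

lemma adjoint_identity:
  fixes a b :: "'a \<Rightarrow> real ^ 'n"
  assumes a: "smooth_on S a" and b: "smooth_on S b" and e: "e \<in> S"
  shows "a e \<bullet> ((- 1) ^ l *\<^sub>R (vd X ^^ l) b e) = (vd X ^^ l) a e \<bullet> b e
    - vd X (\<lambda>e. \<Sum>j<l. (vd X ^^ j) a e \<bullet> ((- 1) ^ (l - 1 - j) *\<^sub>R (vd X ^^ (l - 1 - j)) b e)) e"
  using a
proof (induction l arbitrary: a)
  case 0
  then show ?case
    by (simp add: vd_const)
next
  case (Suc l)
  let ?b = "\<lambda>k e. (- 1) ^ k *\<^sub>R (vd X ^^ k) b e"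
  have b': "smooth_on S (?b k)" for k
    by (intro smooth_on_scaleR smooth_on_const smooth_vd_pow b open_S)
  have a': "smooth_on S ((vd X ^^ j) a)" for j
    by (rule smooth_vd_pow[OF Suc.prems])
  \<comment> \<open>The term j = 0 is split off; the others form the flux of order \<open>l\<close>
    for the function \<open>vd X a\<close>, to which the induction hypothesis applies.\<close>
  have "vd X (\<lambda>e. \<Sum>j<Suc l. (vd X ^^ j) a e \<bullet> ?b (l - j) e) e
      = vd X (\<lambda>e. a e \<bullet> ?b l e + (\<Sum>j<l. (vd X ^^ j) (vd X a) e \<bullet> ?b (l - 1 - j) e)) e"
    by (simp only: sum.lessThan_Suc_shift funpow_Suc_right o_apply funpow_0 diff_zero diff_Suc_eq_diff_pred)
  also have "\<dots> = vd X (\<lambda>e. a e \<bullet> ?b l e) e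
      + vd X (\<lambda>e. \<Sum>j<l. (vd X ^^ j) (vd X a) e \<bullet> ?b (l - 1 - j) e) e"
    by (intro vd_add smooth_on_sum smooth_on_inner smooth_vd_pow smooth_vd Suc.prems b' e open_S)
  also have "vd X (\<lambda>e. a e \<bullet> ?b l e) e = a e \<bullet> vd X (?b l) e + vd X a e \<bullet> ?b l e"
    by (rule vd_bilinear[OF bounded_bilinear_inner Suc.prems b' e])
  also have "vd X (?b l) e = (- 1) ^ l *\<^sub>R (vd X ^^ Suc l) b e"
    using vd_bounded_linear[OF bounded_linear_scaleR_right smooth_vd_pow[OF b] e] by simp
  also have "vd X a e \<bullet> ?b l e = (vd X ^^ Suc l) a e \<bullet> b e
      - vd X (\<lambda>e. \<Sum>j<l. (vd X ^^ j) (vd X a) e \<bullet> ?b (l - 1 - j) e) e"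
    using Suc.IH[OF smooth_vd[OF Suc.prems]] by (simp only: funpow_Suc_right o_apply)
  finally show ?case
    by simp
qed

lemma smooth_vbdry:
  assumes "diff_fun f" "smooth_on S \<psi>" "smooth_on S a" "smooth_on S g"
  shows "smooth_on S (vbdry K X f \<psi> a g)"
  unfolding vbdry_def[abs_def]
  by (intro smooth_on_sum smooth_on_inner smooth_on_scaleR smooth_on_const smooth_vd_pow smooth_vadj_term assms open_S)

lemma smooth_vmom:
  assumes "diff_fun f" "smooth_on S \<psi>" "smooth_on S a"
  shows "smooth_on S (vmom K X f \<psi> a)"
  unfolding vmom_def[abs_def]
  by (intro smooth_on_sum smooth_on_mult smooth_on_inner smooth_on_const smooth_vd_pow smooth_on_vec_lambda
      smooth_diff_fun_vjet diff_fun_pd assms open_S)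

text \<open>Green's identity for the linearization and its formal adjoint:
  \<open>adjoint_identity\<close> for each order \<open>l\<close>, with the fluxes collected in
  \<open>vbdry\<close>.\<close>

lemma inner_vadj:
  assumes f: "diff_fun f" "jet_order K f" and \<psi>: "smooth_on S \<psi>" and a: "smooth_on S a"
    and g: "smooth_on S g" and e: "e \<in> S"
  shows "a e \<bullet> vadj X f \<psi> g e = g e * vlin X f \<psi> a e - vd X (vbdry K X f \<psi> a g) e"
proof -
  let ?b = "\<lambda>l e. \<chi> i. pd l i f (vjet X \<psi> e) * g e"
  let ?r = "\<lambda>l e. \<Sum>j<l. (vd X ^^ j) a e \<bullet> ((- 1) ^ (l - 1 - j) *\<^sub>R (vd X ^^ (l - 1 - j)) (?b l) e)"
  have b: "smooth_on S (?b l)" for l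
    by (rule smooth_vadj_term[OF f(1) \<psi> g])
  have "a e \<bullet> vadj X f \<psi> g e = (\<Sum>l\<le>K. a e \<bullet> ((- 1) ^ l *\<^sub>R (vd X ^^ l) (?b l) e))"
    by (simp add: vadj_eq_sum[OF f(2)] inner_sum_right)
  also have "\<dots> = (\<Sum>l\<le>K. (vd X ^^ l) a e \<bullet> ?b l e) - (\<Sum>l\<le>K. vd X (?r l) e)"
    by (simp only: adjoint_identity[OF a b e] sum_subtractf)
  also have "(\<Sum>l\<le>K. vd X (?r l) e) = vd X (vbdry K X f \<psi> a g) e"
    unfolding vbdry_def[abs_def]
    by (rule vd_sum[symmetric, OF _ e])
      (intro smooth_on_sum smooth_on_inner smooth_on_scaleR smooth_on_const smooth_vd_pow a b open_S)
  also have "(\<Sum>l\<le>K. (vd X ^^ l) a e \<bullet> ?b l e) = g e * vlin X f \<psi> a e"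
    by (simp add: vlin_eq_sum[OF f(2)] inner_vec_def sum_distrib_left mult_ac)
  finally show ?thesis .
qed

lemma line_d_pow_compose:
  assumes c: "\<And>x. (c has_vector_derivative X (c x)) (at x)" "\<And>x. c x \<in> S" "smooth_on UNIV c"
    and g: "smooth_on S g"
  shows "(line_d ^^ k) (\<lambda>x. g (c x)) = (\<lambda>x. (vd X ^^ k) g (c x))"
proof -
  have gc: "smooth_on UNIV (\<lambda>x. g (c x))"
    by (rule smooth_on_compose[OF open_UNIV open_S _ g c(3)]) (use c in auto)
  have "(dird 1 ^^ k) (\<lambda>x. g (c x)) = (\<lambda>x. (vd X ^^ k) g (c x))"
    by (rule dird_pow_compose[where c' = "\<lambda>x h. h *\<^sub>R X (c x)"])
      (use c g in \<open>auto simp: has_vector_derivative_def\<close>)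
  then show ?thesis
    using line_dird_pow[OF gc, of k] by simp
qed

text \<open>The result on the line is applied to the fields pulled back along an integral curve and
  read off at time 0; the starting point of the curve carries the pointwise identity over to the
  bundle.\<close>

lemma vham_skew:
  fixes B :: "'n::finite coeffs"
  assumes B: "local_poisson_bracket B" and K: "\<And>k u. K < k \<Longrightarrow> B k u = 0"
    and c: "\<And>x. (c has_vector_derivative X (c x)) (at x)" "\<And>x. c x \<in> S" "smooth_on UNIV c"
    and \<psi>: "smooth_on S \<psi>" and \<eta>: "smooth_on S \<eta>"
  shows "vham X B \<psi> \<eta> (c 0) = - vham_adj K X B \<psi> \<eta> (c 0)"
proof -
  have Bk: "diff_fun (B k)" for k
    using B by (simp add: local_poisson_bracket_def)
  note pow = line_d_pow_compose[OF c]
  have "smooth_on UNIV (\<lambda>x. \<psi> (c x))" "smooth_on UNIV (\<lambda>x. \<eta> (c x))"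
    using c by (auto intro!: smooth_on_compose[OF open_UNIV open_S _ \<psi> c(3)] smooth_on_compose[OF open_UNIV open_S _ \<eta> c(3)])
  from line_vham_skew[OF B K this]
  have "vham (\<lambda>_. 1) B (\<lambda>x. \<psi> (c x)) (\<lambda>x. \<eta> (c x)) 0 = - vham_adj K (\<lambda>_. 1) B (\<lambda>x. \<psi> (c x)) (\<lambda>x. \<eta> (c x)) 0" .
  moreover have jet: "vjet (\<lambda>_. 1) (\<lambda>x. \<psi> (c x)) x = vjet X \<psi> (c x)" for x
    by (simp add: vjet_def fun_eq_iff pow[OF \<psi>])
  moreover have "(line_d ^^ k) (\<lambda>x. \<eta> (c x) v* B k (vjet X \<psi> (c x))) 0
      = (vd X ^^ k) (\<lambda>e. \<eta> e v* B k (vjet X \<psi> e)) (c 0)" for k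
    using fun_cong[OF pow[OF smooth_vham_adj_term[of B k \<psi> \<eta>, OF Bk \<psi> \<eta>], of k], of 0] .
  ultimately show ?thesis
    by (simp add: vham_def vham_adj_def pow[OF \<eta>])
qed

end

section \<open>Integration by parts on the fibres\<close>

context torus_bundle
begin

lemma frechet_X:
  assumes "e \<in> S"
  shows "frechet_derivative X (at e) v
    = (frechet_derivative \<kappa> (at (snd e)) (snd v), frechet_derivative \<zeta> (at (snd e)) (snd v))"
  unfolding X_def[abs_def]
  by (rule frechet_derivative_eq[OF has_derivative_Pair[OF has_derivative_base[OF smooth_\<kappa> assms] has_derivative_base[OF smooth_\<zeta> assms]]])

text \<open>The coefficients of \<open>X\<close> depend only on the base point, so constant
  directions along the fibre commute with \<open>X\<close>.\<close>

lemma vd_pow_fibre_commute: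
  fixes g :: "(real ^ 'm) \<times> 'p \<Rightarrow> 'b::euclidean_space"
  assumes g: "smooth_on S g" and e: "e \<in> S"
  shows "frechet_derivative ((vd X ^^ l) g) (at e) (v, 0) = (vd X ^^ l) (\<lambda>e. frechet_derivative g (at e) (v, 0)) e"
  using e
proof (induction l arbitrary: e)
  case (Suc l)
  have "frechet_derivative X (at e) (v, 0) = 0"
    using Suc.prems linear_0[OF smooth_on_frechet_linear[OF smooth_\<kappa>]] linear_0[OF smooth_on_frechet_linear[OF smooth_\<zeta>]]
    by (simp add: frechet_X zero_prod_def mem_Times_iff)
  then show ?case
    using vd_commute[OF smooth_vd_pow[OF g] Suc.prems, of l "(v, 0)"] vd_cong[OF Suc.IH Suc.prems]
      linear_0[OF smooth_on_frechet_linear[OF smooth_vd_pow[OF g] Suc.prems]]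
    by simp
qed simp

text \<open>Where \<zeta> vanishes, \<open>X\<close> is tangent to the torus over \<open>p\<close>
  and is there the constant direction \<open>\<kappa> p\<close>; the inclusion of that torus carries
  one to the other.\<close>

lemma dird_pow_fibre:
  assumes "smooth_on S g" "p \<in> W" "\<zeta> p = 0"
  shows "(dird (\<kappa> p) ^^ l) (\<lambda>\<theta>. g (\<theta>, p)) = (\<lambda>\<theta>. (vd X ^^ l) g (\<theta>, p))"
  by (rule dird_pow_compose[where c = "\<lambda>\<theta>. (\<theta>, p)" and c' = "\<lambda>_ v. (v, 0)"])
    (use assms in \<open>auto simp: X_def intro!: derivative_eq_intros\<close>)

lemma jet_fibre:
  "smooth_on S \<psi> \<Longrightarrow> p \<in> W \<Longrightarrow> \<zeta> p = 0 \<Longrightarrow> jet (\<kappa> p) (\<lambda>\<theta>. \<psi> (\<theta>, p)) \<theta> = vjet X \<psi> (\<theta>, p)"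
  by (simp add: jet_def vjet_def fun_eq_iff dird_pow_fibre)

lemma lin_adj_fibre:
  assumes "diff_fun f" "smooth_on S \<psi>" "smooth_on S g" "p \<in> W" "\<zeta> p = 0"
  shows "lin_adj (\<kappa> p) f (\<lambda>\<theta>. \<psi> (\<theta>, p)) (\<lambda>\<theta>. g (\<theta>, p)) \<theta> = vadj X f \<psi> g (\<theta>, p)"
  using dird_pow_fibre[OF smooth_vadj_term[OF assms(1-3)] assms(4,5)] assms
  by (simp add: lin_adj_def vadj_def jet_fibre)

lemma var_deriv_fibre:
  assumes "diff_fun f" "smooth_on S \<psi>" "p \<in> W" "\<zeta> p = 0"
  shows "var_deriv (\<kappa> p) f (\<lambda>\<theta>. \<psi> (\<theta>, p)) = (\<lambda>\<theta>. vadj X f \<psi> (\<lambda>_. 1) (\<theta>, p))"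
  using lin_adj_fibre[OF assms(1,2) smooth_on_const assms(3,4)] by (simp add: var_deriv_def fun_eq_iff)

lemma ham_op_fibre:
  "smooth_on S \<psi> \<Longrightarrow> smooth_on S \<xi> \<Longrightarrow> p \<in> W \<Longrightarrow> \<zeta> p = 0 \<Longrightarrow>
    ham_op (\<kappa> p) B (\<lambda>\<theta>. \<psi> (\<theta>, p)) (\<lambda>\<theta>. \<xi> (\<theta>, p)) \<theta> = vham X B \<psi> \<xi> (\<theta>, p)"
  by (simp add: ham_op_def vham_def dird_pow_fibre jet_fibre)

lemma ham_flow_fibre:
  assumes "diff_fun f" "smooth_on S \<psi>" "p \<in> W" "\<zeta> p = 0"
  shows "ham_flow (\<kappa> p) B f (\<lambda>\<theta>. \<psi> (\<theta>, p)) \<theta> = vham X B \<psi> (vadj X f \<psi> (\<lambda>_. 1)) (\<theta>, p)"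
  using ham_op_fibre[OF assms(2) smooth_vadj[OF assms(1,2) smooth_on_const] assms(3,4)]
  by (simp add: ham_flow_def var_deriv_fibre[OF assms])

lemma dird_fibre:
  assumes g: "smooth_on S g" and p: "p \<in> W"
  shows "dird v (\<lambda>\<theta>. g (\<theta>, p)) \<theta> = frechet_derivative g (at (\<theta>, p)) (v, 0)"
proof -
  \<comment> \<open>The bundle with constant rotation \<open>v\<close> and no motion in the base
    turns a single directional derivative into an instance of \<open>dird_pow_fibre\<close>.\<close>
  interpret const: torus_bundle W "\<lambda>_. v" "\<lambda>_. 0 :: 'p"
    by standard (auto intro: open_W smooth_on_const)
  show ?thesis
    using const.dird_pow_fibre[OF g p, of 1] by (simp add: fun_eq_iff vd_def const.X_def)
qed

lemma fibre_mean_cmult: "fibre_mean (\<lambda>e. c * f e) p = c * fibre_mean f p"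
  by (rule fibre_mean_base_mult[of "\<lambda>_. c"])

lemma fibre_mean_vd_zero:
  assumes "smooth_on S f" "fibre_periodic f" "p \<in> W" "\<zeta> p = 0"
  shows "fibre_mean (vd X f) p = 0"
  using fibre_mean_vd[OF assms(1-3)] assms(4) linear_0[OF smooth_on_frechet_linear[OF smooth_fibre_mean[OF assms(1)] assms(3)]]
  by simp

lemma fibre_periodic_vadj_term:
  assumes "smooth_on S \<psi>" "fibre_periodic \<psi>" "fibre_periodic g"
  shows "fibre_periodic (\<lambda>e. \<chi> i. pd l i f (vjet X \<psi> e) * g e)"
  by (rule fibre_periodic_compose2[OF fibre_periodic_vjet[OF assms(1,2)] assms(3)])

lemma fibre_periodic_vadj:
  assumes "diff_fun f" "smooth_on S \<psi>" "fibre_periodic \<psi>" "smooth_on S g" "fibre_periodic g"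
  shows "fibre_periodic (vadj X f \<psi> g)"
proof -
  obtain K where K: "jet_order K f"
    using diff_fun_order[OF assms(1)] by blast
  show ?thesis
    unfolding vadj_eq_sum[OF K, abs_def]
    by (intro fibre_periodic_sum fibre_periodic_compose[where h = "\<lambda>x. _ *\<^sub>R x"] fibre_periodic_vd_pow
        smooth_vadj_term fibre_periodic_vadj_term assms)
qed

lemma fibre_periodic_vham:
  assumes "\<And>k u. K < k \<Longrightarrow> B k u = 0" "smooth_on S \<psi>" "fibre_periodic \<psi>" "smooth_on S \<xi>" "fibre_periodic \<xi>"
  shows "fibre_periodic (vham X B \<psi> \<xi>)"
proof -
  have "vham X B \<psi> \<xi> = (\<lambda>e. \<Sum>k\<le>K. B k (vjet X \<psi> e) *v (vd X ^^ k) \<xi> e)"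
    by (intro ext vham_eq_sum assms(1))
  then show ?thesis
    by (simp only:) (intro fibre_periodic_sum fibre_periodic_compose2[where h = "\<lambda>u. (*v) (B _ u)"]
        fibre_periodic_vjet fibre_periodic_vd_pow assms)
qed

lemma fibre_periodic_adjoint_terms:
  fixes a b :: "(real ^ 'm) \<times> 'p \<Rightarrow> real ^ 'n"
  assumes "smooth_on S a" "smooth_on S b" "fibre_periodic a" "fibre_periodic b"
  shows "fibre_periodic (\<lambda>e. (vd X ^^ j) a e \<bullet> ((- 1) ^ k *\<^sub>R (vd X ^^ k) b e))"
  by (rule fibre_periodic_compose2[where h = "\<lambda>x y. x \<bullet> ((- 1) ^ k *\<^sub>R y)"])
    (intro fibre_periodic_vd_pow assms)+

lemma fibre_periodic_vbdry:
  assumes "smooth_on S \<psi>" "fibre_periodic \<psi>" "smooth_on S g" "fibre_periodic g" "diff_fun f"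
    "smooth_on S a" "fibre_periodic a"
  shows "fibre_periodic (vbdry K X f \<psi> a g)"
  unfolding vbdry_def[abs_def]
  by (intro fibre_periodic_sum fibre_periodic_adjoint_terms smooth_vadj_term fibre_periodic_vadj_term assms)

lemma fibre_mean_adjoint:
  fixes a b :: "(real ^ 'm) \<times> 'p \<Rightarrow> real ^ 'n"
  assumes a: "smooth_on S a" "fibre_periodic a" and b: "smooth_on S b" "fibre_periodic b" and p: "p \<in> W" "\<zeta> p = 0"
  shows "fibre_mean (\<lambda>e. a e \<bullet> ((- 1) ^ l *\<^sub>R (vd X ^^ l) b e)) p = fibre_mean (\<lambda>e. (vd X ^^ l) a e \<bullet> b e) p"
proof -
  let ?r = "\<lambda>e. \<Sum>j<l. (vd X ^^ j) a e \<bullet> ((- 1) ^ (l - 1 - j) *\<^sub>R (vd X ^^ (l - 1 - j)) b e)"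
  have r: "smooth_on S ?r" "fibre_periodic ?r"
    by (intro smooth_on_sum smooth_on_inner smooth_on_scaleR smooth_on_const smooth_vd_pow a b open_S)
      (intro fibre_periodic_sum fibre_periodic_adjoint_terms a b)
  have "fibre_mean (\<lambda>e. a e \<bullet> ((- 1) ^ l *\<^sub>R (vd X ^^ l) b e)) p
      = fibre_mean (\<lambda>e. (vd X ^^ l) a e \<bullet> b e - vd X ?r e) p"
    by (rule fibre_mean_cong) (rule adjoint_identity[OF a(1) b(1)], use p in simp)
  also have "\<dots> = fibre_mean (\<lambda>e. (vd X ^^ l) a e \<bullet> b e) p - fibre_mean (vd X ?r) p"
    by (intro fibre_mean_diff smooth_on_inner smooth_vd_pow smooth_vd r a b p open_S)
  finally show ?thesis
    using fibre_mean_vd_zero[OF r p] by simp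
qed

lemma fibre_mean_inner_vadj:
  assumes f: "diff_fun f" and \<psi>: "smooth_on S \<psi>" "fibre_periodic \<psi>" and a: "smooth_on S a" "fibre_periodic a"
    and p: "p \<in> W" "\<zeta> p = 0"
  shows "fibre_mean (\<lambda>e. a e \<bullet> vadj X f \<psi> (\<lambda>_. 1) e) p = fibre_mean (vlin X f \<psi> a) p"
proof -
  obtain K where K: "jet_order K f"
    using diff_fun_order[OF f] by blast
  have "fibre_mean (\<lambda>e. a e \<bullet> vadj X f \<psi> (\<lambda>_. 1) e) p
      = fibre_mean (\<lambda>e. vlin X f \<psi> a e - vd X (vbdry K X f \<psi> a (\<lambda>_. 1)) e) p"
    by (rule fibre_mean_cong) (use inner_vadj[OF f K \<psi>(1) a(1) smooth_on_const, of "(_, p)"] p in simp)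
  also have "\<dots> = fibre_mean (vlin X f \<psi> a) p - fibre_mean (vd X (vbdry K X f \<psi> a (\<lambda>_. 1))) p"
    by (intro fibre_mean_diff smooth_vlin smooth_vd smooth_vbdry f \<psi> a p smooth_on_const)
  also have "fibre_mean (vd X (vbdry K X f \<psi> a (\<lambda>_. 1))) p = 0"
    by (intro fibre_mean_vd_zero smooth_vbdry fibre_periodic_vbdry f \<psi> a p smooth_on_const fibre_periodic_const)
  finally show ?thesis
    by simp
qed

text \<open>Under the mean, the l - 1 - j derivatives still on the coefficient can be moved back to
  \<open>a\<close>. All \<open>l\<close> terms of the inner sum then coincide, which is the origin
  of the factor \<open>real l\<close> in \<open>vmom\<close>. The function \<open>g\<close> comes
  out as a factor only at that point, when no derivative falls on it any more.\<close>

lemma fibre_mean_vbdry: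
  fixes f :: "'n::finite jet \<Rightarrow> real"
  assumes f: "diff_fun f" and \<psi>: "smooth_on S \<psi>" "fibre_periodic \<psi>" and a: "smooth_on S a" "fibre_periodic a"
    and g: "smooth_on W g" and p: "p \<in> W" "\<zeta> p = 0"
  shows "fibre_mean (vbdry K X f \<psi> a (\<lambda>e. g (snd e))) p = g p * fibre_mean (vmom K X f \<psi> a) p"
proof -
  let ?b = "\<lambda>l e. \<chi> i. pd l i f (vjet X \<psi> e) * g (snd e)"
  let ?c = "\<lambda>l e. \<chi> i. pd l i f (vjet X \<psi> e)"
  have b: "smooth_on S (?b l)" "fibre_periodic (?b l)" for l
    by (intro smooth_vadj_term smooth_on_base fibre_periodic_vadj_term fibre_periodic_base f \<psi> g)+
  have c: "smooth_on S (?c l)" for l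
    by (intro smooth_on_vec_lambda smooth_diff_fun_vjet diff_fun_pd f \<psi> open_S)
  have "fibre_mean (vbdry K X f \<psi> a (\<lambda>e. g (snd e))) p
      = (\<Sum>l\<le>K. \<Sum>j<l. fibre_mean (\<lambda>e. (vd X ^^ j) a e \<bullet> ((- 1) ^ (l - 1 - j) *\<^sub>R (vd X ^^ (l - 1 - j)) (?b l) e)) p)"
    unfolding vbdry_def[abs_def]
    by (subst fibre_mean_sum[OF _ p(1)], (intro smooth_on_sum smooth_on_inner smooth_on_scaleR smooth_on_const smooth_vd_pow a b open_S)[1],
        intro sum.cong refl fibre_mean_sum smooth_on_inner smooth_on_scaleR smooth_on_const smooth_vd_pow a b open_S p)
  also have "\<dots> = (\<Sum>l\<le>K. \<Sum>j<l. fibre_mean (\<lambda>e. (vd X ^^ (l - 1)) a e \<bullet> ?b l e) p)"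
  proof (intro sum.cong refl)
    fix l j :: nat
    assume "j \<in> {..<l}"
    then have "(vd X ^^ (l - 1 - j)) ((vd X ^^ j) a) = (vd X ^^ (l - 1)) a"
      by (simp add: funpow_add[symmetric, THEN fun_cong, unfolded o_apply])
    then show "fibre_mean (\<lambda>e. (vd X ^^ j) a e \<bullet> ((- 1) ^ (l - 1 - j) *\<^sub>R (vd X ^^ (l - 1 - j)) (?b l) e)) p
        = fibre_mean (\<lambda>e. (vd X ^^ (l - 1)) a e \<bullet> ?b l e) p"
      using fibre_mean_adjoint[OF smooth_vd_pow[OF a(1)] fibre_periodic_vd_pow[OF a] b p] by simp
  qed
  also have "\<dots> = (\<Sum>l\<le>K. real l * fibre_mean (\<lambda>e. g (snd e) * ((vd X ^^ (l - 1)) a e \<bullet> ?c l e)) p)"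
    by (simp add: inner_vec_def sum_distrib_left mult_ac)
  also have "\<dots> = (\<Sum>l\<le>K. g p * fibre_mean (\<lambda>e. real l * ((vd X ^^ (l - 1)) a e \<bullet> ?c l e)) p)"
    by (simp add: fibre_mean_base_mult[of g] fibre_mean_cmult mult.left_commute)
  also have "\<dots> = g p * (\<Sum>l\<le>K. fibre_mean (\<lambda>e. real l * ((vd X ^^ (l - 1)) a e \<bullet> ?c l e)) p)"
    by (simp add: sum_distrib_left)
  also have "(\<Sum>l\<le>K. fibre_mean (\<lambda>e. real l * ((vd X ^^ (l - 1)) a e \<bullet> ?c l e)) p) = fibre_mean (vmom K X f \<psi> a) p"
    unfolding vmom_def[abs_def]
    by (intro fibre_mean_sum[symmetric] smooth_on_mult smooth_on_inner smooth_on_const smooth_vd_pow a c open_S p)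
  finally show ?thesis .
qed

text \<open>Pointwise skew-symmetry replaces the operator by minus its formal adjoint, and
  integration by parts on the torus moves all derivatives to the other factor.\<close>

lemma fibre_mean_vham_skew:
  fixes B :: "'n::finite coeffs"
  assumes B: "local_poisson_bracket B"
    and \<psi>: "smooth_on S \<psi>" "fibre_periodic \<psi>" and \<xi>: "smooth_on S \<xi>" "fibre_periodic \<xi>"
    and \<eta>: "smooth_on S \<eta>" "fibre_periodic \<eta>" and p: "p \<in> W" "\<zeta> p = 0"
  shows "fibre_mean (\<lambda>e. \<xi> e \<bullet> vham X B \<psi> \<eta> e) p = - fibre_mean (\<lambda>e. vham X B \<psi> \<xi> e \<bullet> \<eta> e) p"
proof -
  obtain K where K: "\<And>k u. K < k \<Longrightarrow> B k u = 0"
    using B unfolding local_poisson_bracket_def by blast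
  have Bk: "diff_fun (B k)" for k
    using B by (simp add: local_poisson_bracket_def)
  have adj: "x \<bullet> (y v* A) = (A *v x) \<bullet> y" for x y and A :: "real ^ 'n ^ 'n"
    by (metis dot_lmul_matrix inner_commute)
  let ?b = "\<lambda>k e. \<eta> e v* B k (vjet X \<psi> e)"
  have b: "smooth_on S (?b k)" "fibre_periodic (?b k)" for k
    by (intro smooth_vham_adj_term Bk \<psi> \<eta>)
      (rule fibre_periodic_compose2[OF \<eta>(2) fibre_periodic_vjet[OF \<psi>], where h = "\<lambda>x u. x v* B k u"])
  have skew: "vham X B \<psi> \<eta> (\<theta>, p) = - vham_adj K X B \<psi> \<eta> (\<theta>, p)" for \<theta>
  proof -
    \<comment> \<open>Since \<zeta> vanishes at \<open>p\<close>, the straight line with direction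
      \<open>\<kappa> p\<close> in the fibre is an integral curve through the given point.\<close>
    let ?c = "\<lambda>x. (\<theta> + x *\<^sub>R \<kappa> p, p)"
    have "vham X B \<psi> \<eta> (?c 0) = - vham_adj K X B \<psi> \<eta> (?c 0)"
    proof (rule vham_skew[OF B K _ _ _ \<psi>(1) \<eta>(1)])
      show "(?c has_vector_derivative X (?c x)) (at x)" for x
        using p by (auto simp: X_def has_vector_derivative_def intro!: derivative_eq_intros)
      show "smooth_on UNIV ?c"
        by (intro smooth_on_Pair smooth_on_add smooth_on_scaleR smooth_on_const smooth_on_ident open_UNIV)
    qed (use p in auto)
    then show ?thesis
      by simp
  qed
  have "fibre_mean (\<lambda>e. \<xi> e \<bullet> vham X B \<psi> \<eta> e) p = fibre_mean (\<lambda>e. - 1 * (\<xi> e \<bullet> vham_adj K X B \<psi> \<eta> e)) p"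
    by (rule fibre_mean_cong) (simp add: skew)
  also have "\<dots> = - fibre_mean (\<lambda>e. \<xi> e \<bullet> vham_adj K X B \<psi> \<eta> e) p"
    using fibre_mean_base_mult[of "\<lambda>_. - 1"] by simp
  also have "fibre_mean (\<lambda>e. \<xi> e \<bullet> vham_adj K X B \<psi> \<eta> e) p
      = fibre_mean (\<lambda>e. \<Sum>k\<le>K. \<xi> e \<bullet> ((- 1) ^ k *\<^sub>R (vd X ^^ k) (?b k) e)) p"
    by (simp add: vham_adj_def inner_sum_right)
  also have "\<dots> = (\<Sum>k\<le>K. fibre_mean (\<lambda>e. \<xi> e \<bullet> ((- 1) ^ k *\<^sub>R (vd X ^^ k) (?b k) e)) p)"
    by (intro fibre_mean_sum smooth_on_inner smooth_on_scaleR smooth_on_const smooth_vd_pow \<xi> b open_S p)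
  also have "\<dots> = (\<Sum>k\<le>K. fibre_mean (\<lambda>e. (vd X ^^ k) \<xi> e \<bullet> ?b k e) p)"
    by (simp only: fibre_mean_adjoint[OF \<xi> b p])
  also have "\<dots> = fibre_mean (\<lambda>e. \<Sum>k\<le>K. (vd X ^^ k) \<xi> e \<bullet> ?b k e) p"
    by (intro fibre_mean_sum[symmetric] smooth_on_inner smooth_vd_pow \<xi> b open_S p)
  also have "\<dots> = fibre_mean (\<lambda>e. vham X B \<psi> \<xi> e \<bullet> \<eta> e) p"
    by (simp add: vham_eq_sum[OF K] inner_sum_left adj)
  finally show ?thesis .
qed

end

section \<open>Smoothness of the inverse map\<close>

lemma smooth_on_det:
  fixes A :: "'a::real_normed_vector \<Rightarrow> real ^ 'n ^ 'n"
  assumes "open S" "\<And>i j. smooth_on S (\<lambda>x. A x $ i $ j)"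
  shows "smooth_on S (\<lambda>x. det (A x))"
  unfolding det_def by (intro smooth_on_sum smooth_on_mult smooth_on_prod smooth_on_const assms)

text \<open>Invariance of domain makes the image open. The derivative of the inverse is written by
  Cramer's rule as a smooth function of the preimage, composed with the inverse itself; each order
  of differentiability of the inverse thus gives the next.\<close>

lemma smooth_on_inv_into:
  fixes U :: "real ^ 'N \<Rightarrow> real ^ 'N"
  assumes V: "open V" and U: "smooth_on V U" and inj: "inj_on U V"
    and J: "\<And>p. p \<in> V \<Longrightarrow> det (matrix (frechet_derivative U (at p))) \<noteq> 0"
  shows "open (U ` V)" "smooth_on (U ` V) (inv_into V U)"
proof -
  show UV: "open (U ` V)"
    by (rule invariance_of_domain[OF smooth_on_imp_continuous_on[OF U] V inj])
  let ?G = "inv_into V U" and ?J = "\<lambda>p. matrix (frechet_derivative U (at p))"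
  define c where "c = (\<lambda>w p. \<chi> k. det (\<chi> i j. if j = k then w $ i else ?J p $ i $ j) / det (?J p))"
  have Jw: "frechet_derivative U (at p) x = ?J p *v x" if "p \<in> V" for p x
    using fun_cong[OF matrix_vector_mul(2)[OF smooth_on_frechet_linear[OF U that]], of x] by (rule sym)
  have c: "frechet_derivative U (at p) (c w p) = w" if "p \<in> V" for p w
    using cramer[OF J[OF that], of "c w p" w] by (simp add: c_def Jw[OF that])
  have deriv: "(?G has_derivative (\<lambda>w. c w (?G y))) (at y)" if y: "y \<in> U ` V" for y
  proof -
    have p: "?G y \<in> V" "U (?G y) = y"
      using y by (auto intro: inv_into_into f_inv_into_f)
    have "(?G has_derivative (\<lambda>w. c w (?G y))) (at (U (?G y)))"
      by (rule has_derivative_inverse_strong[OF V p(1) smooth_on_imp_continuous_on[OF U] _ smooth_on_has_derivative[OF U p(1)]])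
        (auto simp: inj c[OF p(1)] fun_eq_iff)
    then show ?thesis
      by (simp only: p)
  qed
  have Jij: "smooth_on V (\<lambda>p. ?J p $ i $ j)" for i j
    unfolding matrix_def by (auto intro!: smooth_on_nth smooth_on_frechet_derivative U V)
  have "smooth_on V (\<lambda>p. if j = k then w $ i else ?J p $ i $ j)" for i j k w
    by (cases "j = k") (auto intro: smooth_on_const Jij)
  then have smooth_c: "smooth_on V (c w)" for w
    unfolding c_def divide_inverse
    by (intro smooth_on_vec_lambda smooth_on_mult smooth_on_inverse smooth_on_det V J) (simp_all add: Jij)
  have "higher_differentiable_on (U ` V) ?G r" for r
  proof (induction r)
    case 0
    show ?case
      using has_derivative_continuous[OF deriv] by (auto intro!: continuous_at_imp_continuous_on)
  next
    case (Suc r)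
    have "higher_differentiable_on (U ` V) (\<lambda>y. c w (?G y)) r" for w
      by (rule higher_differentiable_on_compose[OF UV V _ _ Suc.IH])
        (use smooth_c in \<open>auto simp: smooth_on_def inj\<close>)
    then have "higher_differentiable_on (U ` V) (\<lambda>y. frechet_derivative ?G (at y) w) r" for w
      by (rule higher_differentiable_on_cong[OF UV, rotated]) (rule frechet_derivative_eq[OF deriv, symmetric])
    then show ?case
      using deriv by (auto simp: differentiable_def)
  qed
  then show "smooth_on (U ` V) ?G"
    by (simp add: smooth_on_def)
qed

section \<open>Rationally independent wave numbers\<close>

definition rationally_independent :: "real ^ 'm::finite \<Rightarrow> bool" where
  "rationally_independent k \<longleftrightarrow> (\<forall>n :: 'm \<Rightarrow> int. (\<Sum>\<alpha>\<in>UNIV. of_int (n \<alpha>) * k $ \<alpha>) = 0 \<longrightarrow> (\<forall>\<alpha>. n \<alpha> = 0))"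

text \<open>Each nontrivial integer relation confines \<open>p\<close> to a hyperplane, whose normal
  \<open>a n\<close> is nonzero because \<open>L\<close> is injective. Countably many hyperplanes
  are negligible, a nonempty open set is not.\<close>

lemma exists_rationally_independent:
  fixes L :: "'m::finite \<Rightarrow> 'N::finite"
  assumes "inj L" "open S" "S \<noteq> {}"
  obtains p :: "real ^ 'N" where "p \<in> S" "rationally_independent (\<chi> \<alpha>. p $ L \<alpha>)"
proof -
  define a where "a = (\<lambda>n :: 'm \<Rightarrow> int. \<Sum>\<alpha>\<in>UNIV. of_int (n \<alpha>) *\<^sub>R axis (L \<alpha>) (1 :: real))"
  have a: "a n \<bullet> p = (\<Sum>\<alpha>\<in>UNIV. of_int (n \<alpha>) * p $ L \<alpha>)" for n p
    by (simp add: a_def inner_sum_left inner_axis')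
  have a0: "a n \<noteq> 0" if "n \<alpha> \<noteq> 0" for n \<alpha>
  proof
    assume "a n = 0"
    then have "a n \<bullet> axis (L \<alpha>) 1 = 0"
      by simp
    also have "a n \<bullet> axis (L \<alpha>) 1 = (\<Sum>\<beta>\<in>UNIV. if \<beta> = \<alpha> then of_int (n \<alpha>) else 0)"
      unfolding a using injD[OF assms(1)] by (intro sum.cong) (auto simp: axis_def)
    finally show False
      using that by simp
  qed
  let ?bad = "\<Union>n\<in>{n. \<exists>\<alpha>. n \<alpha> \<noteq> 0}. {p. a n \<bullet> p = 0}"
  have "negligible ?bad"
    using a0 by (intro negligible_countable_Union) (auto intro!: negligible_hyperplane)
  then have "\<not> S \<subseteq> ?bad"
    using open_not_negligible[OF assms(2,3)] negligible_subset by blast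
  then obtain p where "p \<in> S" "p \<notin> ?bad"
    by blast
  then show thesis
    using that[of p] by (auto simp: rationally_independent_def a)
qed

lemma periodic_int_shift:
  fixes g :: "real ^ 'm::finite \<Rightarrow> 'b" and n :: "'m \<Rightarrow> int"
  assumes "periodic g"
  shows "g (\<theta> + (\<chi> \<alpha>. 2 * pi * of_int (n \<alpha>))) = g \<theta>"
proof -
  have nat: "g (\<theta> + (real j * (2 * pi)) *\<^sub>R axis \<alpha> 1) = g \<theta>" for \<theta> \<alpha> j
  proof (induction j)
    case (Suc j)
    have eq: "\<theta> + (real (Suc j) * (2 * pi)) *\<^sub>R axis \<alpha> 1 = \<theta> + (real j * (2 * pi)) *\<^sub>R axis \<alpha> 1 + (2 * pi) *\<^sub>R axis \<alpha> 1"
      by (simp add: algebra_simps)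
    show ?case
      unfolding eq using assms[unfolded periodic_def, rule_format] Suc.IH by (rule trans)
  qed simp
  have int: "g (\<theta> + (of_int j * (2 * pi)) *\<^sub>R axis \<alpha> 1) = g \<theta>" for \<theta> \<alpha> j
  proof (cases "0 \<le> j")
    case True
    then show ?thesis
      using nat[of \<theta> "nat j" \<alpha>] by simp
  next
    case False
    then show ?thesis
      using nat[of "\<theta> + (of_int j * (2 * pi)) *\<^sub>R axis \<alpha> 1" "nat (- j)" \<alpha>] by (simp add: algebra_simps)
  qed
  have "g (\<theta> + (\<Sum>\<alpha>\<in>I. (of_int (n \<alpha>) * (2 * pi)) *\<^sub>R axis \<alpha> 1)) = g \<theta>" if "finite I" for I
    using that
  proof (induction I)
    case (insert \<alpha> I)
    then show ?case
      using int[of "\<theta> + (\<Sum>\<alpha>\<in>I. (of_int (n \<alpha>) * (2 * pi)) *\<^sub>R axis \<alpha> 1)" "n \<alpha>" \<alpha>] by (simp add: add_ac)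
  qed simp
  from this[of UNIV] show ?thesis
    by (simp add: vec_lambda_sum_axis mult.commute)
qed

text \<open>This is Kronecker's approximation theorem, rescaled from period 1 to period 2
  pi.\<close>

lemma rationally_independent_line_dense:
  fixes k :: "real ^ 'm::finite"
  assumes k: "rationally_independent k" and "\<epsilon> > 0"
  obtains t n where "norm (t *\<^sub>R k + (\<chi> \<alpha>. 2 * pi * of_int (n \<alpha>)) - \<theta>) < \<epsilon>"
proof -
  obtain b where b: "bij_betw b {0..<CARD('m)} (UNIV :: 'm set)"
    using ex_bij_betw_nat_finite[of "UNIV :: 'm set"] by auto
  define M where "M = CARD('m)"
  have bM: "bij_betw b {..<M} UNIV"
    using b by (simp add: M_def atLeast0LessThan)
  define x where "x = (\<lambda>i. k $ b i)"
  \<comment> \<open>Independence is asked of the set of the components, so repetitions must be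
    excluded: two equal components would satisfy a relation with coefficients 1 and -1.\<close>
  have inj_k: "inj (($) k)"
  proof (rule injI, rule ccontr)
    fix \<alpha> \<beta>
    assume *: "k $ \<alpha> = k $ \<beta>" "\<alpha> \<noteq> \<beta>"
    define n :: "'m \<Rightarrow> int" where "n = (\<lambda>\<gamma>. if \<gamma> = \<alpha> then 1 else if \<gamma> = \<beta> then - 1 else 0)"
    have "(\<Sum>\<gamma>\<in>UNIV. of_int (n \<gamma>) * k $ \<gamma>)
        = (\<Sum>\<gamma>\<in>UNIV. (if \<gamma> = \<alpha> then k $ \<gamma> else 0) + (if \<gamma> = \<beta> then - k $ \<gamma> else 0))"
      using *(2) by (intro sum.cong) (auto simp: n_def)
    also have "\<dots> = 0"
      using * by (simp add: sum.distrib)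
    finally have "n \<alpha> = 0"
      using k unfolding rationally_independent_def by blast
    then show False
      by (simp add: n_def)
  qed
  have inj_x: "inj_on x {..<M}"
    unfolding x_def using bij_betw_imp_inj_on[OF bM] injD[OF inj_k] by (auto simp: inj_on_def)
  \<comment> \<open>Kronecker's theorem needs linear independence over the integers, hence the reals
    as a module over them.\<close>
  interpret Modules.module "(\<lambda>r. (*) (real_of_int r))"
    by (simp add: Modules.module.intro distrib_left mult.commute)
  have indep: "independent (x ` {..<M})"
  proof
    assume "dependent (x ` {..<M})"
    then obtain t u where t: "finite t" "t \<subseteq> x ` {..<M}" "(\<Sum>v\<in>t. of_int (u v) * v) = 0" "\<exists>v\<in>t. u v \<noteq> 0"
      unfolding dependent_explicit by blast
    have tk: "t \<subseteq> range (($) k)"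
      using t(2) by (auto simp: x_def)
    define n where "n = (\<lambda>\<alpha>. if k $ \<alpha> \<in> t then u (k $ \<alpha>) else 0)"
    have "(\<Sum>\<alpha>\<in>UNIV. of_int (n \<alpha>) * k $ \<alpha>)
        = (\<Sum>\<alpha>\<in>{\<alpha>. k $ \<alpha> \<in> t}. of_int (u (k $ \<alpha>)) * k $ \<alpha>)"
      by (rule sum.mono_neutral_cong_right) (auto simp: n_def)
    also have "\<dots> = (\<Sum>v\<in>t. of_int (u v) * v)"
      by (rule sum.reindex_bij_betw) (use tk inj_k in \<open>auto simp: bij_betw_def inj_on_def dest: injD\<close>)
    finally have "n \<alpha> = 0" for \<alpha>
      using k t(3) unfolding rationally_independent_def by metis
    then have "u (k $ \<alpha>) = 0" if "k $ \<alpha> \<in> t" for \<alpha>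
      using that unfolding n_def by metis
    then show False
      using t(4) tk by blast
  qed
  \<comment> \<open>Every component of the error is at most 2 pi d, and the norm at most their sum;
    the extra 1 in the denominator makes the final bound strict.\<close>
  define d where "d = \<epsilon> / (2 * pi * (real CARD('m) + 1))"
  have "d > 0"
    using \<open>\<epsilon> > 0\<close> by (simp add: d_def add_pos_nonneg)
  obtain t h where th: "\<And>i. i < M \<Longrightarrow> \<bar>t * x i - of_int (h i) - \<theta> $ b i / (2 * pi)\<bar> < d"
    using Kronecker_thm_1[OF indep inj_x \<open>d > 0\<close>, of "\<lambda>i. \<theta> $ b i / (2 * pi)"] by blast
  \<comment> \<open>The sign appears because the theorem subtracts the integers that are added here;
    the time on the line is 2 pi t.\<close>
  define n where "n = (\<lambda>\<alpha>. - h (inv_into {..<M} b \<alpha>))"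
  have comp: "\<bar>((2 * pi * t) *\<^sub>R k + (\<chi> \<alpha>. 2 * pi * of_int (n \<alpha>)) - \<theta>) $ \<alpha>\<bar> \<le> 2 * pi * d" for \<alpha>
  proof -
    define i where "i = inv_into {..<M} b \<alpha>"
    have i: "i < M" "b i = \<alpha>"
      using bM inv_into_into[of \<alpha> b "{..<M}"] f_inv_into_f[of \<alpha> b "{..<M}"] by (auto simp: i_def bij_betw_def)
    have "((2 * pi * t) *\<^sub>R k + (\<chi> \<alpha>. 2 * pi * of_int (n \<alpha>)) - \<theta>) $ \<alpha>
        = 2 * pi * (t * x i - of_int (h i) - \<theta> $ b i / (2 * pi))"
      using i by (simp add: n_def i_def[symmetric] x_def algebra_simps)
    also have "\<bar>\<dots>\<bar> = 2 * pi * \<bar>t * x i - of_int (h i) - \<theta> $ b i / (2 * pi)\<bar>"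
      by (simp add: abs_mult)
    finally show ?thesis
      using th[OF i(1)] by simp
  qed
  have "norm ((2 * pi * t) *\<^sub>R k + (\<chi> \<alpha>. 2 * pi * of_int (n \<alpha>)) - \<theta>) \<le> (\<Sum>\<alpha>\<in>(UNIV :: 'm set). 2 * pi * d)"
    by (rule order_trans[OF norm_le_l1_cart sum_mono]) (rule comp)
  also have "\<dots> < 2 * pi * d * (real CARD('m) + 1)"
    using \<open>d > 0\<close> by (simp add: algebra_simps)
  also have "\<dots> = \<epsilon>"
    by (simp add: d_def add_pos_nonneg less_imp_neq[symmetric])
  finally show thesis
    by (rule that)
qed

text \<open>The set of agreement is closed, invariant under the periods, and contains the line,
  whose translates by periods are dense.\<close>

lemma continuous_periodic_eq_on_dense_line:
  fixes f g :: "real ^ 'm::finite \<Rightarrow> 'b::real_normed_vector"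
  assumes k: "rationally_independent k" and f: "continuous_on UNIV f" "periodic f"
    and g: "continuous_on UNIV g" "periodic g" and eq: "\<And>x :: real. f (x *\<^sub>R k) = g (x *\<^sub>R k)"
  shows "f = g"
proof
  fix \<theta>
  let ?D = "{\<theta>. f \<theta> = g \<theta>}"
  have "closed ?D"
    using f(1) g(1) by (intro closed_Collect_eq)
  moreover have "\<theta> \<in> closure ?D"
    unfolding closure_approachable
  proof (intro allI impI)
    fix \<epsilon> :: real
    assume "\<epsilon> > 0"
    then obtain t n where "norm (t *\<^sub>R k + (\<chi> \<alpha>. 2 * pi * of_int (n \<alpha>)) - \<theta>) < \<epsilon>"
      using rationally_independent_line_dense[OF k] by blast
    then show "\<exists>y\<in>?D. dist y \<theta> < \<epsilon>"
      using eq by (intro bexI[of _ "t *\<^sub>R k + (\<chi> \<alpha>. 2 * pi * of_int (n \<alpha>))"])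
        (auto simp: dist_norm periodic_int_shift f g)
  qed
  ultimately show "f \<theta> = g \<theta>"
    by simp
qed

section \<open>A dimension count\<close>

text \<open>
  The relations \<open>Y\<close> among the variational derivatives have dimension at least \<open>m\<close>, because \<open>\<Omega>\<close> has rank
  \<open>m\<close> and the kernel of \<open>\<Omega>\<close> is spanned by \<open>Y\<close> and \<open>s\<close> further vectors.
\<close>

lemma relations_dimension_count:
  fixes \<Omega> :: "real ^ 'N::finite ^ 'm::finite" and J :: "real ^ 'N ^ 'N"
  assumes card: "CARD('N) = 2 * CARD('m) + s" and rank: "rank \<Omega> = CARD('m)"
    and Y: "subspace Y" "\<And>c. \<Omega> *v c = 0 \<Longrightarrow> \<exists>d. c - (\<Sum>l<s. d l *\<^sub>R \<gamma> l) \<in> Y"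
    and J: "det J \<noteq> 0" "card I = CARD('m)" "\<And>c j. c \<in> Y \<Longrightarrow> j \<notin> I \<Longrightarrow> (c v* J) $ j = 0"
    and c: "\<And>j. j \<notin> I \<Longrightarrow> (c v* J) $ j = 0"
  shows "c \<in> Y"
proof -
  obtain E where E: "E \<subseteq> Y" "independent E" "Y \<subseteq> span E" "card E = dim Y"
    using basis_exists by blast
  have "finite E"
    using E(2) by (rule independent_imp_finite)
  have "surj ((*v) \<Omega>)"
    using rank full_rank_surjective by blast
  then have "\<forall>\<alpha>. \<exists>x. \<Omega> *v x = axis \<alpha> 1"
    by (metis surjD)
  then obtain b where b: "\<And>\<alpha>. \<Omega> *v b \<alpha> = axis \<alpha> 1"
    using choice[of "\<lambda>\<alpha> x. \<Omega> *v x = axis \<alpha> 1"] by blast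
  \<comment> \<open>Subtracting a combination of the preimages \<open>b\<close> of the axes brings
    any vector into the kernel of \<Omega>, which lies in the span of \<open>Y\<close> and the
    vectors \<gamma>. Counting generators gives 2m + s \<le> dim Y + s + m.\<close>
  let ?E = "E \<union> \<gamma> ` {..<s} \<union> range b"
  have "c \<in> span ?E" for c
  proof -
    let ?k = "c - (\<Sum>\<alpha>\<in>UNIV. (\<Omega> *v c) $ \<alpha> *\<^sub>R b \<alpha>)"
    have "\<Omega> *v ?k = 0"
      by (simp add: matrix_vector_mult_diff_distrib matrix_vector_right_distrib matrix_vector_mult_scaleR b
          linear_sum[OF matrix_vector_mul_linear] vec_lambda_sum_axis[symmetric])
    then obtain d where d: "?k - (\<Sum>l<s. d l *\<^sub>R \<gamma> l) \<in> Y"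
      using Y(2) by blast
    have "c = (?k - (\<Sum>l<s. d l *\<^sub>R \<gamma> l)) + (\<Sum>l<s. d l *\<^sub>R \<gamma> l) + (\<Sum>\<alpha>\<in>UNIV. (\<Omega> *v c) $ \<alpha> *\<^sub>R b \<alpha>)"
      by simp
    also have "\<dots> \<in> span ?E"
    proof (intro span_add span_sum span_scale)
      show "?k - (\<Sum>l<s. d l *\<^sub>R \<gamma> l) \<in> span ?E"
        using d E(3) span_mono[of E ?E] by blast
    qed (auto intro: span_base)
    finally show ?thesis .
  qed
  then have "dim (UNIV :: (real ^ 'N) set) \<le> card ?E"
    by (intro dim_le_card) (use \<open>finite E\<close> in auto)
  also have "\<dots> \<le> card E + card (\<gamma> ` {..<s}) + card (range b)"
    by (meson add_le_mono1 card_Un_le order_trans)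
  also have "\<dots> \<le> dim Y + s + CARD('m)"
    using card_image_le[of "{..<s}" \<gamma>] card_image_le[of UNIV b] E(4) by simp
  finally have dimY: "CARD('m) \<le> dim Y"
    using card by simp
  \<comment> \<open>As \<open>J\<close> is invertible, \<open>?C\<close> has dimension at most m. It
    contains \<open>Y\<close>, whose dimension is at least m, so the two subspaces coincide, and the
    given \<open>c\<close> lies in \<open>?C\<close>.\<close>
  let ?C = "{c. \<forall>j. j \<notin> I \<longrightarrow> (c v* J) $ j = 0}"
  have detT: "det (transpose J) \<noteq> 0"
    using J(1) by simp
  have "\<forall>j. \<exists>x. x v* J = axis j 1"
    using cramer[OF detT] by simp
  then obtain r where r: "\<And>j. r j v* J = axis j 1"
    using choice[of "\<lambda>j x. x v* J = axis j 1"] by blast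
  have inj: "x = y" if "x v* J = y v* J" for x y
    using that cramer[OF detT, of x "y v* J"] cramer[OF detT, of y "y v* J"] by simp
  have "?C \<subseteq> span (r ` I)"
  proof
    fix c
    assume c: "c \<in> ?C"
    have "(\<Sum>j\<in>I. (c v* J) $ j *\<^sub>R r j) v* J = (\<Sum>j\<in>I. (c v* J) $ j *\<^sub>R (r j v* J))"
      by (simp only: bounded_bilinear.sum_left[OF bounded_bilinear_vector_matrix]
          bounded_bilinear.scaleR_left[OF bounded_bilinear_vector_matrix])
    also have "\<dots> = c v* J"
      using c by (auto simp: r vec_eq_iff axis_def if_distrib sum.If_cases cong: if_cong)
    finally have "c = (\<Sum>j\<in>I. (c v* J) $ j *\<^sub>R r j)"
      using inj[of "\<Sum>j\<in>I. (c v* J) $ j *\<^sub>R r j" c] by simp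
    also have "\<dots> \<in> span (r ` I)"
      by (intro span_sum span_scale span_base) auto
    finally show "c \<in> span (r ` I)" .
  qed
  then have "dim ?C \<le> card (r ` I)"
    by (rule dim_le_card) simp
  also have "\<dots> \<le> CARD('m)"
    using card_image_le[of I r] J(2) by simp
  finally have "dim ?C \<le> dim Y"
    using dimY by simp
  moreover have "subspace ?C"
    using linear_add[OF matrix_vector_mul_linear, of "transpose J"] linear_scale[OF matrix_vector_mul_linear, of "transpose J"]
    by (auto simp: subspace_def)
  ultimately have "Y = ?C"
    using subspace_dim_equal[OF Y(1)] J(3) by blast
  then show ?thesis
    using c by simp
qed

section \<open>Linearity of the Hamiltonian operator in the covector\<close>

context vector_field
begin

lemma vham_sum:
  fixes B :: "'n::finite coeffs"
  assumes K: "\<And>k u. K < k \<Longrightarrow> B k u = 0" and \<xi>: "\<And>i. i \<in> I \<Longrightarrow> smooth_on S (\<xi> i)" and e: "e \<in> S"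
  shows "vham X B \<psi> (\<lambda>e. \<Sum>i\<in>I. c i *\<^sub>R \<xi> i e) e = (\<Sum>i\<in>I. c i *\<^sub>R vham X B \<psi> (\<xi> i) e)"
proof -
  have "(vd X ^^ k) (\<lambda>e. \<Sum>i\<in>I. c i *\<^sub>R \<xi> i e) e = (\<Sum>i\<in>I. c i *\<^sub>R (vd X ^^ k) (\<xi> i) e)" for k
    using vd_pow_sum[of I "\<lambda>i e. c i *\<^sub>R \<xi> i e" e k] \<xi> e
    by (simp add: vd_pow_scaleR smooth_on_scaleR[OF open_S smooth_on_const])
  then show ?thesis
    by (simp add: vham_eq_sum[OF K] bounded_bilinear.sum_right[OF bounded_bilinear_matrix_vector]
        bounded_bilinear.scaleR_right[OF bounded_bilinear_matrix_vector] scaleR_sum_right sum.swap[of _ I])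
qed

lemma vham_diff:
  fixes B :: "'n::finite coeffs"
  assumes K: "\<And>k u. K < k \<Longrightarrow> B k u = 0" and "smooth_on S \<xi>" "smooth_on S \<eta>" and e: "e \<in> S"
  shows "vham X B \<psi> (\<lambda>e. \<xi> e - \<eta> e) e = vham X B \<psi> \<xi> e - vham X B \<psi> \<eta> e"
  by (simp add: vham_eq_sum[OF K] vd_pow_diff[OF assms(2,3) e] matrix_vector_mult_diff_distrib sum_subtractf)

end

lemma fun_basisD: "v \<in> S \<Longrightarrow> fun_basis I e S \<Longrightarrow> \<exists>c. \<forall>x. v x = (\<Sum>a\<in>I. c a *\<^sub>R e a x)"
  by (simp add: fun_basis_def)

lemma bounded_linear_wave_numbers: "bounded_linear (wave_numbers \<iota>)"
  unfolding linear_conv_bounded_linear[symmetric] by (auto intro!: linearI simp: wave_numbers_def vec_eq_iff)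

section \<open>Variational derivatives on the family\<close>

locale averaging =
  fixes B :: "'n::finite coeffs"
    and F :: "'n jet \<Rightarrow> real ^ 'n"
    and P_H :: "'n jet \<Rightarrow> real"
    and \<iota> :: "('m::finite, 'N::finite) labels"
    and s :: nat
    and W V :: "(real ^ 'N) set"
    and \<Phi> :: "('m, 'N, 'n) family"
    and N :: "nat \<Rightarrow> ('m, 'n) qp_functional"
    and dN :: "nat \<Rightarrow> ('m, 'n) qp_covector"
    and P :: "'N \<Rightarrow> 'n jet \<Rightarrow> real"
  assumes bracket: "local_poisson_bracket B"
    and system: "hamiltonian_system B P_H F"
    and family: "regular_hamiltonian_family B F \<iota> s W \<Phi> N dN"
    and integrals: "complete_hamiltonian_set B P_H \<iota> s W \<Phi> dN P"
    and open_V: "open V" and V_W: "V \<subseteq> W" and inj_V: "inj_on (integral_values \<iota> \<Phi> P) V"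
begin

abbreviation k :: "real ^ 'N \<Rightarrow> real ^ 'm" where "k \<equiv> wave_numbers \<iota>"

definition \<phi> :: "(real ^ 'm) \<times> (real ^ 'N) \<Rightarrow> real ^ 'n" where "\<phi> = (\<lambda>(\<theta>, p). \<Phi> \<theta> p)"

lemma m_phase: "m_phase_family F \<iota> W \<Phi>" and labels: "parameter_labels \<iota> s"
  using family by (auto simp: regular_hamiltonian_family_def complete_regular_family_def)

lemma open_W: "open W"
  using m_phase by (simp add: m_phase_family_def)

sublocale fam: torus_bundle W k "\<lambda>_. 0"
  by standard (auto intro: open_W smooth_on_const smooth_on_linear_map bounded_linear_wave_numbers)

lemma smooth_\<phi>: "smooth_on fam.S \<phi>" and periodic_\<phi>: "fam.fibre_periodic \<phi>"
  using m_phase by (auto simp: m_phase_family_def smooth_family_def \<phi>_def fam.fibre_periodic_def)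

lemma B_diff_fun: "diff_fun (B j)"
  using bracket by (simp add: local_poisson_bracket_def)

lemma B_order: "\<exists>KB. \<forall>j>KB. \<forall>u. B j u = 0"
  using bracket by (simp add: local_poisson_bracket_def)

lemma P_diff_fun: "diff_fun (P \<nu>)" and P_H_diff_fun: "diff_fun P_H"
  using integrals system by (auto simp: complete_hamiltonian_set_def hamiltonian_system_def)

definition grad :: "('n jet \<Rightarrow> real) \<Rightarrow> (real ^ 'm) \<times> (real ^ 'N) \<Rightarrow> real ^ 'n" where
  "grad f = vadj fam.X f \<phi> (\<lambda>_. 1)"

lemma smooth_grad: "diff_fun f \<Longrightarrow> smooth_on fam.S (grad f)"
  unfolding grad_def by (intro fam.smooth_vadj smooth_\<phi> smooth_on_const)

lemma periodic_grad: "diff_fun f \<Longrightarrow> fam.fibre_periodic (grad f)"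
  unfolding grad_def
  by (intro fam.fibre_periodic_vadj smooth_\<phi> periodic_\<phi> smooth_on_const fam.fibre_periodic_const)

lemma var_deriv_family:
  "diff_fun f \<Longrightarrow> p \<in> W \<Longrightarrow> var_deriv (k p) f (\<lambda>\<theta>. \<Phi> \<theta> p) = (\<lambda>\<theta>. grad f (\<theta>, p))"
  using fam.var_deriv_fibre[OF _ smooth_\<phi>] by (simp add: grad_def \<phi>_def)

lemma dird_family: "p \<in> W \<Longrightarrow> dird v (\<lambda>\<theta>. \<Phi> \<theta> p) \<theta> = frechet_derivative \<phi> (at (\<theta>, p)) (v, 0)"
  using fam.dird_fibre[OF smooth_\<phi>] by (simp add: \<phi>_def)

lemma average_eq: "p \<in> W \<Longrightarrow> average \<iota> \<Phi> f p = fibre_mean (\<lambda>e. f (vjet fam.X \<phi> e)) p"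
  using fam.jet_fibre[OF smooth_\<phi>] by (simp add: average_def fibre_mean_def \<phi>_def)

lemma smooth_average: "diff_fun f \<Longrightarrow> smooth_on W (average \<iota> \<Phi> f)"
  by (rule smooth_on_cong[OF open_W _ fam.smooth_fibre_mean[OF fam.smooth_diff_fun_vjet[OF _ smooth_\<phi>]]])
    (auto simp: average_eq)

lemma smooth_integral_values: "smooth_on W (integral_values \<iota> \<Phi> P)"
  unfolding integral_values_def[abs_def]
  by (intro smooth_on_vec_lambda smooth_average P_diff_fun open_W)

lemma fibre_line:
  assumes "p \<in> W"
  shows "((\<lambda>x. (\<theta> + x *\<^sub>R k p, p)) has_derivative (\<lambda>h. h *\<^sub>R (k p, 0))) (at x)"
    "fam.X (\<theta> + x *\<^sub>R k p, p) = (k p, 0)" "(\<theta> + x *\<^sub>R k p, p) \<in> fam.S"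
    "smooth_on UNIV (\<lambda>x :: real. (\<theta> + x *\<^sub>R k p, p))"
  using assms
  by (auto simp: fam.X_def intro!: derivative_eq_intros smooth_on_Pair smooth_on_add smooth_on_scaleR
      smooth_on_const smooth_on_ident)

lemma smooth_on_fibre_line:
  "p \<in> W \<Longrightarrow> smooth_on fam.S g \<Longrightarrow> smooth_on UNIV (\<lambda>x :: real. g (\<theta> + x *\<^sub>R k p, p))"
  by (rule smooth_on_compose[OF open_UNIV fam.open_S _ _ fibre_line(4)]) auto

text \<open>On the line the flow of the Hamiltonian is \<open>F\<close>, and on the family the
  m-phase equation identifies \<open>F\<close> with the derivative of \<Phi> along the frequencies.
  So the Hamiltonian, like the integrals, acts on the family by shifting the phases.\<close>

lemma vham_grad_P_H:
  assumes p: "p \<in> W"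
  shows "vham fam.X B \<phi> (grad P_H) (\<theta>, p) = frechet_derivative \<phi> (at (\<theta>, p)) (frequencies \<iota> p, 0)"
proof -
  let ?c = "\<lambda>x. (\<theta> + x *\<^sub>R k p, p)"
  have c: "(?c has_derivative (\<lambda>h. h *\<^sub>R (k p, 0))) (at x)" "1 *\<^sub>R (k p, 0) = fam.X (?c x)" "?c x \<in> fam.S" for x :: real
    using fibre_line[OF p] by simp_all
  have "vham fam.X B \<phi> (grad P_H) (?c 0) = ham_flow 1 B P_H (\<lambda>x. \<phi> (?c x)) 0"
    unfolding grad_def by (rule fam.ham_flow_compose[OF c P_H_diff_fun smooth_\<phi>, symmetric])
  also have "\<dots> = F (jet 1 (\<lambda>x. \<phi> (?c x)) 0)"
    using system smooth_on_fibre_line[OF p smooth_\<phi>, of \<theta>] unfolding hamiltonian_system_def by auto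
  also have "jet 1 (\<lambda>x. \<phi> (?c x)) 0 = vjet fam.X \<phi> (?c 0)"
    by (rule fam.jet_compose[OF c smooth_\<phi>])
  also have "F (vjet fam.X \<phi> (?c 0)) = F (jet (k p) (\<lambda>\<theta>. \<Phi> \<theta> p) \<theta>)"
    using fam.jet_fibre[OF smooth_\<phi> p] by (simp add: \<phi>_def)
  also have "\<dots> = frechet_derivative \<phi> (at (\<theta>, p)) (frequencies \<iota> p, 0)"
    using m_phase p by (auto simp: m_phase_family_def dird_family[symmetric])
  finally show ?thesis
    by simp
qed

lemma frequency_matrix:
  obtains \<Omega> :: "real ^ 'N \<Rightarrow> real ^ 'N ^ 'm" where
    "\<And>p. p \<in> W \<Longrightarrow> rank (\<Omega> p) = CARD('m)"
    "\<And>p \<nu> \<theta>. p \<in> W \<Longrightarrow>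
      vham fam.X B \<phi> (grad (P \<nu>)) (\<theta>, p) = frechet_derivative \<phi> (at (\<theta>, p)) (column \<nu> (\<Omega> p), 0)"
proof -
  note parts = integrals[unfolded complete_hamiltonian_set_def, THEN conjunct2, THEN conjunct2, THEN conjunct2, THEN conjunct2]
  obtain \<Omega> :: "real ^ 'N \<Rightarrow> real ^ 'N ^ 'm" where \<Omega>: "\<forall>p\<in>W. rank (\<Omega> p) = CARD('m) \<and>
      (\<forall>\<nu> \<theta>. ham_flow (k p) B (P \<nu>) (\<lambda>\<theta>. \<Phi> \<theta> p) \<theta> = dird (column \<nu> (\<Omega> p)) (\<lambda>\<theta>. \<Phi> \<theta> p) \<theta>)"
    using conjunct1[OF parts] by (elim exE conjE)
  show thesis
  proof (rule that[of \<Omega>])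
    show "rank (\<Omega> p) = CARD('m)" if "p \<in> W" for p
      using \<Omega> that by simp
    show "vham fam.X B \<phi> (grad (P \<nu>)) (\<theta>, p) = frechet_derivative \<phi> (at (\<theta>, p)) (column \<nu> (\<Omega> p), 0)"
      if "p \<in> W" for p \<nu> \<theta>
      using \<Omega> that fam.ham_flow_fibre[OF P_diff_fun smooth_\<phi> that refl, of B \<nu> \<theta>]
      by (simp add: dird_family grad_def \<phi>_def)
  qed
qed

lemma annihilator_coefficients:
  obtains \<gamma> :: "nat \<Rightarrow> real ^ 'N \<Rightarrow> real ^ 'N" where
    "\<And>l p x. l < s \<Longrightarrow> p \<in> W \<Longrightarrow>
      dN l (k p) (\<lambda>\<theta>. \<Phi> \<theta> p) (x *\<^sub>R k p) = (\<Sum>\<nu>\<in>UNIV. \<gamma> l p $ \<nu> *\<^sub>R grad (P \<nu>) (x *\<^sub>R k p, p))"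
proof -
  note parts = integrals[unfolded complete_hamiltonian_set_def, THEN conjunct2, THEN conjunct2, THEN conjunct2, THEN conjunct2]
  obtain \<gamma> :: "nat \<Rightarrow> 'N \<Rightarrow> real ^ 'N \<Rightarrow> real" where \<gamma>: "\<forall>l<s. \<forall>p\<in>W. \<forall>\<theta>\<^sub>0 x.
      let k = wave_numbers \<iota> p; \<Psi> = (\<lambda>\<theta>. \<Phi> (\<theta> + \<theta>\<^sub>0) p) in
         dN l k \<Psi> (x *\<^sub>R k) = (\<Sum>\<nu>\<in>UNIV. \<gamma> l \<nu> p *\<^sub>R var_deriv k (P \<nu>) \<Psi> (x *\<^sub>R k))"
    using conjunct2[OF parts] by (elim exE conjE)
  show thesis
  proof (rule that[of "\<lambda>l p. \<chi> \<nu>. \<gamma> l \<nu> p"])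
    fix l p and x :: real
    assume lp: "l < s" "p \<in> W"
    show "dN l (k p) (\<lambda>\<theta>. \<Phi> \<theta> p) (x *\<^sub>R k p) = (\<Sum>\<nu>\<in>UNIV. (\<chi> \<nu>. \<gamma> l \<nu> p) $ \<nu> *\<^sub>R grad (P \<nu>) (x *\<^sub>R k p, p))"
      using \<gamma>[rule_format, OF lp, of 0 x] by (simp add: Let_def var_deriv_family[OF P_diff_fun lp(2)])
  qed
qed

text \<open>Restricted to the line, \<open>D\<close> is an element of \<open>qp_kernel\<close> and
  so a combination of the annihilators, which are combinations of the gradients of the integrals.
  The resulting identity on the line extends to the torus by density.\<close>

lemma kernel_spanned:
  assumes p: "p \<in> W" "rationally_independent (k p)"
    and D: "smooth_on fam.S D" "fam.fibre_periodic D" "\<And>\<theta>. vham fam.X B \<phi> D (\<theta>, p) = 0"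
    and \<gamma>: "\<And>l x. l < s \<Longrightarrow>
      dN l (k p) (\<lambda>\<theta>. \<Phi> \<theta> p) (x *\<^sub>R k p) = (\<Sum>\<nu>\<in>UNIV. \<gamma> l $ \<nu> *\<^sub>R grad (P \<nu>) (x *\<^sub>R k p, p))"
  obtains d where "\<And>\<theta>. D (\<theta>, p) = (\<Sum>\<nu>\<in>UNIV. (\<Sum>l<s. d l *\<^sub>R \<gamma> l) $ \<nu> *\<^sub>R grad (P \<nu>) (\<theta>, p))"
proof -
  let ?v = "\<lambda>x. D (x *\<^sub>R k p, p)"
  have D_fibre: "smooth_on UNIV (\<lambda>\<theta>. D (\<theta>, p))" "periodic (\<lambda>\<theta>. D (\<theta>, p))"
    using p D(2) by (auto simp: fam.fibre_periodic_def
        intro!: smooth_on_compose[OF open_UNIV fam.open_S _ D(1)] smooth_on_Pair smooth_on_const smooth_on_ident)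
  have c: "((\<lambda>x. (x *\<^sub>R k p, p)) has_derivative (\<lambda>h. h *\<^sub>R (k p, 0))) (at x)"
    "1 *\<^sub>R (k p, 0) = fam.X (x *\<^sub>R k p, p)" "(x *\<^sub>R k p, p) \<in> fam.S" for x :: real
    using fibre_line[OF p(1), of 0] by simp_all
  have "ham_op 1 B (\<lambda>y. \<Phi> (y *\<^sub>R k p) p) ?v x = 0" for x
    using fam.ham_op_compose[OF c smooth_\<phi> D(1), of B x] D(3) by (simp add: \<phi>_def)
  then have "?v \<in> qp_kernel B (k p) (\<lambda>\<theta>. \<Phi> \<theta> p)"
    unfolding qp_kernel_def using D_fibre by auto
  moreover have "fun_basis {..<s} (\<lambda>l x. dN l (k p) (\<lambda>\<theta>. \<Phi> \<theta> p) (x *\<^sub>R k p)) (qp_kernel B (k p) (\<lambda>\<theta>. \<Phi> \<theta> p))"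
    using conjunct2[OF conjunct2[OF family[unfolded regular_hamiltonian_family_def]], rule_format, OF p(1), of 0]
    by (simp add: Let_def)
  ultimately have "\<exists>d. \<forall>x. ?v x = (\<Sum>l<s. d l *\<^sub>R dN l (k p) (\<lambda>\<theta>. \<Phi> \<theta> p) (x *\<^sub>R k p))"
    by (intro fun_basisD)
  then obtain d where "\<forall>x. ?v x = (\<Sum>l<s. d l *\<^sub>R dN l (k p) (\<lambda>\<theta>. \<Phi> \<theta> p) (x *\<^sub>R k p))"
    by (elim exE)
  note d = this[rule_format]
  let ?g = "\<lambda>\<theta>. \<Sum>\<nu>\<in>UNIV. (\<Sum>l<s. d l *\<^sub>R \<gamma> l) $ \<nu> *\<^sub>R grad (P \<nu>) (\<theta>, p)"
  have "(\<lambda>\<theta>. D (\<theta>, p)) = ?g"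
  proof (rule continuous_periodic_eq_on_dense_line[OF p(2) smooth_on_imp_continuous_on[OF D_fibre(1)] D_fibre(2)])
    show "continuous_on UNIV ?g"
      by (intro continuous_on_sum continuous_on_scaleR continuous_on_const fam.continuous_on_fibre smooth_grad P_diff_fun p)
    show "periodic ?g"
      using periodic_grad[OF P_diff_fun] p unfolding fam.fibre_periodic_def periodic_def by simp
    show "?v x = ?g (x *\<^sub>R k p)" for x
      unfolding d using \<gamma>
      by (simp add: scaleR_sum_right scaleR_sum_left sum.swap[of _ UNIV] sum_component)
  qed
  then show thesis
    using that by (simp add: fun_eq_iff)
qed

text \<open>The parameters act on the mean of \<open>f\<close> in two ways. The change of \<Phi> at
  fixed wave numbers pairs with the variational derivative; the change of the wave numbers at fixed
  \<Phi> gives the term with \<open>vmom\<close>.\<close>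

lemma frechet_average:
  assumes f: "diff_fun f" "jet_order K f" and p: "p \<in> W"
  shows "frechet_derivative (average \<iota> \<Phi> f) (at p) q
    = fibre_mean (\<lambda>e. frechet_derivative \<phi> (at e) (0, q) \<bullet> grad f e) p
      + fibre_mean (vmom K fam.X f \<phi> (\<lambda>e. frechet_derivative \<phi> (at e) (k q, 0))) p"
proof -
  let ?q = "\<lambda>e. frechet_derivative \<phi> (at e) (0, q)" and ?z = "\<lambda>e. frechet_derivative \<phi> (at e) (k q, 0)"
  have q: "smooth_on fam.S ?q" "fam.fibre_periodic ?q" and z: "smooth_on fam.S ?z"
    by (intro smooth_on_frechet_derivative fam.fibre_periodic_frechet smooth_\<phi> periodic_\<phi> refl)+
  have X: "frechet_derivative fam.X (at e) (0, q) = (k q, 0)" if "e \<in> fam.S" for e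
    using frechet_derivative_eq[OF bounded_linear_imp_has_derivative[OF bounded_linear_wave_numbers[of \<iota>]]]
    by (simp add: fam.frechet_X[OF that] frechet_derivative_const)
  \<comment> \<open>Each of the \<open>l\<close> derivatives along the wave vector is varied once,
    with \<open>k q\<close> in place of the wave vector, and fibre directions commute with the rest.
    At l = 0 the truncated l - 1 is harmless because of the factor \<open>real l\<close>.\<close>
  have comm: "frechet_derivative ((vd fam.X ^^ l) \<phi>) (at e) (0, q) = (vd fam.X ^^ l) ?q e + real l *\<^sub>R (vd fam.X ^^ (l - 1)) ?z e"
    if "e \<in> fam.S" for l e
    using that
  proof (induction l arbitrary: e)
    case (Suc l)
    have "frechet_derivative ((vd fam.X ^^ Suc l) \<phi>) (at e) (0, q)
        = vd fam.X (\<lambda>e. frechet_derivative ((vd fam.X ^^ l) \<phi>) (at e) (0, q)) e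
          + frechet_derivative ((vd fam.X ^^ l) \<phi>) (at e) (k q, 0)"
      using fam.vd_commute[OF fam.smooth_vd_pow[OF smooth_\<phi>] Suc.prems, of l "(0, q)"] by (simp add: X[OF Suc.prems])
    also have "vd fam.X (\<lambda>e. frechet_derivative ((vd fam.X ^^ l) \<phi>) (at e) (0, q)) e
        = vd fam.X (\<lambda>e. (vd fam.X ^^ l) ?q e + real l *\<^sub>R (vd fam.X ^^ (l - 1)) ?z e) e"
      by (rule fam.vd_cong[OF Suc.IH Suc.prems])
    also have "\<dots> = (vd fam.X ^^ Suc l) ?q e + vd fam.X (\<lambda>e. real l *\<^sub>R (vd fam.X ^^ (l - 1)) ?z e) e"
      using fam.vd_add[OF fam.smooth_vd_pow[OF q(1)] smooth_on_scaleR[OF fam.open_S smooth_on_const fam.smooth_vd_pow[OF z]] Suc.prems]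
      by simp
    also have "vd fam.X (\<lambda>e. real l *\<^sub>R (vd fam.X ^^ (l - 1)) ?z e) e = real l *\<^sub>R (vd fam.X ^^ l) ?z e"
      using fam.vd_bounded_linear[OF bounded_linear_scaleR_right fam.smooth_vd_pow[OF z] Suc.prems] by (cases l) (auto simp: vd_const)
    also have "frechet_derivative ((vd fam.X ^^ l) \<phi>) (at e) (k q, 0) = (vd fam.X ^^ l) ?z e"
      by (rule fam.vd_pow_fibre_commute[OF smooth_\<phi> Suc.prems])
    finally show ?case
      by (simp add: algebra_simps)
  qed simp
  have split: "frechet_derivative (\<lambda>e. f (vjet fam.X \<phi> e)) (at e) (0, q)
      = vlin fam.X f \<phi> ?q e + vmom K fam.X f \<phi> ?z e" if "e \<in> fam.S" for e
  proof -
    have "frechet_derivative (\<lambda>e. f (vjet fam.X \<phi> e)) (at e) (0, q)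
      = (\<Sum>l\<le>K. \<Sum>i\<in>UNIV. (frechet_derivative ((vd fam.X ^^ l) \<phi>) (at e) (0, q) $ i) *\<^sub>R pd l i f (vjet fam.X \<phi> e))"
      unfolding fam.frechet_diff_fun_vjet[OF f(1) smooth_\<phi> that] by (rule suminf_atMost) (simp add: pd_above_order[OF f(2)])
    then show ?thesis
      by (simp add: comm[OF that] vlin_eq_sum[OF f(2)] vmom_def inner_vec_def sum.distrib algebra_simps sum_distrib_left)
  qed
  have "frechet_derivative (average \<iota> \<Phi> f) (at p) q = frechet_derivative (fibre_mean (\<lambda>e. f (vjet fam.X \<phi> e))) (at p) q"
    using frechet_derivative_transform_open[OF open_W p, of "average \<iota> \<Phi> f"] average_eq by simp
  also have "\<dots> = fibre_mean (\<lambda>e. frechet_derivative (\<lambda>e. f (vjet fam.X \<phi> e)) (at e) (0, q)) p"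
    by (rule fam.frechet_fibre_mean[OF fam.smooth_diff_fun_vjet[OF f(1) smooth_\<phi>] p])
  also have "\<dots> = fibre_mean (\<lambda>e. vlin fam.X f \<phi> ?q e + vmom K fam.X f \<phi> ?z e) p"
    by (rule fam.fibre_mean_cong) (rule split, use p in simp)
  also have "\<dots> = fibre_mean (vlin fam.X f \<phi> ?q) p + fibre_mean (vmom K fam.X f \<phi> ?z) p"
    by (intro fam.fibre_mean_add fam.smooth_vlin fam.smooth_vmom f smooth_\<phi> q z p)
  also have "fibre_mean (vlin fam.X f \<phi> ?q) p = fibre_mean (\<lambda>e. ?q e \<bullet> grad f e) p"
    unfolding grad_def by (rule fam.fibre_mean_inner_vadj[OF f(1) smooth_\<phi> periodic_\<phi> q p refl, symmetric])
  finally show ?thesis .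
qed

lemma fibre_mean_inner_grad_sum:
  fixes a :: "(real ^ 'm) \<times> (real ^ 'N) \<Rightarrow> real ^ 'n"
  assumes "smooth_on fam.S a" "p \<in> W"
  shows "(\<Sum>\<nu>\<in>UNIV. c $ \<nu> * fibre_mean (\<lambda>e. a e \<bullet> grad (P \<nu>) e) p)
    = fibre_mean (\<lambda>e. a e \<bullet> (\<Sum>\<nu>\<in>UNIV. c $ \<nu> *\<^sub>R grad (P \<nu>) e)) p"
proof -
  have "fibre_mean (\<lambda>e. a e \<bullet> (\<Sum>\<nu>\<in>UNIV. c $ \<nu> *\<^sub>R grad (P \<nu>) e)) p
      = fibre_mean (\<lambda>e. \<Sum>\<nu>\<in>UNIV. c $ \<nu> * (a e \<bullet> grad (P \<nu>) e)) p"
    by (simp add: inner_sum_right)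
  also have "\<dots> = (\<Sum>\<nu>\<in>UNIV. fibre_mean (\<lambda>e. c $ \<nu> * (a e \<bullet> grad (P \<nu>) e)) p)"
    by (intro fam.fibre_mean_sum smooth_on_mult smooth_on_const smooth_on_inner smooth_grad P_diff_fun assms fam.open_S)
  finally show ?thesis
    by (simp add: fam.fibre_mean_cmult)
qed

lemma card_labels: "CARD('N) = 2 * CARD('m) + s" and inj_wave_label: "inj (\<lambda>\<alpha> :: 'm. \<iota> (Inl \<alpha>))"
proof -
  have bij: "bij_betw \<iota> (UNIV <+> UNIV <+> {..<s}) UNIV"
    using labels by (simp add: parameter_labels_def)
  then show "CARD('N) = 2 * CARD('m) + s"
    using bij_betw_same_card[OF bij] by (simp add: card_Plus)
  show "inj (\<lambda>\<alpha> :: 'm. \<iota> (Inl \<alpha>))"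
    using bij_betw_imp_inj_on[OF bij] by (auto simp: inj_on_def)
qed

lemma frechet_integral_values:
  assumes "p \<in> W"
  shows "frechet_derivative (integral_values \<iota> \<Phi> P) (at p) q
    = (\<chi> \<nu>. frechet_derivative (average \<iota> \<Phi> (P \<nu>)) (at p) q)"
proof (rule frechet_derivative_eq)
  show "(integral_values \<iota> \<Phi> P has_derivative (\<lambda>q. \<chi> \<nu>. frechet_derivative (average \<iota> \<Phi> (P \<nu>)) (at p) q)) (at p)"
    unfolding integral_values_def[abs_def] vec_lambda_sum_axis
    by (intro has_derivative_sum bounded_linear.has_derivative[OF bounded_linear_scaleR_left]
        smooth_on_has_derivative[OF smooth_average[OF P_diff_fun] assms])
qed

lemma jacobian_entry:
  assumes "p \<in> W"
  shows "matrix (frechet_derivative (integral_values \<iota> \<Phi> P) (at p)) $ \<nu> $ j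
    = frechet_derivative (average \<iota> \<Phi> (P \<nu>)) (at p) (axis j 1)"
  by (simp add: matrix_def frechet_integral_values[OF assms])

text \<open>Two coefficient vectors are compared. The vector \<mu> comes from the kernel and
  represents the gradient, but only modulo relations among the gradients of the integrals;
  \<open>h\<close> is known only through averages. Both give the same derivatives of averages in all
  directions other than the wave numbers, and by the dimension count this forces their difference to
  be a relation.\<close>

lemma gradient_relation_generic:
  assumes p: "p \<in> W" "rationally_independent (k p)"
    and h: "\<And>q. frechet_derivative (average \<iota> \<Phi> P_H) (at p) q
      = (\<Sum>\<mu>\<in>UNIV. h $ \<mu> * frechet_derivative (average \<iota> \<Phi> (P \<mu>)) (at p) q)"
  shows "grad P_H (\<theta>, p) = (\<Sum>\<mu>\<in>UNIV. h $ \<mu> *\<^sub>R grad (P \<mu>) (\<theta>, p))"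
proof -
  obtain KB where "\<forall>j>KB. \<forall>u. B j u = 0"
    using B_order by (elim exE)
  note KB = this[rule_format]
  obtain \<Omega> :: "real ^ 'N \<Rightarrow> real ^ 'N ^ 'm" where \<Omega>: "\<And>p. p \<in> W \<Longrightarrow> rank (\<Omega> p) = CARD('m)"
    "\<And>p \<nu> \<theta>. p \<in> W \<Longrightarrow>
      vham fam.X B \<phi> (grad (P \<nu>)) (\<theta>, p) = frechet_derivative \<phi> (at (\<theta>, p)) (column \<nu> (\<Omega> p), 0)"
    using frequency_matrix by blast
  obtain \<gamma> :: "nat \<Rightarrow> real ^ 'N \<Rightarrow> real ^ 'N" where \<gamma>: "\<And>l p x. l < s \<Longrightarrow> p \<in> W \<Longrightarrow>
      dN l (k p) (\<lambda>\<theta>. \<Phi> \<theta> p) (x *\<^sub>R k p) = (\<Sum>\<nu>\<in>UNIV. \<gamma> l p $ \<nu> *\<^sub>R grad (P \<nu>) (x *\<^sub>R k p, p))"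
    using annihilator_coefficients by blast
  define G where "G = (\<lambda>c e. \<Sum>\<nu>\<in>UNIV. c $ \<nu> *\<^sub>R grad (P \<nu>) e)"
  have G: "smooth_on fam.S (G c)" "fam.fibre_periodic (G c)" for c
    unfolding G_def
    by (intro smooth_on_sum smooth_on_scaleR smooth_on_const smooth_grad P_diff_fun fam.open_S)
      (intro fam.fibre_periodic_sum fam.fibre_periodic_compose[where h = "\<lambda>x. _ *\<^sub>R x"] periodic_grad P_diff_fun)
  have G_diff: "G (c - d) e = G c e - G d e" for c d e
    by (simp add: G_def algebra_simps sum_subtractf)
  have vham_G: "vham fam.X B \<phi> (G c) (\<theta>, p) = frechet_derivative \<phi> (at (\<theta>, p)) (\<Omega> p *v c, 0)" for c \<theta>
  proof -
    have lin: "linear (frechet_derivative \<phi> (at (\<theta>, p)))"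
      using smooth_on_frechet_linear[OF smooth_\<phi>] p by simp
    have "(\<Omega> p *v c, 0) = (\<Sum>\<nu>\<in>UNIV. c $ \<nu> *\<^sub>R (column \<nu> (\<Omega> p), 0 :: real ^ 'N))"
      by (simp add: prod_eq_iff fst_sum snd_sum matrix_mult_sum scalar_mult_eq_scaleR)
    then have "frechet_derivative \<phi> (at (\<theta>, p)) (\<Omega> p *v c, 0)
        = (\<Sum>\<nu>\<in>UNIV. c $ \<nu> *\<^sub>R frechet_derivative \<phi> (at (\<theta>, p)) (column \<nu> (\<Omega> p), 0))"
      by (simp only: linear_sum[OF lin] linear_scale[OF lin])
    then show ?thesis
      unfolding G_def
      by (subst fam.vham_sum[OF KB]) (use p smooth_grad[OF P_diff_fun] in \<open>auto simp: \<Omega>(2)\<close>)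
  qed
  have "surj ((*v) (\<Omega> p))"
    using \<Omega>(1)[OF p(1)] full_rank_surjective by blast
  \<comment> \<open>Full rank allows the phase shift generated by the Hamiltonian to be reproduced
    by the integrals; what then remains of the gradient lies in the kernel of the bracket.\<close>
  then obtain c0 where c0: "\<Omega> p *v c0 = frequencies \<iota> p"
    by (metis surjD)
  have "vham fam.X B \<phi> (\<lambda>e. grad P_H e - G c0 e) (\<theta>, p) = 0" for \<theta>
    using fam.vham_diff[OF KB smooth_grad[OF P_H_diff_fun] G(1)] p by (simp add: vham_G vham_grad_P_H c0)
  from kernel_spanned[OF p smooth_on_diff[OF fam.open_S smooth_grad[OF P_H_diff_fun] G(1)] _ this \<gamma>[OF _ p(1)]]
  obtain d where d: "\<And>\<theta>. grad P_H (\<theta>, p) - G c0 (\<theta>, p) = G (\<Sum>l<s. d l *\<^sub>R \<gamma> l p) (\<theta>, p)"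
    using fam.fibre_periodic_compose2[OF periodic_grad[OF P_H_diff_fun] G(2), where h = "(-)"] unfolding G_def by blast
  define \<mu> where "\<mu> = c0 + (\<Sum>l<s. d l *\<^sub>R \<gamma> l p)"
  have \<mu>: "grad P_H (\<theta>, p) = G \<mu> (\<theta>, p)" for \<theta>
    using d[of \<theta>] G_diff[of \<mu> c0 "(\<theta>, p)"] by (simp add: \<mu>_def)
  \<comment> \<open>\<open>?Y\<close> is the space of relations among the gradients, and
    \<open>?I\<close> below the m parameter labels of the wave numbers.\<close>
  let ?Y = "{c. \<forall>\<theta>. G c (\<theta>, p) = 0}" and ?J = "matrix (frechet_derivative (integral_values \<iota> \<Phi> P) (at p))"
  let ?I = "range (\<lambda>\<alpha> :: 'm. \<iota> (Inl \<alpha>))"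
  have vmJ: "(c v* ?J) $ j = (\<Sum>\<nu>\<in>UNIV. c $ \<nu> * frechet_derivative (average \<iota> \<Phi> (P \<nu>)) (at p) (axis j 1))" for c j
    by (simp add: vector_matrix_mult_def jacobian_entry[OF p(1)] mult.commute)
  \<comment> \<open>Such a parameter leaves the wave numbers unchanged, so the \<open>vmom\<close>
    term of \<open>frechet_average\<close> is absent and the derivative of the average depends on
    the gradient alone.\<close>
  have avg_j: "frechet_derivative (average \<iota> \<Phi> f) (at p) (axis j 1)
      = fibre_mean (\<lambda>e. frechet_derivative \<phi> (at e) (0, axis j 1) \<bullet> grad f e) p" if "diff_fun f" "j \<notin> ?I" for f j
  proof -
    obtain K where K: "jet_order K f"
      using diff_fun_order[OF \<open>diff_fun f\<close>] by blast
    have "k (axis j 1) = 0"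
      using \<open>j \<notin> ?I\<close> by (auto simp: wave_numbers_def vec_eq_iff axis_def)
    then have "vmom K fam.X f \<phi> (\<lambda>e. frechet_derivative \<phi> (at e) (k (axis j 1), 0)) (\<theta>, p) = 0" for \<theta>
    proof -
      assume kj: "k (axis j 1) = 0"
      have z: "frechet_derivative \<phi> (at e) (k (axis j 1), 0) = 0" if "e \<in> fam.S" for e
        using linear_0[OF smooth_on_frechet_linear[OF smooth_\<phi> that]] by (simp add: kj zero_prod_def)
      have "(vd fam.X ^^ l) (\<lambda>e. frechet_derivative \<phi> (at e) (k (axis j 1), 0)) (\<theta>, p) = (vd fam.X ^^ l) (\<lambda>_. 0) (\<theta>, p)" for l
        by (rule fam.vd_pow_cong[OF z]) (use p in auto)
      then show ?thesis
        by (simp add: vmom_def vd_pow_zero)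
    qed
    then have "fibre_mean (vmom K fam.X f \<phi> (\<lambda>e. frechet_derivative \<phi> (at e) (k (axis j 1), 0))) p = 0"
      by (simp add: fibre_mean_def)
    then show ?thesis
      using frechet_average[OF \<open>diff_fun f\<close> K p(1), of "axis j 1"] by simp
  qed
  have pair: "(c v* ?J) $ j = fibre_mean (\<lambda>e. frechet_derivative \<phi> (at e) (0, axis j 1) \<bullet> G c e) p" if "j \<notin> ?I" for c j
    unfolding vmJ G_def using that p(1)
    by (simp add: avg_j[OF P_diff_fun] fibre_mean_inner_grad_sum[OF smooth_on_frechet_derivative[OF smooth_\<phi>]])
  have "h - \<mu> \<in> ?Y"
  proof (rule relations_dimension_count[where \<Omega> = "\<Omega> p" and J = ?J and I = ?I and \<gamma> = "\<lambda>l. \<gamma> l p"])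
    show "CARD('N) = 2 * CARD('m) + s"
      by (rule card_labels)
    show "rank (\<Omega> p) = CARD('m)"
      by (rule \<Omega>(1)[OF p(1)])
    show "subspace ?Y"
      by (auto simp: subspace_def G_def algebra_simps sum.distrib simp flip: scaleR_sum_right scaleR_scaleR)
    show "\<exists>d. c - (\<Sum>l<s. d l *\<^sub>R \<gamma> l p) \<in> ?Y" if "\<Omega> p *v c = 0" for c
    proof -
      have "vham fam.X B \<phi> (G c) (\<theta>, p) = 0" for \<theta>
        using linear_0[OF smooth_on_frechet_linear[OF smooth_\<phi>, of "(\<theta>, p)"]] p by (simp add: vham_G that zero_prod_def)
      from kernel_spanned[OF p G this \<gamma>[OF _ p(1)]]
      obtain d where "\<And>\<theta>. G c (\<theta>, p) = G (\<Sum>l<s. d l *\<^sub>R \<gamma> l p) (\<theta>, p)"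
        unfolding G_def by blast
      then show ?thesis
        by (auto simp: G_diff)
    qed
    show "det ?J \<noteq> 0"
      using integrals p(1) by (simp add: complete_hamiltonian_set_def)
    show "card ?I = CARD('m)"
      by (rule card_image[OF inj_wave_label])
    show "(c v* ?J) $ j = 0" if "c \<in> ?Y" "j \<notin> ?I" for c j
      using that by (simp add: pair fibre_mean_def)
    show "((h - \<mu>) v* ?J) $ j = 0" if "j \<notin> ?I" for j
    proof -
      have "(h v* ?J) $ j = fibre_mean (\<lambda>e. frechet_derivative \<phi> (at e) (0, axis j 1) \<bullet> G \<mu> e) p"
        unfolding vmJ h[symmetric] avg_j[OF P_H_diff_fun that] by (rule fam.fibre_mean_cong) (simp add: \<mu>)
      then show ?thesis
        by (simp add: vector_matrix_left_distrib pair[OF that]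
            bounded_bilinear.diff_left[OF bounded_bilinear_vector_matrix])
    qed
  qed
  then have "G h (\<theta>, p) = G \<mu> (\<theta>, p)"
    using G_diff[of h \<mu> "(\<theta>, p)"] by simp
  then show ?thesis
    by (simp add: \<mu> G_def)
qed

text \<open>A failure at one parameter would persist on an open set. The wave numbers are
  coordinates of the parameter, so that set contains a parameter with rationally independent ones,
  contradicting the generic case.\<close>

lemma gradient_relation:
  assumes h: "\<And>p q. p \<in> V \<Longrightarrow> frechet_derivative (average \<iota> \<Phi> P_H) (at p) q
      = (\<Sum>\<mu>\<in>UNIV. h p $ \<mu> * frechet_derivative (average \<iota> \<Phi> (P \<mu>)) (at p) q)"
    and cont: "continuous_on V h" and p: "p \<in> V"
  shows "grad P_H (\<theta>, p) = (\<Sum>\<mu>\<in>UNIV. h p $ \<mu> *\<^sub>R grad (P \<mu>) (\<theta>, p))"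
proof (rule ccontr)
  let ?g = "\<lambda>p. grad P_H (\<theta>, p) - (\<Sum>\<mu>\<in>UNIV. h p $ \<mu> *\<^sub>R grad (P \<mu>) (\<theta>, p))"
  assume "grad P_H (\<theta>, p) \<noteq> (\<Sum>\<mu>\<in>UNIV. h p $ \<mu> *\<^sub>R grad (P \<mu>) (\<theta>, p))"
  then have ne: "?g p \<noteq> 0"
    by simp
  have grad_cont: "continuous_on V (\<lambda>p. grad f (\<theta>, p))" if "diff_fun f" for f
    by (rule continuous_on_compose2[OF smooth_on_imp_continuous_on[OF smooth_grad[OF that]]])
      (use V_W in \<open>auto intro!: continuous_intros\<close>)
  have "continuous_on V ?g"
    by (intro continuous_on_diff continuous_on_sum continuous_on_scaleR continuous_on_component grad_cont
        P_diff_fun P_H_diff_fun cont)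
  then have "open (V \<inter> ?g -` (- {0}))"
    by (intro continuous_open_preimage open_V) auto
  moreover have "V \<inter> ?g -` (- {0}) \<noteq> {}"
    using p ne by blast
  ultimately obtain p' where p': "p' \<in> V \<inter> ?g -` (- {0})" "rationally_independent (\<chi> \<alpha>. p' $ \<iota> (Inl \<alpha>))"
    using exists_rationally_independent[OF inj_wave_label] by blast
  then have "p' \<in> W" "p' \<in> V" "rationally_independent (k p')"
    using V_W by (auto simp: wave_numbers_def)
  from gradient_relation_generic[OF this(1,3) h[OF this(2)]] show False
    using p'(1) by simp
qed

text \<open>By \<open>frechet_average\<close> a derivative of an average is a gradient part plus a
  momentum part. The coefficients \<open>h\<close> match the full derivative by assumption and the
  gradient part by \<open>gradient_relation\<close>, hence also the difference.\<close>

lemma momentum_relation: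
  assumes h: "\<And>p q. p \<in> V \<Longrightarrow> frechet_derivative (average \<iota> \<Phi> P_H) (at p) q
      = (\<Sum>\<mu>\<in>UNIV. h p $ \<mu> * frechet_derivative (average \<iota> \<Phi> (P \<mu>)) (at p) q)"
    and cont: "continuous_on V h" and p: "p \<in> V" and K: "jet_order K P_H" "\<And>\<mu>. jet_order K (P \<mu>)"
  shows "fibre_mean (vmom K fam.X P_H \<phi> (\<lambda>e. frechet_derivative \<phi> (at e) (v, 0))) p
    = (\<Sum>\<mu>\<in>UNIV. h p $ \<mu> * fibre_mean (vmom K fam.X (P \<mu>) \<phi> (\<lambda>e. frechet_derivative \<phi> (at e) (v, 0))) p)"
proof -
  have pW: "p \<in> W"
    using p V_W by blast
  \<comment> \<open>A direction in the space of parameters along which the wave vector changes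
    exactly by \<open>v\<close>.\<close>
  let ?j = "\<Sum>\<alpha>\<in>UNIV. v $ \<alpha> *\<^sub>R axis (\<iota> (Inl \<alpha>)) 1 :: real ^ 'N"
  let ?M = "\<lambda>f. fibre_mean (vmom K fam.X f \<phi> (\<lambda>e. frechet_derivative \<phi> (at e) (v, 0))) p"
  let ?G = "\<lambda>f. fibre_mean (\<lambda>e. frechet_derivative \<phi> (at e) (0, ?j) \<bullet> grad f e) p"
  have ax: "axis (\<iota> (Inl \<alpha>)) (1 :: real) $ \<iota> (Inl \<beta>) = (if \<alpha> = \<beta> then 1 else 0)" for \<alpha> \<beta> :: 'm
    using injD[OF inj_wave_label, of \<alpha> \<beta>] by (auto simp: axis_def)
  have kj: "k ?j = v"
    by (simp add: wave_numbers_def vec_eq_iff sum_component ax if_distrib cong: if_cong)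
  have avg: "frechet_derivative (average \<iota> \<Phi> f) (at p) ?j = ?G f + ?M f" if "diff_fun f" "jet_order K f" for f
    using frechet_average[OF that pW, of ?j] by (simp add: kj)
  have "?G P_H = (\<Sum>\<mu>\<in>UNIV. h p $ \<mu> * ?G (P \<mu>))"
    unfolding fibre_mean_inner_grad_sum[OF smooth_on_frechet_derivative[OF smooth_\<phi>] pW]
    by (rule fam.fibre_mean_cong) (simp add: gradient_relation[OF h cont p])
  then show ?thesis
    using h[OF p, of ?j] by (simp add: avg P_diff_fun P_H_diff_fun K distrib_left sum.distrib)
qed

end

section \<open>Linearity of the linearization; antiderivatives\<close>

context vector_field
begin

lemma vlin_sum:
  fixes f :: "'n::finite jet \<Rightarrow> real"
  assumes f: "diff_fun f" and \<eta>: "\<And>i. i \<in> I \<Longrightarrow> smooth_on S (\<eta> i)" and e: "e \<in> S"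
  shows "vlin X f \<psi> (\<lambda>e. \<Sum>i\<in>I. \<eta> i e) e = (\<Sum>i\<in>I. vlin X f \<psi> (\<eta> i) e)"
proof -
  obtain K where K: "jet_order K f"
    using diff_fun_order[OF f] by blast
  show ?thesis
    by (simp add: vlin_eq_sum[OF K] vd_pow_sum[OF \<eta> e] sum_component sum_distrib_right sum.swap[of _ I])
qed

lemma vlin_diff:
  fixes f :: "'n::finite jet \<Rightarrow> real"
  assumes f: "diff_fun f" and "smooth_on S \<xi>" "smooth_on S \<eta>" and e: "e \<in> S"
  shows "vlin X f \<psi> (\<lambda>e. \<xi> e - \<eta> e) e = vlin X f \<psi> \<xi> e - vlin X f \<psi> \<eta> e"
proof -
  obtain K where K: "jet_order K f"
    using diff_fun_order[OF f] by blast
  show ?thesis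
    by (simp add: vlin_eq_sum[OF K] vd_pow_diff[OF assms(2,3) e] left_diff_distrib sum_subtractf)
qed

lemma vadj_const:
  assumes f: "diff_fun f" and \<psi>: "smooth_on S \<psi>" and e: "e \<in> S"
  shows "vadj X f \<psi> (\<lambda>_. c) e = c *\<^sub>R vadj X f \<psi> (\<lambda>_. 1) e"
proof -
  obtain K where K: "jet_order K f"
    using diff_fun_order[OF f] by blast
  have "(\<chi> i. pd l i f (vjet X \<psi> e) * c) = c *\<^sub>R (\<chi> i. pd l i f (vjet X \<psi> e) * 1)" for l e
    by (simp add: vec_eq_iff)
  then show ?thesis
    using vd_pow_scaleR[OF smooth_vadj_term[OF f \<psi> smooth_on_const[of S 1]] e, of _ c]
    by (simp add: vadj_eq_sum[OF K] scaleR_sum_right mult.commute)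
qed

end

lemma exists_antiderivative:
  fixes f :: "real \<Rightarrow> 'a::euclidean_space"
  assumes "continuous_on UNIV f"
  obtains g where "\<And>x. (g has_vector_derivative f x) (at x)" "g 0 = 0"
proof -
  have "isCont f x" for x
    using assms continuous_on_eq_continuous_at[OF open_UNIV] by blast
  then obtain g where "\<And>x. (g has_vector_derivative f x) (at x)"
    using einterval_antiderivative[of "- \<infinity>" \<infinity> f] by auto
  then show thesis
    by (intro that[of "\<lambda>x. g x - g 0"]) (auto intro!: derivative_eq_intros)
qed

lemma smooth_on_antiderivative:
  fixes f :: "real \<Rightarrow> 'a::real_normed_vector"
  assumes g: "\<And>x. (g has_vector_derivative f x) (at x)" and f: "smooth_on UNIV f"
  shows "smooth_on UNIV g"
proof (rule smooth_onI_derivative)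
  show "g differentiable (at x)" for x
    using g unfolding has_vector_derivative_def differentiable_def by blast
  have "frechet_derivative g (at x) v = v *\<^sub>R f x" for x v
    using frechet_derivative_eq[OF g[unfolded has_vector_derivative_def]] .
  then show "smooth_on UNIV (\<lambda>x. frechet_derivative g (at x) v)" for v
    by (simp add: smooth_on_bounded_linear[OF open_UNIV bounded_linear_scaleR_right f])
qed

lemma frechet_zero_tangent:
  assumes u: "smooth_on UNIV u" and zero: "\<And>t :: real. u (e + t *\<^sub>R v) = 0"
  shows "frechet_derivative u (at e) v = 0"
proof -
  have "frechet_derivative (\<lambda>t. u (e + t *\<^sub>R v)) (at 0) 1 = frechet_derivative u (at (e + 0 *\<^sub>R v)) (1 *\<^sub>R v)"
    by (rule frechet_derivative_chain) (auto intro!: derivative_eq_intros smooth_on_imp_differentiable[OF u])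
  then show ?thesis
    by (simp add: zero frechet_derivative_const)
qed

section \<open>Modulated fields\<close>

text \<open>
  The parameters of the family vary slowly along the curve \<open>p\<close>: at the point \<open>(\<theta>, \<epsilon>, X)\<close> of the bundle,
  moving along the line by \<open>x\<close> changes \<open>\<theta>\<close> at the rate \<open>k (p X)\<close> and \<open>X\<close> at the rate \<open>\<epsilon>\<close>. The Whitham
  equations are the mean over the fibre of the \<open>\<epsilon>\<close>-derivative at \<open>\<epsilon> = 0\<close> of the exact equations.
\<close>

locale modulation = averaging B F P_H \<iota> s W V \<Phi> N dN P
  for B :: "'n::finite coeffs"
    and F :: "'n jet \<Rightarrow> real ^ 'n"
    and P_H :: "'n jet \<Rightarrow> real"
    and \<iota> :: "('m::finite, 'N::finite) labels"
    and s :: nat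
    and W V :: "(real ^ 'N) set"
    and \<Phi> :: "('m, 'N, 'n) family"
    and N :: "nat \<Rightarrow> ('m, 'n) qp_functional"
    and dN :: "nat \<Rightarrow> ('m, 'n) qp_covector"
    and P :: "'N \<Rightarrow> 'n jet \<Rightarrow> real" +
  fixes p :: "real \<Rightarrow> real ^ 'N"
  assumes smooth_p: "smooth_on UNIV p" and p_W: "p X \<in> W"
begin

lemma smooth_compose_slow: "smooth_on W g \<Longrightarrow> smooth_on UNIV (\<lambda>z :: real \<times> real. g (p (snd z)))"
  by (rule smooth_on_compose[OF open_UNIV open_W _ _ smooth_on_compose[OF open_UNIV open_UNIV _ smooth_p]])
    (auto simp: p_W intro: smooth_on_linear_map bounded_linear_snd)

sublocale mod: torus_bundle UNIV "\<lambda>z :: real \<times> real. k (p (snd z))" "\<lambda>z. (0, fst z)"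
  by standard (simp, rule smooth_compose_slow[OF smooth_on_linear_map[OF bounded_linear_wave_numbers]],
      intro smooth_on_linear_map bounded_linear_Pair bounded_linear_zero bounded_linear_fst)

definition \<psi> :: "(real ^ 'm) \<times> real \<times> real \<Rightarrow> real ^ 'n" where "\<psi> e = \<phi> (fst e, p (snd (snd e)))"

lemma smooth_slow: "smooth_on UNIV (\<lambda>e :: (real ^ 'm) \<times> real \<times> real. p (snd (snd e)))"
  by (rule smooth_on_compose[OF open_UNIV open_UNIV _ smooth_p])
    (auto intro!: smooth_on_snd smooth_on_ident)

lemma smooth_\<psi>: "smooth_on UNIV \<psi>"
  unfolding \<psi>_def[abs_def]
  by (rule smooth_on_compose[OF open_UNIV fam.open_S _ smooth_\<phi>])
    (auto simp: p_W intro!: smooth_on_Pair smooth_on_fst smooth_on_ident smooth_slow)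

lemma periodic_\<psi>: "mod.fibre_periodic \<psi>"
  using periodic_\<phi> p_W by (auto simp: mod.fibre_periodic_def fam.fibre_periodic_def \<psi>_def periodic_def)

abbreviation slow :: "(real \<Rightarrow> 'b) \<Rightarrow> (real ^ 'm) \<times> real \<times> real \<Rightarrow> 'b" where
  "slow g \<equiv> \<lambda>e. g (snd (snd e))"

lemma smooth_on_slow: "smooth_on UNIV g \<Longrightarrow> smooth_on UNIV (slow g)"
  by (rule smooth_on_compose[OF open_UNIV open_UNIV _, where f = g])
    (auto intro!: smooth_on_snd smooth_on_ident)

text \<open>At \<epsilon> = 0 the base point stands still, so both sides are the same iterated
  directional derivative on one torus.\<close>

lemma vd_pow_slice:
  assumes "smooth_on fam.S g" "smooth_on UNIV g'" "\<And>\<theta>. g' (\<theta>, 0, X) = g (\<theta>, p X)"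
  shows "(vd mod.X ^^ l) g' (\<theta>, 0, X) = (vd fam.X ^^ l) g (\<theta>, p X)"
  using fun_cong[OF fam.dird_pow_fibre[OF assms(1) p_W[of X] refl, of l], of \<theta>]
    fun_cong[OF mod.dird_pow_fibre[of g' "(0, X)" l], of \<theta>] assms
  by (simp add: zero_prod_def)

lemma slice:
  assumes "diff_fun f"
  shows "vjet mod.X \<psi> (\<theta>, 0, X) = vjet fam.X \<phi> (\<theta>, p X)"
    and "vadj mod.X f \<psi> (\<lambda>_. 1) (\<theta>, 0, X) = grad f (\<theta>, p X)"
    and "vham mod.X B \<psi> (vadj mod.X f \<psi> (\<lambda>_. 1)) (\<theta>, 0, X) = vham fam.X B \<phi> (grad f) (\<theta>, p X)"
proof -
  have \<psi>\<phi>: "\<psi> (\<theta>, 0, X) = \<phi> (\<theta>, p X)" for \<theta>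
    by (simp add: \<psi>_def)
  show jet: "vjet mod.X \<psi> (\<theta>, 0, X) = vjet fam.X \<phi> (\<theta>, p X)" for \<theta>
    unfolding vjet_def fun_eq_iff by (intro allI vd_pow_slice smooth_\<phi> smooth_\<psi> \<psi>\<phi>)
  have term1: "smooth_on UNIV (\<lambda>e. \<chi> i. pd l i f (vjet mod.X \<psi> e) * 1)" for l
    by (rule mod.smooth_vadj_term[OF assms, unfolded UNIV_Times_UNIV, OF smooth_\<psi> smooth_on_const])
  obtain K where K: "jet_order K f"
    using diff_fun_order[OF assms] by blast
  show vadj: "vadj mod.X f \<psi> (\<lambda>_. 1) (\<theta>, 0, X) = grad f (\<theta>, p X)" for \<theta>
    unfolding grad_def vadj_eq_sum[OF K]
    by (intro sum.cong refl arg_cong[where f = "scaleR _"] vd_pow_slice fam.smooth_vadj_term assms smooth_\<phi>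
        smooth_on_const term1) (simp add: jet)
  have "smooth_on UNIV (vadj mod.X f \<psi> (\<lambda>_. 1))"
    by (rule mod.smooth_vadj[OF assms, unfolded UNIV_Times_UNIV, OF smooth_\<psi> smooth_on_const])
  then show "vham mod.X B \<psi> (vadj mod.X f \<psi> (\<lambda>_. 1)) (\<theta>, 0, X) = vham fam.X B \<phi> (grad f) (\<theta>, p X)"
    unfolding vham_def by (simp add: jet vd_pow_slice[OF smooth_grad[OF assms] _ vadj])
qed

lemma slice_mean: "fibre_mean (\<lambda>e. f (vjet mod.X \<psi> e)) (0, X) = average \<iota> \<Phi> f (p X)" if "diff_fun f"
  unfolding average_eq[OF p_W] fibre_mean_def by (simp add: slice(1)[OF that])

lemma smooth_vjet: "diff_fun f \<Longrightarrow> smooth_on UNIV (\<lambda>e. f (vjet mod.X \<psi> e))"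
  using mod.smooth_diff_fun_vjet smooth_\<psi> by simp

lemma periodic_vjet: "mod.fibre_periodic (\<lambda>e. f (vjet mod.X \<psi> e))"
  by (rule mod.fibre_periodic_compose[OF mod.fibre_periodic_vjet]) (simp_all add: smooth_\<psi> periodic_\<psi>)

text \<open>The field is triangular: \<epsilon> is constant, X moves uniformly, and the phases are
  an antiderivative of the wave vector along this motion. Hence every point lies on an integral
  curve defined for all times.\<close>

lemma integral_curve:
  "\<exists>c. c 0 = e \<and> smooth_on UNIV c \<and> (\<forall>x. (c has_derivative (\<lambda>h. h *\<^sub>R mod.X (c x))) (at x))"
proof -
  obtain \<theta> \<epsilon> X where e: "e = (\<theta>, \<epsilon>, X)"
    by (cases e)
  have "smooth_on UNIV (\<lambda>x. p (X + x * \<epsilon>))"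
    by (rule smooth_on_compose[OF open_UNIV open_UNIV _ smooth_p])
      (auto intro!: smooth_on_add smooth_on_mult smooth_on_const smooth_on_ident)
  then have f: "smooth_on UNIV (\<lambda>x. k (p (X + x * \<epsilon>)))"
    by (rule smooth_on_bounded_linear[OF open_UNIV bounded_linear_wave_numbers])
  obtain g where g: "\<And>x. (g has_vector_derivative k (p (X + x * \<epsilon>))) (at x)" "g 0 = 0"
    using exists_antiderivative[OF smooth_on_imp_continuous_on[OF f]] by blast
  show ?thesis
  proof (intro exI[of _ "\<lambda>x. (\<theta> + g x, \<epsilon>, X + x * \<epsilon>)"] conjI allI)
    show "(\<theta> + g 0, \<epsilon>, X + 0 * \<epsilon>) = e"
      by (simp add: e g)
    show "smooth_on UNIV (\<lambda>x. (\<theta> + g x, \<epsilon>, X + x * \<epsilon>))"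
      by (intro smooth_on_Pair smooth_on_add smooth_on_mult smooth_on_const smooth_on_ident
          smooth_on_antiderivative[OF g(1) f] open_UNIV)
    show "((\<lambda>x. (\<theta> + g x, \<epsilon>, X + x * \<epsilon>)) has_derivative (\<lambda>h. h *\<^sub>R mod.X (\<theta> + g x, \<epsilon>, X + x * \<epsilon>))) (at x)" for x
      using g(1)[of x] by (auto simp: mod.X_def has_vector_derivative_def intro!: derivative_eq_intros)
  qed
qed

text \<open>The composition of \<psi> with an integral curve is a smooth field on the line, so the
  hypotheses about such fields apply to it exactly; evaluated at time 0 they hold at an arbitrary
  point of the bundle, for every \<epsilon>.\<close>

lemma conservation_law_modulated:
  assumes "conservation_law F R Q"
  shows "vlin mod.X R \<psi> (vham mod.X B \<psi> (vadj mod.X P_H \<psi> (\<lambda>_. 1))) e = vd mod.X (\<lambda>e. Q (vjet mod.X \<psi> e)) e"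
proof -
  obtain c where "c 0 = e \<and> smooth_on UNIV c \<and> (\<forall>x. (c has_derivative (\<lambda>h. h *\<^sub>R mod.X (c x))) (at x))"
    using integral_curve[of e] by (elim exE)
  note c = this[THEN conjunct1] this[THEN conjunct2, THEN conjunct1] this[THEN conjunct2, THEN conjunct2, rule_format]
  have c': "1 *\<^sub>R mod.X (c x) = mod.X (c x)" "c x \<in> mod.S" for x
    by simp_all
  have \<psi>c: "smooth_on UNIV (\<lambda>x. \<psi> (c x))"
    by (rule smooth_on_compose[OF open_UNIV open_UNIV _ smooth_\<psi> c(2)]) simp
  have s\<psi>: "smooth_on mod.S \<psi>"
    by (simp add: smooth_\<psi>)
  obtain KB where "\<forall>j>KB. \<forall>u. B j u = 0"
    using B_order by (elim exE)
  note KB = this[rule_format]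
  have v: "smooth_on mod.S (vham mod.X B \<psi> (vadj mod.X P_H \<psi> (\<lambda>_. 1)))"
    by (rule mod.smooth_vham[OF B_diff_fun KB s\<psi> mod.smooth_vadj[OF P_H_diff_fun s\<psi> smooth_on_const]])
  have F: "F (jet 1 (\<lambda>x. \<psi> (c x)) y) = vham mod.X B \<psi> (vadj mod.X P_H \<psi> (\<lambda>_. 1)) (c y)" for y
    using system \<psi>c mod.ham_flow_compose[OF c(3) c' P_H_diff_fun s\<psi>, of B y] by (simp add: hamiltonian_system_def)
  have Q: "diff_fun Q"
    using assms by (simp add: conservation_law_def)
  have "lin 1 R (\<lambda>x. \<psi> (c x)) (\<lambda>y. F (jet 1 (\<lambda>x. \<psi> (c x)) y)) 0 = dird 1 (\<lambda>y. Q (jet 1 (\<lambda>x. \<psi> (c x)) y)) 0"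
    using assms \<psi>c by (simp add: conservation_law_def)
  then have "lin 1 R (\<lambda>x. \<psi> (c x)) (\<lambda>y. vham mod.X B \<psi> (vadj mod.X P_H \<psi> (\<lambda>_. 1)) (c y)) 0
      = dird 1 (\<lambda>y. Q (jet 1 (\<lambda>x. \<psi> (c x)) y)) 0"
    by (simp only: F)
  also have "\<dots> = vd mod.X (\<lambda>e. Q (vjet mod.X \<psi> e)) e"
    unfolding mod.jet_compose[OF c(3) c' s\<psi>] mod.dird_compose[OF c(3) c' mod.smooth_diff_fun_vjet[OF Q s\<psi>]] c(1) ..
  finally show ?thesis
    using mod.lin_compose[OF c(3) c' s\<psi> v, of R 0] by (simp only: c(1))
qed

text \<open>In \<open>density_bracket\<close> the second density may be smeared with any smooth
  function, without compact support, so the slow coefficient \<open>H\<close> is admissible.\<close>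

lemma density_bracket_modulated:
  assumes R: "density_bracket B R R' A" "diff_fun R'" and H: "smooth_on UNIV H"
  shows "vlin mod.X R \<psi> (vham mod.X B \<psi> (vadj mod.X R' \<psi> (slow H))) e
    = (\<Sum>j. A j (vjet mod.X \<psi> e) * (vd mod.X ^^ j) (slow H) e)"
proof -
  obtain c where "c 0 = e \<and> smooth_on UNIV c \<and> (\<forall>x. (c has_derivative (\<lambda>h. h *\<^sub>R mod.X (c x))) (at x))"
    using integral_curve[of e] by (elim exE)
  note c = this[THEN conjunct1] this[THEN conjunct2, THEN conjunct1] this[THEN conjunct2, THEN conjunct2, rule_format]
  have c': "1 *\<^sub>R mod.X (c x) = mod.X (c x)" "c x \<in> mod.S" for x
    by simp_all
  have \<psi>c: "smooth_on UNIV (\<lambda>x. \<psi> (c x))" and Hc: "smooth_on UNIV (\<lambda>x. slow H (c x))"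
    by (rule smooth_on_compose[OF open_UNIV open_UNIV _ _ c(2)], simp_all add: smooth_\<psi> smooth_on_slow[OF H])+
  have s\<psi>: "smooth_on mod.S \<psi>" and sH: "smooth_on mod.S (slow H)"
    by (simp_all add: smooth_\<psi> smooth_on_slow[OF H])
  obtain KB where "\<forall>j>KB. \<forall>u. B j u = 0"
    using B_order by (elim exE)
  note KB = this[rule_format]
  note a = mod.smooth_vadj[OF R(2) s\<psi> sH]
  have v: "smooth_on mod.S (vham mod.X B \<psi> (vadj mod.X R' \<psi> (slow H)))"
    by (rule mod.smooth_vham[OF B_diff_fun KB s\<psi> a])
  have "lin 1 R (\<lambda>x. \<psi> (c x)) (ham_op 1 B (\<lambda>x. \<psi> (c x)) (lin_adj 1 R' (\<lambda>x. \<psi> (c x)) (\<lambda>x. slow H (c x)))) 0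
     = (\<Sum>j. A j (jet 1 (\<lambda>x. \<psi> (c x)) 0) * (dird 1 ^^ j) (\<lambda>x. slow H (c x)) 0)"
    using R(1) \<psi>c Hc unfolding density_bracket_def by blast
  moreover have "lin_adj 1 R' (\<lambda>x. \<psi> (c x)) (\<lambda>x. slow H (c x)) = (\<lambda>x. vadj mod.X R' \<psi> (slow H) (c x))"
    using mod.lin_adj_compose[OF c(3) c' R(2) s\<psi> sH] by (rule ext)
  moreover have "ham_op 1 B (\<lambda>x. \<psi> (c x)) (\<lambda>x. vadj mod.X R' \<psi> (slow H) (c x))
      = (\<lambda>x. vham mod.X B \<psi> (vadj mod.X R' \<psi> (slow H)) (c x))"
    using mod.ham_op_compose[OF c(3) c' s\<psi> a] by (rule ext)
  ultimately show ?thesis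
    by (simp only: mod.lin_compose[OF c(3) c' s\<psi> v] mod.jet_compose[OF c(3) c' s\<psi>]
      mod.dird_pow_compose[OF c(3) c' sH] c(1))
qed

lemma total_derivative_modulated:
  assumes "\<And>(\<phi> :: real \<Rightarrow> real ^ 'n) x. smooth_on UNIV \<phi> \<Longrightarrow> A0 (jet 1 \<phi> x) = dird 1 (\<lambda>y. q (jet 1 \<phi> y)) x"
    and q: "diff_fun q"
  shows "A0 (vjet mod.X \<psi> e) = vd mod.X (\<lambda>e. q (vjet mod.X \<psi> e)) e"
proof -
  obtain c where "c 0 = e \<and> smooth_on UNIV c \<and> (\<forall>x. (c has_derivative (\<lambda>h. h *\<^sub>R mod.X (c x))) (at x))"
    using integral_curve[of e] by (elim exE)
  note c = this[THEN conjunct1] this[THEN conjunct2, THEN conjunct1] this[THEN conjunct2, THEN conjunct2, rule_format]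
  have c': "1 *\<^sub>R mod.X (c x) = mod.X (c x)" "c x \<in> mod.S" for x
    by simp_all
  have \<psi>c: "smooth_on UNIV (\<lambda>x. \<psi> (c x))"
    by (rule smooth_on_compose[OF open_UNIV open_UNIV _ smooth_\<psi> c(2)]) simp
  have s\<psi>: "smooth_on mod.S \<psi>"
    by (simp add: smooth_\<psi>)
  show ?thesis
    using assms(1)[OF \<psi>c, of 0]
    unfolding mod.jet_compose[OF c(3) c' s\<psi>] mod.dird_compose[OF c(3) c' mod.smooth_diff_fun_vjet[OF q s\<psi>]] c(1) .
qed

subsection \<open>The first order in \<open>\<epsilon>\<close>\<close>

text \<open>The coordinates of the modulated bundle are (\<theta>, \<epsilon>, X), so (0, 1, 0) is
  the direction of \<epsilon>.\<close>

abbreviation D :: "((real ^ 'm) \<times> real \<times> real \<Rightarrow> 'b::real_normed_vector) \<Rightarrow> (real ^ 'm) \<times> real \<times> real \<Rightarrow> 'b" where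
  "D g \<equiv> \<lambda>e. frechet_derivative g (at e) (0, 1, 0)"

lemma smooth_D: "smooth_on UNIV g \<Longrightarrow> smooth_on UNIV (D g)"
  by (rule smooth_on_frechet_derivative)

lemma smooth_vd_UNIV: "smooth_on UNIV g \<Longrightarrow> smooth_on UNIV ((vd mod.X ^^ l) g)"
  using mod.smooth_vd_pow by simp

lemma D_bilinear:
  assumes "bounded_bilinear pr" "smooth_on UNIV f" "smooth_on UNIV g"
  shows "D (\<lambda>e. pr (f e) (g e)) e = pr (f e) (D g e) + pr (D f e) (g e)"
  by (rule frechet_derivative_eq[OF bounded_bilinear.FDERIV[OF assms(1)
          smooth_on_has_derivative[OF assms(2) UNIV_I] smooth_on_has_derivative[OF assms(3) UNIV_I]]])

lemma D_sum:
  assumes "\<And>i. i \<in> I \<Longrightarrow> smooth_on UNIV (f i)"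
  shows "D (\<lambda>e. \<Sum>i\<in>I. f i e) e = (\<Sum>i\<in>I. D (f i) e)"
  by (rule frechet_derivative_eq[OF has_derivative_sum]) (rule smooth_on_has_derivative[OF assms UNIV_I])

lemma D_diff:
  assumes "smooth_on UNIV f" "smooth_on UNIV g"
  shows "D (\<lambda>e. f e - g e) e = D f e - D g e"
  by (rule frechet_derivative_eq[OF has_derivative_diff[OF smooth_on_has_derivative[OF assms(1) UNIV_I]
          smooth_on_has_derivative[OF assms(2) UNIV_I]]])

lemma frechet_vanishing_on_slice:
  assumes "smooth_on UNIV u" "\<And>\<theta> X. u (\<theta>, 0, X) = 0"
  shows "frechet_derivative u (at (\<theta>, 0, X)) (v, 0, y) = 0"
  by (rule frechet_zero_tangent[OF assms(1)]) (simp add: assms(2))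

text \<open>Here \<epsilon> enters the field only as the rate of X. The commutator of the
  \<epsilon>-derivative with the total derivative is therefore the X-derivative; every slow
  derivative in the result comes from this.\<close>

lemma frechet_mod_X: "frechet_derivative mod.X (at e) (0, 1, 0) = (0, 0, 1)"
proof -
  have "((\<lambda>z. k (p (snd z))) has_derivative (\<lambda>v. k (frechet_derivative p (at (snd (snd e))) (snd v)))) (at (snd e))"
    by (intro bounded_linear.has_derivative[OF bounded_linear_wave_numbers] has_derivative_frechet_chain)
      (auto intro!: derivative_eq_intros smooth_on_imp_differentiable[OF smooth_p])
  from frechet_derivative_eq[OF this, of "(1, 0)"]
  have "frechet_derivative (\<lambda>z. k (p (snd z))) (at (snd e)) (1, 0) = 0"
    using linear_0[OF smooth_on_frechet_linear[OF smooth_p UNIV_I]]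
      linear_0[OF bounded_linear.linear[OF bounded_linear_wave_numbers]] by simp
  moreover have "frechet_derivative (\<lambda>z :: real \<times> real. (0 :: real, fst z)) (at (snd e)) (1, 0) = (0, 1)"
    by (rule trans[OF frechet_derivative_eq[where f' = "\<lambda>v. (0, fst v)"]]) (auto intro!: derivative_eq_intros)
  ultimately show ?thesis
    by (simp add: mod.frechet_X)
qed

lemma D_vd:
  fixes g :: "(real ^ 'm) \<times> real \<times> real \<Rightarrow> 'b::euclidean_space"
  assumes "smooth_on UNIV g"
  shows "D (vd mod.X g) e = vd mod.X (D g) e + frechet_derivative g (at e) (0, 0, 1)"
  using mod.vd_commute[of g e "(0, 1, 0)"] assms by (simp add: frechet_mod_X)

text \<open>The field is tangent to the slice \<epsilon> = 0, so derivatives along it of a function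
  vanishing there vanish too. So do its X-derivatives, which are the commutators between
  \<open>D\<close> and the total derivative; hence the two commute on the slice.\<close>

lemma vanishing_on_slice:
  fixes u :: "(real ^ 'm) \<times> real \<times> real \<Rightarrow> 'b::euclidean_space"
  assumes u: "smooth_on UNIV u" "\<And>\<theta> X. u (\<theta>, 0, X) = 0"
  shows "(vd mod.X ^^ l) u (\<theta>, 0, X) = 0"
    and "D ((vd mod.X ^^ l) u) (\<theta>, 0, X) = (vd mod.X ^^ l) (D u) (\<theta>, 0, X)"
proof -
  have X: "mod.X (\<theta>, 0, X) = (k (p X), 0, 0)" for \<theta> X
    by (simp add: mod.X_def)
  show zero: "(vd mod.X ^^ l) u (\<theta>, 0, X) = 0" for l \<theta> X
  proof (induction l arbitrary: \<theta> X)
    case (Suc l)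
    then show ?case
      using frechet_vanishing_on_slice[OF smooth_vd_UNIV[OF u(1)]] by (simp add: vd_def[of _ "(vd _ ^^ l) u"] X)
  qed (simp add: u)
  show "D ((vd mod.X ^^ l) u) (\<theta>, 0, X) = (vd mod.X ^^ l) (D u) (\<theta>, 0, X)"
  proof (induction l arbitrary: \<theta> X)
    case (Suc l)
    let ?v = "\<lambda>e. D ((vd mod.X ^^ l) u) e - (vd mod.X ^^ l) (D u) e"
    have sm: "smooth_on UNIV (D ((vd mod.X ^^ l) u))" "smooth_on UNIV ((vd mod.X ^^ l) (D u))"
      by (intro smooth_D smooth_vd_UNIV u)+
    have "vd mod.X ?v (\<theta>, 0, X) = 0"
      unfolding vd_def[of mod.X ?v] X
      by (rule frechet_vanishing_on_slice[OF smooth_on_diff[OF open_UNIV sm]]) (simp add: Suc.IH)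
    moreover have "vd mod.X ?v (\<theta>, 0, X) = vd mod.X (D ((vd mod.X ^^ l) u)) (\<theta>, 0, X) - (vd mod.X ^^ Suc l) (D u) (\<theta>, 0, X)"
      using mod.vd_pow_diff[of "D ((vd mod.X ^^ l) u)" "(vd mod.X ^^ l) (D u)" "(\<theta>, 0, X)" 1] sm by simp
    moreover have "frechet_derivative ((vd mod.X ^^ l) u) (at (\<theta>, 0, X)) (0, 0, 1) = 0"
      by (rule frechet_vanishing_on_slice[OF smooth_vd_UNIV[OF u(1)] zero])
    ultimately show ?case
      using D_vd[OF smooth_vd_UNIV[OF u(1)], of l "(\<theta>, 0, X)"] by simp
  qed simp
qed

lemma vd_pow_slice_cong:
  fixes u v :: "(real ^ 'm) \<times> real \<times> real \<Rightarrow> 'b::euclidean_space"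
  assumes "smooth_on UNIV u" "smooth_on UNIV v" "\<And>\<theta> X. u (\<theta>, 0, X) = v (\<theta>, 0, X)"
  shows "(vd mod.X ^^ l) u (\<theta>, 0, X) = (vd mod.X ^^ l) v (\<theta>, 0, X)"
  using vanishing_on_slice(1)[OF smooth_on_diff[OF open_UNIV assms(1,2)], of l \<theta> X] assms
    mod.vd_pow_diff[of u v "(\<theta>, 0, X)" l] by simp

text \<open>When the \<epsilon>-derivative falls on a coefficient of the operator, the remaining
  factor vanishes on the slice. To first order the operator can be frozen at \<epsilon> = 0.\<close>

lemma D_vham_slice:
  assumes w: "smooth_on UNIV w" "\<And>\<theta> X. w (\<theta>, 0, X) = 0"
  shows "vham mod.X B \<psi> w (\<theta>, 0, X) = 0"
    and "D (vham mod.X B \<psi> w) (\<theta>, 0, X) = vham mod.X B \<psi> (D w) (\<theta>, 0, X)"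
proof -
  obtain KB where "\<forall>j>KB. \<forall>u. B j u = 0"
    using B_order by (elim exE)
  note KB = this[rule_format]
  have eq: "vham mod.X B \<psi> w = (\<lambda>e. \<Sum>j\<le>KB. B j (vjet mod.X \<psi> e) *v (vd mod.X ^^ j) w e)"
    by (intro ext vham_eq_sum KB)
  show "vham mod.X B \<psi> w (\<theta>, 0, X) = 0"
    unfolding eq by (simp add: vanishing_on_slice(1)[OF w])
  have "D (vham mod.X B \<psi> w) (\<theta>, 0, X)
      = (\<Sum>j\<le>KB. D (\<lambda>e. B j (vjet mod.X \<psi> e) *v (vd mod.X ^^ j) w e) (\<theta>, 0, X))"
    unfolding eq
    by (intro D_sum smooth_on_bilinear[OF open_UNIV bounded_bilinear_matrix_vector] smooth_vjet B_diff_fun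
        smooth_vd_UNIV w)
  also have "\<dots> = (\<Sum>j\<le>KB. B j (vjet mod.X \<psi> (\<theta>, 0, X)) *v (vd mod.X ^^ j) (D w) (\<theta>, 0, X))"
    by (simp add: D_bilinear[OF bounded_bilinear_matrix_vector smooth_vjet[OF B_diff_fun] smooth_vd_UNIV[OF w(1)]]
        vanishing_on_slice[OF w])
  finally show "D (vham mod.X B \<psi> w) (\<theta>, 0, X) = vham mod.X B \<psi> (D w) (\<theta>, 0, X)"
    by (simp add: vham_eq_sum[OF KB])
qed

lemma D_vlin_slice:
  fixes f :: "'n jet \<Rightarrow> real"
  assumes f: "diff_fun f" and y: "smooth_on UNIV y" "\<And>\<theta> X. y (\<theta>, 0, X) = 0"
  shows "D (vlin mod.X f \<psi> y) (\<theta>, 0, X) = vlin mod.X f \<psi> (D y) (\<theta>, 0, X)"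
proof -
  obtain K where K: "jet_order K f"
    using diff_fun_order[OF f] by blast
  have eq: "vlin mod.X f \<psi> y = (\<lambda>e. \<Sum>l\<le>K. (vd mod.X ^^ l) y e \<bullet> (\<chi> i. pd l i f (vjet mod.X \<psi> e)))" for y
    by (simp add: vlin_eq_sum[OF K] fun_eq_iff inner_vec_def)
  have c: "smooth_on UNIV (\<lambda>e. \<chi> i. pd l i f (vjet mod.X \<psi> e))" for l
    by (intro smooth_on_vec_lambda smooth_vjet diff_fun_pd f open_UNIV)
  have "D (vlin mod.X f \<psi> y) (\<theta>, 0, X)
      = (\<Sum>l\<le>K. D (\<lambda>e. (vd mod.X ^^ l) y e \<bullet> (\<chi> i. pd l i f (vjet mod.X \<psi> e))) (\<theta>, 0, X))"
    unfolding eq by (intro D_sum smooth_on_inner smooth_vd_UNIV c y open_UNIV)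
  also have "\<dots> = (\<Sum>l\<le>K. (vd mod.X ^^ l) (D y) (\<theta>, 0, X) \<bullet> (\<chi> i. pd l i f (vjet mod.X \<psi> (\<theta>, 0, X))))"
    by (simp add: D_bilinear[OF bounded_bilinear_inner smooth_vd_UNIV[OF y(1)] c] vanishing_on_slice[OF y])
  finally show ?thesis
    by (simp add: eq)
qed

text \<open>The \<epsilon>-derivative of a total derivative is a total derivative plus the
  X-derivative. At \<epsilon> = 0 the former has zero mean, and the latter commutes with
  averaging.\<close>

lemma fibre_mean_D_vd:
  assumes q: "smooth_on UNIV q" "mod.fibre_periodic q"
  shows "fibre_mean (D (vd mod.X q)) (0, X) = line_d (\<lambda>X. fibre_mean q (0, X)) X"
proof -
  have "fibre_mean (D (vd mod.X q)) (0, X)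
      = fibre_mean (\<lambda>e. vd mod.X (D q) e + frechet_derivative q (at e) (0, 0, 1)) (0, X)"
    by (simp only: D_vd[OF q(1)])
  also have "\<dots> = fibre_mean (vd mod.X (D q)) (0, X) + fibre_mean (\<lambda>e. frechet_derivative q (at e) (0, 0, 1)) (0, X)"
    using mod.fibre_mean_add[of "vd mod.X (D q)" "\<lambda>e. frechet_derivative q (at e) (0, 0, 1)" "(0, X)"]
      smooth_vd_UNIV[OF smooth_D[OF q(1)], of 1] smooth_on_frechet_derivative[OF q(1)] by simp
  also have "fibre_mean (vd mod.X (D q)) (0, X) = 0"
    by (rule mod.fibre_mean_vd_zero) (use q mod.fibre_periodic_frechet[of q "\<lambda>_. (0, 1, 0)"] in \<open>auto simp: smooth_D zero_prod_def\<close>)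
  also have "fibre_mean (\<lambda>e. frechet_derivative q (at e) (0, 0, 1)) (0, X)
      = frechet_derivative (fibre_mean q) (at (0, X)) (0, 1)"
    using mod.frechet_fibre_mean[of q "(0, X)" "(0, 1)"] q(1) by simp
  also have "\<dots> = line_d (\<lambda>X. fibre_mean q (0, X)) X"
    unfolding vd_def
    by (rule frechet_derivative_chain[where f = "fibre_mean q" and c = "Pair 0" and c' = "\<lambda>x. (0, x)", symmetric])
      (use mod.smooth_fibre_mean[of q] q(1) in \<open>auto intro!: derivative_eq_intros smooth_on_imp_differentiable\<close>)
  finally show ?thesis
    by simp
qed

lemma D_slow: "smooth_on UNIV H \<Longrightarrow> D (slow H) e = 0"
  using linear_0[OF smooth_on_frechet_linear[of UNIV H "snd (snd e)"]]
  by (subst frechet_derivative_chain[where f = H and c' = "\<lambda>v. snd (snd v)"])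
    (auto intro!: derivative_eq_intros smooth_on_imp_differentiable)

end

section \<open>The defect and its first order in epsilon\<close>

context modulation
begin

lemma frechet_\<psi>: "frechet_derivative \<psi> (at (\<theta>, \<epsilon>, X)) (v, 0) = frechet_derivative \<phi> (at (\<theta>, p X)) (v, 0)"
  using mod.dird_fibre[of \<psi> "(\<epsilon>, X)" v \<theta>] fam.dird_fibre[OF smooth_\<phi> p_W, of v X \<theta>] smooth_\<psi>
  by (simp add: \<psi>_def)

lemma momentum_slice:
  assumes "diff_fun f"
  shows "fibre_mean (vmom K mod.X f \<psi> (\<lambda>e. frechet_derivative \<psi> (at e) (v, 0))) (0, X)
    = fibre_mean (vmom K fam.X f \<phi> (\<lambda>e. frechet_derivative \<phi> (at e) (v, 0))) (p X)"
  unfolding fibre_mean_def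
  by (simp add: vmom_def slice(1)[OF assms] frechet_\<psi>
      vd_pow_slice[OF smooth_on_frechet_derivative[OF smooth_\<phi>] smooth_on_frechet_derivative[OF smooth_\<psi>]])

text \<open>On the slice a slow coefficient is constant along the torus and can be taken out of the
  adjoint as a scalar.\<close>

lemma vadj_slow_slice:
  assumes f: "diff_fun f" and H: "smooth_on UNIV H"
  shows "vadj mod.X f \<psi> (slow H) (\<theta>, 0, X) = H X *\<^sub>R grad f (\<theta>, p X)"
proof -
  have s\<psi>: "smooth_on mod.S \<psi>" and sH: "smooth_on mod.S (slow H)"
    by (simp_all add: smooth_\<psi> smooth_on_slow[OF H])
  have "vadj mod.X f \<psi> (slow H) (\<theta>, 0, X) = vadj mod.X f \<psi> (\<lambda>_. H X) (\<theta>, 0, X)"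
    using mod.lin_adj_fibre[OF f s\<psi> sH, of "(0, X)" \<theta>] mod.lin_adj_fibre[OF f s\<psi> smooth_on_const, of "(0, X)" "H X" \<theta>]
    by (simp add: zero_prod_def)
  then show ?thesis
    using mod.vadj_const[OF f s\<psi>, of "(\<theta>, 0, X)" "H X"] by (simp add: slice(2)[OF f])
qed

lemma vd_slow:
  assumes h: "smooth_on UNIV h"
  shows "vd mod.X (slow h) e = fst (snd e) *\<^sub>R line_d h (snd (snd e))"
    and "D (vd mod.X (slow h)) = slow (line_d h)"
proof -
  have fr: "frechet_derivative (slow h) (at e) v = snd (snd v) *\<^sub>R line_d h (snd (snd e))" for e v
    unfolding vd_def using linear_scale[OF smooth_on_frechet_linear[OF h UNIV_I], of "snd (snd e)" "snd (snd v)" 1]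
    by (subst frechet_derivative_chain[where f = h and c' = "\<lambda>v. snd (snd v)"])
      (auto intro!: derivative_eq_intros smooth_on_imp_differentiable[OF h])
  show "vd mod.X (slow h) e = fst (snd e) *\<^sub>R line_d h (snd (snd e))"
    unfolding vd_def[of mod.X] by (simp add: fr mod.X_def)
  have vd: "vd mod.X (slow h) = (\<lambda>e. fst (snd e) *\<^sub>R line_d h (snd (snd e)))"
    unfolding vd_def[of mod.X] by (simp add: fr mod.X_def fun_eq_iff)
  have s1: "smooth_on UNIV (\<lambda>e :: (real ^ 'm) \<times> real \<times> real. fst (snd e))" and s2: "smooth_on UNIV (slow (line_d h))"
    using line.smooth_vd[OF h] by (auto intro!: smooth_on_fst smooth_on_snd smooth_on_ident smooth_on_slow)
  have "D (\<lambda>e :: (real ^ 'm) \<times> real \<times> real. fst (snd e)) e = 1" for e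
    by (rule trans[OF frechet_derivative_eq[where f' = "\<lambda>v. fst (snd v)"]]) (auto intro!: derivative_eq_intros)
  then show "D (vd mod.X (slow h)) = slow (line_d h)"
    unfolding vd using D_bilinear[OF bounded_bilinear_scaleR s1 s2] D_slow[OF line.smooth_vd[OF h]]
    by (simp add: fun_eq_iff)
qed

text \<open>The j-th total derivative of a slow function is \<epsilon>^j times its j-th derivative.
  At first order only j = 1 contributes among the positive j, which is why just \<open>A 0\<close>
  and \<open>A 1\<close> enter the averaged bracket.\<close>

lemma vd_pow_slow_slice:
  fixes h :: "real \<Rightarrow> real"
  assumes h: "smooth_on UNIV h"
  shows "(vd mod.X ^^ Suc j) (slow h) (\<theta>, 0, X) = 0"
    and "D ((vd mod.X ^^ Suc j) (slow h)) (\<theta>, 0, X) = (if j = 0 then line_d h X else 0)"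
proof -
  have s: "smooth_on UNIV (vd mod.X (slow h))" if "smooth_on UNIV h" for h :: "real \<Rightarrow> real"
    using smooth_vd_UNIV[OF smooth_on_slow[OF that], of 1] by simp
  have z: "vd mod.X (slow h) (\<theta>, 0, X) = 0" if "smooth_on UNIV h" for h :: "real \<Rightarrow> real" and \<theta> X
    by (simp add: vd_slow(1)[OF that])
  have zero: "(vd mod.X ^^ Suc j) (slow h) (\<theta>, 0, X) = 0" if "smooth_on UNIV h" for h :: "real \<Rightarrow> real" and j \<theta> X
    using vanishing_on_slice(1)[OF s[OF that] z[OF that], of j \<theta> X] by (simp only: funpow_Suc_right o_apply)
  then show "(vd mod.X ^^ Suc j) (slow h) (\<theta>, 0, X) = 0"
    using h .
  have "D ((vd mod.X ^^ Suc j) (slow h)) (\<theta>, 0, X) = (vd mod.X ^^ j) (slow (line_d h)) (\<theta>, 0, X)"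
    using vanishing_on_slice(2)[OF s[OF h] z[OF h], of j \<theta> X] unfolding vd_slow(2)[OF h]
    by (simp only: funpow_Suc_right o_apply)
  then show "D ((vd mod.X ^^ Suc j) (slow h)) (\<theta>, 0, X) = (if j = 0 then line_d h X else 0)"
    using zero[OF line.smooth_vd[OF h]] by (cases j) auto
qed

lemma fibre_mean_D_zero:
  assumes "smooth_on UNIV g" "\<And>z. fibre_mean g z = 0"
  shows "fibre_mean (D g) z = 0"
proof -
  have "fibre_mean g = (\<lambda>_. 0)"
    using assms(2) by (rule ext)
  then show ?thesis
    using mod.frechet_fibre_mean[of g z "(1, 0)"] assms(1) by (simp add: frechet_derivative_const)
qed

context
  fixes H :: "real \<Rightarrow> real ^ 'N"
  assumes H: "smooth_on UNIV H"
    and gradients: "\<And>\<theta> X. grad P_H (\<theta>, p X) = (\<Sum>\<mu>\<in>UNIV. H X $ \<mu> *\<^sub>R grad (P \<mu>) (\<theta>, p X))"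
    and momenta: "\<And>K v X. jet_order K P_H \<Longrightarrow> (\<And>\<mu>. jet_order K (P \<mu>)) \<Longrightarrow>
      fibre_mean (vmom K fam.X P_H \<phi> (\<lambda>e. frechet_derivative \<phi> (at e) (v, 0))) (p X)
      = (\<Sum>\<mu>\<in>UNIV. H X $ \<mu> * fibre_mean (vmom K fam.X (P \<mu>) \<phi> (\<lambda>e. frechet_derivative \<phi> (at e) (v, 0))) (p X))"
begin

lemma smooth_H: "smooth_on UNIV (\<lambda>X. H X $ \<mu>)"
  by (rule smooth_on_nth[OF open_UNIV H])

abbreviation (input) G :: "'N \<Rightarrow> (real ^ 'm) \<times> real \<times> real \<Rightarrow> real" where
  "G \<mu> \<equiv> slow (\<lambda>X. H X $ \<mu>)"

text \<open>
  The part of the variational derivative of the Hamiltonian that the integrals \<open>I\<^sup>\<mu>\<close> do not account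
  for; it is of first order in \<open>\<epsilon>\<close>.
\<close>

definition defect :: "(real ^ 'm) \<times> real \<times> real \<Rightarrow> real ^ 'n" where
  "defect e = vadj mod.X P_H \<psi> (\<lambda>_. 1) e - (\<Sum>\<mu>\<in>UNIV. vadj mod.X (P \<mu>) \<psi> (G \<mu>) e)"

lemma smooth_vadj_mod: "diff_fun f \<Longrightarrow> smooth_on UNIV g \<Longrightarrow> smooth_on UNIV (vadj mod.X f \<psi> g)"
  using mod.smooth_vadj[of f \<psi> g] smooth_\<psi> by simp

lemma smooth_defect: "smooth_on UNIV defect"
  unfolding defect_def[abs_def]
  by (intro smooth_on_diff smooth_on_sum smooth_vadj_mod P_diff_fun P_H_diff_fun smooth_on_const
      smooth_on_slow smooth_H open_UNIV)

lemma defect_slice: "defect (\<theta>, 0, X) = 0"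
  by (simp add: defect_def slice(2)[OF P_H_diff_fun] vadj_slow_slice[OF P_diff_fun smooth_H] gradients)

text \<open>Green's identity writes the pairing as a combination of linearizations along a phase
  shift minus the total derivative of a flux. The former average to zero on every fibre; to first
  order the latter averages to the X-derivative of the mean flux.\<close>

lemma fibre_mean_tangent_defect:
  "fibre_mean (\<lambda>e. frechet_derivative \<psi> (at e) (v, 0) \<bullet> D defect e) (0, X) = 0"
proof -
  let ?a = "\<lambda>e. frechet_derivative \<psi> (at e) (v, 0)"
  obtain K where K: "jet_order K P_H" "\<And>\<mu>. jet_order K (P \<mu>)"
  proof -
    obtain K1 K2 where "\<forall>\<mu>\<in>UNIV. jet_order K1 (P \<mu>)" "jet_order K2 P_H"
      using diff_fun_finite_order[of UNIV P] P_diff_fun diff_fun_order[OF P_H_diff_fun] by auto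
    then show thesis
      by (intro that[of "max K1 K2"]) (auto intro: jet_order_mono)
  qed
  have a: "smooth_on UNIV ?a" "mod.fibre_periodic ?a"
    using mod.fibre_periodic_frechet[of \<psi> "\<lambda>_. (v, 0)"] periodic_\<psi>
    by (auto intro!: smooth_on_frechet_derivative simp: smooth_\<psi>)
  have S: "smooth_on mod.S \<psi>" "smooth_on mod.S ?a" "smooth_on mod.S (G \<mu>)" for \<mu>
    using smooth_\<psi> a smooth_on_slow[OF smooth_H] by simp_all
  let ?l = "\<lambda>f. vlin mod.X f \<psi> ?a"
  \<comment> \<open>A phase shift commutes with the total derivative, so the linearization along it
    is the phase derivative of the density itself.\<close>
  have l: "?l f = (\<lambda>e. frechet_derivative (\<lambda>e. f (vjet mod.X \<psi> e)) (at e) (v, 0))" if "diff_fun f" for f :: "'n jet \<Rightarrow> real"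
    using mod.frechet_diff_fun_vjet[OF that S(1)] mod.vd_pow_fibre_commute[OF S(1)] by (simp add: fun_eq_iff vlin_def)
  \<comment> \<open>The mean vanishes for every value of \<epsilon>, not only on the slice; this is
    needed because it is differentiated in \<epsilon> below.\<close>
  have l_smooth: "smooth_on UNIV (?l f)" and l_mean: "fibre_mean (?l f) z = 0"
    if "diff_fun f" for f :: "'n jet \<Rightarrow> real" and z
    using mod.fibre_mean_frechet_fibre[of "\<lambda>e. f (vjet mod.X \<psi> e)" z v] smooth_vjet[OF that] periodic_vjet
    by (auto simp: l[OF that] intro: smooth_on_frechet_derivative)
  let ?r = "\<lambda>e. vbdry K mod.X P_H \<psi> ?a (\<lambda>_. 1) e - (\<Sum>\<mu>\<in>UNIV. vbdry K mod.X (P \<mu>) \<psi> ?a (G \<mu>) e)"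
  have b_smooth: "smooth_on UNIV (vbdry K mod.X f \<psi> ?a g)" if "diff_fun f" "smooth_on UNIV g" for f :: "'n jet \<Rightarrow> real" and g
    using mod.smooth_vbdry[of f \<psi> ?a g K] that S by simp
  have b_periodic: "mod.fibre_periodic (vbdry K mod.X f \<psi> ?a g)"
    if "diff_fun f" "smooth_on UNIV g" "mod.fibre_periodic g" for f :: "'n jet \<Rightarrow> real" and g
    using mod.fibre_periodic_vbdry[of \<psi> g f ?a K] that S a periodic_\<psi> by simp
  have slow_periodic: "mod.fibre_periodic (slow g)" for g :: "real \<Rightarrow> real"
    by (rule mod.fibre_periodic_base[of "\<lambda>z. g (snd z)"])
  have r: "smooth_on UNIV ?r"
    by (intro smooth_on_diff smooth_on_sum b_smooth P_diff_fun P_H_diff_fun smooth_on_const smooth_on_slow smooth_H open_UNIV)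
  have r_periodic: "mod.fibre_periodic ?r"
    by (intro mod.fibre_periodic_compose2[where h = "(-)"] mod.fibre_periodic_sum b_periodic P_diff_fun P_H_diff_fun
        smooth_on_const smooth_on_slow smooth_H mod.fibre_periodic_const slow_periodic)
  let ?g = "\<lambda>e. ?l P_H e - (\<Sum>\<mu>\<in>UNIV. G \<mu> e * ?l (P \<mu>) e)"
  have g: "smooth_on UNIV ?g"
    by (intro smooth_on_diff smooth_on_sum smooth_on_mult l_smooth P_diff_fun P_H_diff_fun smooth_on_slow smooth_H open_UNIV)
  have g_mean: "fibre_mean ?g z = 0" for z
  proof -
    have "smooth_on UNIV (\<lambda>e. \<Sum>\<mu>\<in>UNIV. G \<mu> e * ?l (P \<mu>) e)"
      by (intro smooth_on_sum smooth_on_mult l_smooth P_diff_fun smooth_on_slow smooth_H open_UNIV)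
    then have "fibre_mean ?g z = fibre_mean (?l P_H) z - fibre_mean (\<lambda>e. \<Sum>\<mu>\<in>UNIV. G \<mu> e * ?l (P \<mu>) e) z"
      using l_smooth[OF P_H_diff_fun] by (intro mod.fibre_mean_diff) simp_all
    also have "fibre_mean (\<lambda>e. \<Sum>\<mu>\<in>UNIV. G \<mu> e * ?l (P \<mu>) e) z = (\<Sum>\<mu>\<in>UNIV. fibre_mean (\<lambda>e. G \<mu> e * ?l (P \<mu>) e) z)"
      using smooth_on_mult[OF open_UNIV smooth_on_slow[OF smooth_H] l_smooth[OF P_diff_fun]]
      by (intro mod.fibre_mean_sum) simp_all
    also have "\<dots> = (\<Sum>\<mu>\<in>UNIV. H (snd z) $ \<mu> * fibre_mean (?l (P \<mu>)) z)"
      by (intro sum.cong refl) (rule mod.fibre_mean_base_mult[of "\<lambda>z. H (snd z) $ _"])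
    also have "\<dots> = 0"
      by (simp add: l_mean[OF P_diff_fun])
    finally show ?thesis
      by (simp add: l_mean[OF P_H_diff_fun])
  qed
  have dr: "vd mod.X ?r e = vd mod.X (vbdry K mod.X P_H \<psi> ?a (\<lambda>_. 1)) e
      - (\<Sum>\<mu>\<in>UNIV. vd mod.X (vbdry K mod.X (P \<mu>) \<psi> ?a (G \<mu>)) e)" for e
  proof -
    have "smooth_on UNIV (\<lambda>e. \<Sum>\<mu>\<in>UNIV. vbdry K mod.X (P \<mu>) \<psi> ?a (G \<mu>) e)"
      by (intro smooth_on_sum b_smooth P_diff_fun smooth_on_slow smooth_H open_UNIV)
    then have "vd mod.X ?r e = vd mod.X (vbdry K mod.X P_H \<psi> ?a (\<lambda>_. 1)) e
        - vd mod.X (\<lambda>e. \<Sum>\<mu>\<in>UNIV. vbdry K mod.X (P \<mu>) \<psi> ?a (G \<mu>) e) e"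
      using mod.vd_pow_diff[of "vbdry K mod.X P_H \<psi> ?a (\<lambda>_. 1)" _ e 1] b_smooth[OF P_H_diff_fun smooth_on_const] by simp
    also have "vd mod.X (\<lambda>e. \<Sum>\<mu>\<in>UNIV. vbdry K mod.X (P \<mu>) \<psi> ?a (G \<mu>) e) e
        = (\<Sum>\<mu>\<in>UNIV. vd mod.X (vbdry K mod.X (P \<mu>) \<psi> ?a (G \<mu>)) e)"
      using b_smooth[OF P_diff_fun smooth_on_slow[OF smooth_H]] by (intro mod.vd_sum) simp_all
    finally show ?thesis .
  qed
  have u: "?a e \<bullet> defect e = ?g e - vd mod.X ?r e" for e
    using mod.inner_vadj[OF P_H_diff_fun K(1) S(1,2) smooth_on_const, of e 1]
      mod.inner_vadj[OF P_diff_fun K(2) S(1,2) S(3), of e]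
    by (simp add: defect_def inner_diff_right inner_sum_right dr sum_subtractf)
  have vr: "smooth_on UNIV (vd mod.X ?r)"
    using smooth_vd_UNIV[OF r, of 1] by simp
  \<comment> \<open>The other term of the product rule contains the defect itself, which vanishes at
    \<epsilon> = 0.\<close>
  have "fibre_mean (\<lambda>e. ?a e \<bullet> D defect e) (0, X) = fibre_mean (D (\<lambda>e. ?a e \<bullet> defect e)) (0, X)"
    by (rule mod.fibre_mean_cong) (simp add: D_bilinear[OF bounded_bilinear_inner a(1) smooth_defect] defect_slice)
  also have "\<dots> = fibre_mean (\<lambda>e. D ?g e - D (vd mod.X ?r) e) (0, X)"
    unfolding u by (simp only: D_diff[OF g vr])
  also have "\<dots> = fibre_mean (D ?g) (0, X) - fibre_mean (D (vd mod.X ?r)) (0, X)"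
    using mod.fibre_mean_diff[of "D ?g" "D (vd mod.X ?r)" "(0, X)"] smooth_D[OF g] smooth_D[OF vr] by simp
  also have "fibre_mean (D ?g) (0, X) = 0"
    by (rule fibre_mean_D_zero[OF g g_mean])
  also have "fibre_mean (D (vd mod.X ?r)) (0, X) = line_d (\<lambda>X. fibre_mean ?r (0, X)) X"
    by (rule fibre_mean_D_vd[OF r r_periodic])
  \<comment> \<open>On the slice each flux averages to its coefficient times the mean of
    \<open>vmom\<close>, and \<open>momenta\<close> says that these cancel for every X, hence after
    differentiation in X as well.\<close>
  also have "(\<lambda>X. fibre_mean ?r (0, X)) = (\<lambda>X. 0)"
  proof
    fix X
    let ?M = "\<lambda>f. fibre_mean (vmom K fam.X f \<phi> (\<lambda>e. frechet_derivative \<phi> (at e) (v, 0))) (p X)"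
    have mean_b: "fibre_mean (vbdry K mod.X f \<psi> ?a (slow h)) (0, X) = h X * ?M f"
      if "diff_fun f" "smooth_on UNIV h" for f :: "'n jet \<Rightarrow> real" and h
    proof -
      have h: "smooth_on UNIV (\<lambda>z :: real \<times> real. h (snd z))"
        by (rule smooth_on_compose[OF open_UNIV open_UNIV _ that(2)])
          (auto intro: smooth_on_linear_map bounded_linear_snd)
      have "(0, fst (0 :: real, X)) = (0 :: real \<times> real)"
        by (simp add: zero_prod_def)
      from mod.fibre_mean_vbdry[OF that(1) S(1) periodic_\<psi> S(2) a(2) h UNIV_I this, of K] show ?thesis
        by (simp add: momentum_slice[OF that(1)])
    qed
    have "fibre_mean ?r (0, X) = fibre_mean (vbdry K mod.X P_H \<psi> ?a (slow (\<lambda>_. 1))) (0, X)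
        - fibre_mean (\<lambda>e. \<Sum>\<mu>\<in>UNIV. vbdry K mod.X (P \<mu>) \<psi> ?a (G \<mu>) e) (0, X)"
      using b_smooth[OF P_H_diff_fun smooth_on_const] smooth_on_sum[OF open_UNIV b_smooth[OF P_diff_fun smooth_on_slow[OF smooth_H]]]
      by (intro mod.fibre_mean_diff) simp_all
    also have "fibre_mean (\<lambda>e. \<Sum>\<mu>\<in>UNIV. vbdry K mod.X (P \<mu>) \<psi> ?a (G \<mu>) e) (0, X)
        = (\<Sum>\<mu>\<in>UNIV. fibre_mean (vbdry K mod.X (P \<mu>) \<psi> ?a (G \<mu>)) (0, X))"
      using b_smooth[OF P_diff_fun smooth_on_slow[OF smooth_H]] by (intro mod.fibre_mean_sum) simp_all
    finally show "fibre_mean ?r (0, X) = 0"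
      using momenta[OF K, of v X]
      by (simp only: mean_b[OF P_diff_fun smooth_H] mean_b[OF P_H_diff_fun smooth_on_const])
  qed
  finally show ?thesis
    by (simp add: vd_const)
qed

text \<open>Under the mean the linearization is the pairing with the gradient of
  \<open>P \<nu>\<close>. Skew-symmetry moves the operator onto that gradient, where it yields a
  phase shift with the frequencies of the \<nu>-th flow, and the preceding lemma applies.\<close>

lemma fibre_mean_vlin_vham_defect:
  "fibre_mean (vlin mod.X (P \<nu>) \<psi> (vham mod.X B \<psi> (D defect))) (0, X) = 0"
proof -
  obtain \<Omega> :: "real ^ 'N \<Rightarrow> real ^ 'N ^ 'm" where "\<And>p. p \<in> W \<Longrightarrow> rank (\<Omega> p) = CARD('m)"
    and \<Omega>: "\<And>p \<nu> \<theta>. p \<in> W \<Longrightarrow>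
      vham fam.X B \<phi> (grad (P \<nu>)) (\<theta>, p) = frechet_derivative \<phi> (at (\<theta>, p)) (column \<nu> (\<Omega> p), 0)"
    using frequency_matrix by blast
  obtain KB where "\<forall>j>KB. \<forall>u. B j u = 0"
    using B_order by (elim exE)
  note KB = this[rule_format]
  let ?y = "vham mod.X B \<psi> (D defect)" and ?x = "vadj mod.X (P \<nu>) \<psi> (\<lambda>_. 1)"
  have S: "smooth_on mod.S \<psi>" "smooth_on mod.S (D defect)"
    using smooth_\<psi> smooth_D[OF smooth_defect] by simp_all
  have per_vadj: "mod.fibre_periodic (vadj mod.X f \<psi> (slow h))"
    if "diff_fun f" "smooth_on UNIV h" for f :: "'n jet \<Rightarrow> real" and h
    using mod.fibre_periodic_vadj[of f \<psi> "slow h"] that S periodic_\<psi> smooth_on_slow[OF that(2)]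
      mod.fibre_periodic_base[of "\<lambda>z. h (snd z)"] by simp
  have "mod.fibre_periodic defect"
    unfolding defect_def[abs_def]
    by (intro mod.fibre_periodic_compose2[where h = "(-)"] mod.fibre_periodic_sum per_vadj P_diff_fun smooth_H
        P_H_diff_fun smooth_on_const)
  then have Dd: "mod.fibre_periodic (D defect)"
    using mod.fibre_periodic_frechet[of defect "\<lambda>_. (0, 1, 0)"] smooth_defect by simp
  have y: "smooth_on mod.S ?y" "mod.fibre_periodic ?y"
    by (rule mod.smooth_vham[where K = KB, OF B_diff_fun KB S], assumption,
        rule mod.fibre_periodic_vham[where K = KB, OF KB S(1) periodic_\<psi> S(2) Dd], assumption)
  have x: "smooth_on mod.S ?x" "mod.fibre_periodic ?x"
    using smooth_vadj_mod[OF P_diff_fun smooth_on_const] per_vadj[OF P_diff_fun smooth_on_const[of _ 1]] by simp_all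
  have "fibre_mean (vlin mod.X (P \<nu>) \<psi> ?y) (0, X) = fibre_mean (\<lambda>e. ?y e \<bullet> ?x e) (0, X)"
    using mod.fibre_mean_inner_vadj[OF P_diff_fun S(1) periodic_\<psi> y, of "(0, X)"] by (simp add: zero_prod_def)
  also have "\<dots> = - fibre_mean (\<lambda>e. vham mod.X B \<psi> ?x e \<bullet> D defect e) (0, X)"
    using mod.fibre_mean_vham_skew[OF bracket S(1) periodic_\<psi> x S(2) Dd, of "(0, X)"]
    by (simp add: zero_prod_def inner_commute)
  also have "fibre_mean (\<lambda>e. vham mod.X B \<psi> ?x e \<bullet> D defect e) (0, X)
      = fibre_mean (\<lambda>e. frechet_derivative \<psi> (at e) (column \<nu> (\<Omega> (p X)), 0) \<bullet> D defect e) (0, X)"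
    by (rule mod.fibre_mean_cong) (simp add: slice(3)[OF P_diff_fun] \<Omega>[OF p_W] frechet_\<psi>)
  finally show ?thesis
    by (simp add: fibre_mean_tangent_defect)
qed

text \<open>The exact conservation law minus the exact smeared brackets is the linearization of
  \<open>P \<nu>\<close> along the operator applied to the defect. Its \<epsilon>-derivative at 0
  has zero mean; the other side averages to the flux term minus the bracket terms.\<close>

lemma whitham_identity:
  assumes Q: "conservation_law F (P \<nu>) Q"
    and A: "\<And>\<mu>. density_bracket B (P \<nu>) (P \<mu>) (A \<mu>)" and QQ: "\<And>\<mu>. diff_fun (QQ \<mu>)"
    and A0: "\<And>\<mu> (\<phi> :: real \<Rightarrow> real ^ 'n) x. smooth_on UNIV \<phi> \<Longrightarrow> A \<mu> 0 (jet 1 \<phi> x) = dird 1 (\<lambda>y. QQ \<mu> (jet 1 \<phi> y)) x"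
  shows "line_d (\<lambda>X. average \<iota> \<Phi> Q (p X)) X = (\<Sum>\<mu>\<in>UNIV. H X $ \<mu> * line_d (\<lambda>X. average \<iota> \<Phi> (QQ \<mu>) (p X)) X
    + average \<iota> \<Phi> (A \<mu> 1) (p X) * line_d (\<lambda>X. H X $ \<mu>) X)"
proof -
  obtain KB where "\<forall>j>KB. \<forall>u. B j u = 0"
    using B_order by (elim exE)
  note KB = this[rule_format]
  have Q': "diff_fun Q"
    using Q by (simp add: conservation_law_def)
  have A': "diff_fun (A \<mu> j)" for \<mu> j
    using A by (simp add: density_bracket_def)
  have "\<exists>J. \<forall>j>J. \<forall>u. A \<mu> j u = 0" for \<mu>
    using A by (simp add: density_bracket_def)
  then obtain J where "\<forall>\<mu>. \<forall>j>J \<mu>. \<forall>u. A \<mu> j u = 0"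
    using choice[of "\<lambda>\<mu> J. \<forall>j>J. \<forall>u. A \<mu> j u = 0"] by blast
  note J = this[rule_format]
  let ?q = "\<lambda>e. Q (vjet mod.X \<psi> e)" and ?qq = "\<lambda>\<mu> e. QQ \<mu> (vjet mod.X \<psi> e)"
  let ?t = "\<lambda>\<mu> j e. A \<mu> j (vjet mod.X \<psi> e) * (vd mod.X ^^ j) (G \<mu>) e"
  have S: "smooth_on mod.S \<psi>" "smooth_on mod.S (vadj mod.X P_H \<psi> (\<lambda>_. 1))" "smooth_on mod.S (vadj mod.X (P \<mu>) \<psi> (G \<mu>))" for \<mu>
    using smooth_\<psi> smooth_vadj_mod[OF P_H_diff_fun smooth_on_const] smooth_vadj_mod[OF P_diff_fun smooth_on_slow[OF smooth_H]]
    by simp_all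
  have S': "smooth_on mod.S (\<lambda>e. \<Sum>\<mu>\<in>UNIV. vadj mod.X (P \<mu>) \<psi> (G \<mu>) e)"
    by (intro smooth_on_sum S mod.open_S)
  have vham_S: "smooth_on mod.S (vham mod.X B \<psi> \<xi>)" if "smooth_on mod.S \<xi>" for \<xi>
    by (rule mod.smooth_vham[where K = KB, OF B_diff_fun _ S(1) that]) (rule KB)
  have "vham mod.X B \<psi> defect e = vham mod.X B \<psi> (vadj mod.X P_H \<psi> (\<lambda>_. 1)) e
      - (\<Sum>\<mu>\<in>UNIV. vham mod.X B \<psi> (vadj mod.X (P \<mu>) \<psi> (G \<mu>)) e)" for e
  proof -
    have "vham mod.X B \<psi> defect e = vham mod.X B \<psi> (vadj mod.X P_H \<psi> (\<lambda>_. 1)) e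
        - vham mod.X B \<psi> (\<lambda>e. \<Sum>\<mu>\<in>UNIV. vadj mod.X (P \<mu>) \<psi> (G \<mu>) e) e"
      unfolding defect_def[abs_def] by (rule mod.vham_diff[where K = KB and B = B, OF KB S(2) S']) simp_all
    also have "vham mod.X B \<psi> (\<lambda>e. \<Sum>\<mu>\<in>UNIV. vadj mod.X (P \<mu>) \<psi> (G \<mu>) e) e
        = (\<Sum>\<mu>\<in>UNIV. vham mod.X B \<psi> (vadj mod.X (P \<mu>) \<psi> (G \<mu>)) e)"
      using mod.vham_sum[of KB B UNIV "\<lambda>\<mu>. vadj mod.X (P \<mu>) \<psi> (G \<mu>)" e \<psi> "\<lambda>_. 1", OF KB S(3)] by (simp add: mem_Times_iff)
    finally show ?thesis .
  qed
  then have vham_defect: "vham mod.X B \<psi> defect = (\<lambda>e. vham mod.X B \<psi> (vadj mod.X P_H \<psi> (\<lambda>_. 1)) e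
      - (\<Sum>\<mu>\<in>UNIV. vham mod.X B \<psi> (vadj mod.X (P \<mu>) \<psi> (G \<mu>)) e))"
    by (rule ext)
  have split: "vlin mod.X (P \<nu>) \<psi> (vham mod.X B \<psi> defect) e
      = vlin mod.X (P \<nu>) \<psi> (vham mod.X B \<psi> (vadj mod.X P_H \<psi> (\<lambda>_. 1))) e
        - (\<Sum>\<mu>\<in>UNIV. vlin mod.X (P \<nu>) \<psi> (vham mod.X B \<psi> (vadj mod.X (P \<mu>) \<psi> (G \<mu>))) e)" for e
  proof -
    let ?v = "\<lambda>\<mu>. vham mod.X B \<psi> (vadj mod.X (P \<mu>) \<psi> (G \<mu>))"
    have v: "smooth_on mod.S (?v \<mu>)" "smooth_on mod.S (\<lambda>e. \<Sum>\<mu>\<in>UNIV. ?v \<mu> e)" for \<mu>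
      by (rule vham_S[OF S(3)]) (rule smooth_on_sum[OF mod.open_S vham_S[OF S(3)]])
    have "vlin mod.X (P \<nu>) \<psi> (vham mod.X B \<psi> defect) e
        = vlin mod.X (P \<nu>) \<psi> (vham mod.X B \<psi> (vadj mod.X P_H \<psi> (\<lambda>_. 1))) e
          - vlin mod.X (P \<nu>) \<psi> (\<lambda>e. \<Sum>\<mu>\<in>UNIV. ?v \<mu> e) e"
      unfolding vham_defect by (rule mod.vlin_diff[OF P_diff_fun vham_S[OF S(2)] v(2)]) (simp add: mem_Times_iff)
    also have "vlin mod.X (P \<nu>) \<psi> (\<lambda>e. \<Sum>\<mu>\<in>UNIV. ?v \<mu> e) e = (\<Sum>\<mu>\<in>UNIV. vlin mod.X (P \<nu>) \<psi> (?v \<mu>) e)"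
      by (rule mod.vlin_sum[OF P_diff_fun v(1)]) (simp add: mem_Times_iff)
    finally show ?thesis .
  qed
  \<comment> \<open>The bound is \<open>Suc (J \<mu>)\<close> so that the terms j = 0 and j = 1,
    which are the ones that survive, are present even if \<open>J \<mu>\<close> is 0.\<close>
  have "(\<Sum>j. ?t \<mu> j e) = (\<Sum>j\<le>Suc (J \<mu>). ?t \<mu> j e)" for \<mu> e
    by (rule suminf_atMost) (simp add: J)
  then have exact: "vlin mod.X (P \<nu>) \<psi> (vham mod.X B \<psi> defect)
      = (\<lambda>e. vd mod.X ?q e - (\<Sum>\<mu>\<in>UNIV. \<Sum>j\<le>Suc (J \<mu>). ?t \<mu> j e))"
    by (intro ext) (simp only: split conservation_law_modulated[OF Q] density_bracket_modulated[OF A P_diff_fun smooth_H])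
  have q: "smooth_on UNIV ?q" "smooth_on UNIV (?qq \<mu>)" "smooth_on UNIV (vd mod.X ?q)" "smooth_on UNIV (vd mod.X (?qq \<mu>))" for \<mu>
    using smooth_vjet[OF Q'] smooth_vjet[OF QQ] smooth_vd_UNIV[OF smooth_vjet[OF Q'], of 1]
      smooth_vd_UNIV[OF smooth_vjet[OF QQ], where l = 1] by simp_all
  have t: "smooth_on UNIV (?t \<mu> j)" for \<mu> j
    by (intro smooth_on_mult smooth_vjet A' smooth_vd_UNIV smooth_on_slow smooth_H open_UNIV)
  \<comment> \<open>\<open>A 0\<close> is a total derivative, and the slow coefficient does not
    depend on \<epsilon>, so the \<epsilon>-derivative falls on the total derivative alone.\<close>
  have t0: "D (?t \<mu> 0) (\<theta>, 0, X) = H X $ \<mu> * D (vd mod.X (?qq \<mu>)) (\<theta>, 0, X)" for \<theta> \<mu>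
  proof -
    have "?t \<mu> 0 = (\<lambda>e. vd mod.X (?qq \<mu>) e * G \<mu> e)"
      by (simp add: fun_eq_iff total_derivative_modulated[OF A0 QQ])
    then show ?thesis
      using D_bilinear[OF bounded_bilinear_mult q(4)[of \<mu>] smooth_on_slow[OF smooth_H[of \<mu>]], of "(\<theta>, 0, X)"]
        D_slow[OF smooth_H]
      by simp
  qed
  have tS: "D (?t \<mu> (Suc j)) (\<theta>, 0, X) = (if j = 0 then A \<mu> 1 (vjet mod.X \<psi> (\<theta>, 0, X)) * line_d (\<lambda>X. H X $ \<mu>) X else 0)" for \<theta> \<mu> j
    using D_bilinear[OF bounded_bilinear_mult smooth_vjet[OF A'[of \<mu> "Suc j"]]
        smooth_vd_UNIV[OF smooth_on_slow[OF smooth_H[of \<mu>]], of "Suc j"], of "(\<theta>, 0, X)"]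
      vd_pow_slow_slice[OF smooth_H[of \<mu>], of j \<theta> X]
    by (simp del: funpow.simps)
  have sum_t: "(\<Sum>j\<le>Suc (J \<mu>). D (?t \<mu> j) (\<theta>, 0, X)) = H X $ \<mu> * D (vd mod.X (?qq \<mu>)) (\<theta>, 0, X)
      + line_d (\<lambda>X. H X $ \<mu>) X * A \<mu> 1 (vjet mod.X \<psi> (\<theta>, 0, X))" for \<theta> \<mu>
    unfolding sum.atMost_Suc_shift t0 tS by (simp add: sum.delta)
  let ?r = "\<lambda>\<mu> e. H X $ \<mu> * D (vd mod.X (?qq \<mu>)) e + line_d (\<lambda>X. H X $ \<mu>) X * A \<mu> 1 (vjet mod.X \<psi> e)"
  have right: "D (vlin mod.X (P \<nu>) \<psi> (vham mod.X B \<psi> defect)) (\<theta>, 0, X)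
      = D (vd mod.X ?q) (\<theta>, 0, X) - (\<Sum>\<mu>\<in>UNIV. ?r \<mu> (\<theta>, 0, X))" for \<theta>
  proof -
    have "D (\<lambda>e. vd mod.X ?q e - (\<Sum>\<mu>\<in>UNIV. \<Sum>j\<le>Suc (J \<mu>). ?t \<mu> j e)) (\<theta>, 0, X)
        = D (vd mod.X ?q) (\<theta>, 0, X) - D (\<lambda>e. \<Sum>\<mu>\<in>UNIV. \<Sum>j\<le>Suc (J \<mu>). ?t \<mu> j e) (\<theta>, 0, X)"
      by (intro D_diff q smooth_on_sum t open_UNIV)
    also have "D (\<lambda>e. \<Sum>\<mu>\<in>UNIV. \<Sum>j\<le>Suc (J \<mu>). ?t \<mu> j e) (\<theta>, 0, X)
        = (\<Sum>\<mu>\<in>UNIV. D (\<lambda>e. \<Sum>j\<le>Suc (J \<mu>). ?t \<mu> j e) (\<theta>, 0, X))"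
      by (intro D_sum smooth_on_sum t open_UNIV)
    also have "\<dots> = (\<Sum>\<mu>\<in>UNIV. \<Sum>j\<le>Suc (J \<mu>). D (?t \<mu> j) (\<theta>, 0, X))"
      by (intro sum.cong refl D_sum t)
    finally show ?thesis
      by (simp only: exact sum_t)
  qed
  have d: "smooth_on UNIV defect" and y: "smooth_on UNIV (vham mod.X B \<psi> g)" if "smooth_on UNIV g" for g
    using vham_S that smooth_defect by simp_all
  \<comment> \<open>Both the operator and the linearization act on functions that vanish at
    \<epsilon> = 0, so the \<epsilon>-derivative passes through each of them in turn down to the
    defect.\<close>
  have left: "D (vlin mod.X (P \<nu>) \<psi> (vham mod.X B \<psi> defect)) (\<theta>, 0, X)
      = vlin mod.X (P \<nu>) \<psi> (vham mod.X B \<psi> (D defect)) (\<theta>, 0, X)" for \<theta>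
  proof -
    obtain K where K: "jet_order K (P \<nu>)"
      using diff_fun_order[OF P_diff_fun] by blast
    have "D (vlin mod.X (P \<nu>) \<psi> (vham mod.X B \<psi> defect)) (\<theta>, 0, X)
        = vlin mod.X (P \<nu>) \<psi> (D (vham mod.X B \<psi> defect)) (\<theta>, 0, X)"
      by (rule D_vlin_slice[OF P_diff_fun y[OF smooth_defect] D_vham_slice(1)[OF smooth_defect defect_slice]])
    also have "\<dots> = vlin mod.X (P \<nu>) \<psi> (vham mod.X B \<psi> (D defect)) (\<theta>, 0, X)"
      unfolding vlin_eq_sum[OF K]
      by (simp only: vd_pow_slice_cong[OF smooth_D[OF y[OF smooth_defect]] y[OF smooth_D[OF smooth_defect]]
            D_vham_slice(2)[OF smooth_defect defect_slice]])
    finally show ?thesis .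
  qed
  have "0 = fibre_mean (vlin mod.X (P \<nu>) \<psi> (vham mod.X B \<psi> (D defect))) (0, X)"
    by (rule fibre_mean_vlin_vham_defect[symmetric])
  also have "\<dots> = fibre_mean (\<lambda>e. D (vd mod.X ?q) e - (\<Sum>\<mu>\<in>UNIV. ?r \<mu> e)) (0, X)"
    by (rule mod.fibre_mean_cong) (simp only: left[symmetric] right)
  also have "\<dots> = fibre_mean (D (vd mod.X ?q)) (0, X) - fibre_mean (\<lambda>e. \<Sum>\<mu>\<in>UNIV. ?r \<mu> e) (0, X)"
  proof (rule mod.fibre_mean_diff)
    show "smooth_on mod.S (D (vd mod.X ?q))"
      using smooth_D[OF q(3)] by simp
    have "smooth_on UNIV (\<lambda>e. \<Sum>\<mu>\<in>UNIV. ?r \<mu> e)"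
      by (intro smooth_on_sum smooth_on_add smooth_on_mult smooth_on_const smooth_D q smooth_vjet A' open_UNIV)
    then show "smooth_on mod.S (\<lambda>e. \<Sum>\<mu>\<in>UNIV. ?r \<mu> e)"
      by simp
  qed simp
  also have "fibre_mean (\<lambda>e. \<Sum>\<mu>\<in>UNIV. ?r \<mu> e) (0, X) = (\<Sum>\<mu>\<in>UNIV. fibre_mean (?r \<mu>) (0, X))"
  proof (rule mod.fibre_mean_sum)
    have "smooth_on UNIV (?r \<mu>)" for \<mu>
      by (intro smooth_on_add smooth_on_mult smooth_on_const smooth_D q smooth_vjet A' open_UNIV)
    then show "smooth_on mod.S (?r \<mu>)" for \<mu>
      by simp
  qed simp
  also have "\<dots> = (\<Sum>\<mu>\<in>UNIV. H X $ \<mu> * fibre_mean (D (vd mod.X (?qq \<mu>))) (0, X)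
      + line_d (\<lambda>X. H X $ \<mu>) X * fibre_mean (\<lambda>e. A \<mu> 1 (vjet mod.X \<psi> e)) (0, X))"
    using smooth_D[OF q(4)] smooth_vjet[OF A']
    by (intro sum.cong refl, subst mod.fibre_mean_add) (auto intro!: smooth_on_mult smooth_on_const simp: mod.fibre_mean_cmult)
  finally have "fibre_mean (D (vd mod.X ?q)) (0, X) = (\<Sum>\<mu>\<in>UNIV. H X $ \<mu> * fibre_mean (D (vd mod.X (?qq \<mu>))) (0, X)
      + line_d (\<lambda>X. H X $ \<mu>) X * fibre_mean (\<lambda>e. A \<mu> 1 (vjet mod.X \<psi> e)) (0, X))"
    by simp
  then show ?thesis
    by (simp only: fibre_mean_D_vd[OF q(1) periodic_vjet] fibre_mean_D_vd[OF q(2) periodic_vjet]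
        slice_mean[OF Q'] slice_mean[OF QQ] slice_mean[OF A'] mult.commute[of "line_d _ _"])
qed

end

end

section \<open>The Whitham system\<close>

lemma dird_eq_frechet:
  assumes "g differentiable (at x)"
  shows "dird v g x = frechet_derivative g (at x) v"
proof -
  have g: "(g has_derivative frechet_derivative g (at x)) (at (x + 0 *\<^sub>R v))"
    using frechet_derivative_worksI[OF assms] by simp
  have "((\<lambda>h. x + h *\<^sub>R v) has_derivative (\<lambda>h. h *\<^sub>R v)) (at 0)"
    by (auto intro!: derivative_eq_intros)
  from has_derivative_compose[OF this g]
  have "((\<lambda>h. g (x + h *\<^sub>R v)) has_vector_derivative frechet_derivative g (at x) v) (at 0)"
    by (simp add: has_vector_derivative_def linear_scale[OF linear_frechet_derivative[OF assms]])
  then show ?thesis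
    unfolding dird_def by (rule vector_derivative_at)
qed

lemma dird_pow_const_zero: "(dird v ^^ l) (\<lambda>_. 0) = (\<lambda>_. 0)"
  by (rule funpow_const_fixed) (simp add: fun_eq_iff dird_def)

lemma var_deriv_zeroth_order:
  fixes g :: "real ^ 'N::finite \<Rightarrow> real"
  assumes "\<And>y. g differentiable (at (U y))"
  shows "var_deriv \<kappa> (\<lambda>u. g (u 0)) U = (\<lambda>y. \<chi> i. frechet_derivative g (at (U y)) (axis i 1))"
proof
  fix y
  have "jet_order 0 (\<lambda>u. g (u 0))"
    by (simp add: jet_order_def)
  then have above: "pd l i (\<lambda>u. g (u 0)) u = 0" if "0 < l" for l i u
    using that by (rule pd_above_order)
  have zeroth: "pd 0 i (\<lambda>u. g (u 0)) (jet \<kappa> U y) = frechet_derivative g (at (U y)) (axis i 1)" for i y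
    using dird_eq_frechet[OF assms, of "axis i 1" y] by (simp add: pd_def dird_def jet_def)
  have "var_deriv \<kappa> (\<lambda>u. g (u 0)) U y = (\<Sum>l\<le>0. (- 1) ^ l *\<^sub>R
      (dird \<kappa> ^^ l) (\<lambda>y. \<chi> i. pd l i (\<lambda>u. g (u 0)) (jet \<kappa> U y) \<bullet> 1) y)"
    unfolding var_deriv_def lin_adj_def
    by (rule suminf_atMost) (simp add: above zero_vec_def[symmetric] dird_pow_const_zero)
  then show "var_deriv \<kappa> (\<lambda>u. g (u 0)) U y = (\<chi> i. frechet_derivative g (at (U y)) (axis i 1))"
    by (simp add: zeroth)
qed

lemma ham_op_DN_bracket:
  "ham_op \<kappa> (DN_bracket a q) U \<xi> X $ \<nu> =
    (\<Sum>\<mu>\<in>UNIV. (\<Sum>\<gamma>\<in>UNIV. dird (axis \<gamma> 1) (q \<nu> \<mu>) (U X) * dird \<kappa> U X $ \<gamma>) * \<xi> X $ \<mu>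
      + a \<nu> \<mu> (U X) * dird \<kappa> \<xi> X $ \<mu>)"
proof -
  have "ham_op \<kappa> (DN_bracket a q) U \<xi> X
      = (\<Sum>j\<le>1. DN_bracket a q j (jet \<kappa> U X) *v (dird \<kappa> ^^ j) \<xi> X)"
    unfolding ham_op_def
    by (rule suminf_atMost) (simp add: DN_bracket_def zero_vec_def[symmetric])
  then show ?thesis
    by (simp add: DN_bracket_def jet_def matrix_vector_mult_def sum.distrib)
qed

section \<open>Averages as functions of the coordinates U\<close>

context averaging
begin

abbreviation \<U> :: "(real ^ 'N) set" where "\<U> \<equiv> integral_values \<iota> \<Phi> P ` V"

abbreviation parameters :: "real ^ 'N \<Rightarrow> real ^ 'N" where
  "parameters \<equiv> inv_into V (integral_values \<iota> \<Phi> P)"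

abbreviation avg :: "('n jet \<Rightarrow> real) \<Rightarrow> real ^ 'N \<Rightarrow> real" where
  "avg \<equiv> average_U \<iota> \<Phi> P V"

lemma open_\<U>: "open \<U>" and smooth_parameters: "smooth_on \<U> parameters"
proof -
  have "det (matrix (frechet_derivative (integral_values \<iota> \<Phi> P) (at p))) \<noteq> 0" if "p \<in> V" for p
    using integrals V_W that by (auto simp: complete_hamiltonian_set_def)
  then show "open \<U>" "smooth_on \<U> parameters"
    using smooth_on_inv_into[OF open_V smooth_on_subset[OF smooth_integral_values V_W] inj_V] by blast+
qed

lemma parameters_V: "u \<in> \<U> \<Longrightarrow> parameters u \<in> V"
  by (rule inv_into_into)

lemma integral_values_parameters: "u \<in> \<U> \<Longrightarrow> integral_values \<iota> \<Phi> P (parameters u) = u"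
  by (rule f_inv_into_f)

lemma avg_integral_values: "p \<in> V \<Longrightarrow> avg f (integral_values \<iota> \<Phi> P p) = average \<iota> \<Phi> f p"
  by (simp add: average_U_def inj_V)

lemma avg_P: "u \<in> \<U> \<Longrightarrow> avg (P \<nu>) u = u $ \<nu>"
  using arg_cong[OF integral_values_parameters, of u "\<lambda>u. u $ \<nu>"]
  by (simp add: average_U_def integral_values_def)

lemma smooth_avg: "diff_fun f \<Longrightarrow> smooth_on \<U> (avg f)"
  unfolding average_U_def[abs_def]
  by (rule smooth_on_compose[OF open_\<U> open_W _ smooth_average smooth_parameters])
    (use parameters_V V_W in auto)

text \<open>This gradient plays two roles: it supplies the coefficients in the relation between the
  variational derivatives on the family, and along a profile U(X) it is the variational derivative
  of the averaged Hamiltonian.\<close>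

definition h :: "real ^ 'N \<Rightarrow> real ^ 'N" where
  "h u = (\<chi> \<mu>. frechet_derivative (avg P_H) (at u) (axis \<mu> 1))"

lemma smooth_h: "smooth_on \<U> h"
  unfolding h_def[abs_def]
  by (intro smooth_on_vec_lambda smooth_on_frechet_derivative smooth_avg P_H_diff_fun open_\<U>)

text \<open>Chain rule for the passage from the parameters to U; it is precisely the hypothesis
  under which the gradient and momentum relations were proved.\<close>

lemma frechet_average_P_H:
  assumes p: "p \<in> V"
  shows "frechet_derivative (average \<iota> \<Phi> P_H) (at p) q
    = (\<Sum>\<mu>\<in>UNIV. h (integral_values \<iota> \<Phi> P p) $ \<mu> * frechet_derivative (average \<iota> \<Phi> (P \<mu>)) (at p) q)"
proof -
  let ?U = "integral_values \<iota> \<Phi> P"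
  have pW: "p \<in> W" and pU: "?U p \<in> \<U>"
    using p V_W by auto
  have "frechet_derivative (average \<iota> \<Phi> P_H) (at p) q = frechet_derivative (\<lambda>p. avg P_H (?U p)) (at p) q"
    using frechet_derivative_transform_open[OF open_V p, of "average \<iota> \<Phi> P_H" "\<lambda>p. avg P_H (?U p)"]
    by (simp add: avg_integral_values)
  also have "\<dots> = frechet_derivative (avg P_H) (at (?U p)) (frechet_derivative ?U (at p) q)"
    by (rule frechet_derivative_chain[OF smooth_on_has_derivative[OF smooth_integral_values pW]
          smooth_on_imp_differentiable[OF smooth_avg[OF P_H_diff_fun] pU]])
  also have "\<dots> = (\<Sum>\<mu>\<in>UNIV. frechet_derivative (average \<iota> \<Phi> (P \<mu>)) (at p) q
      * frechet_derivative (avg P_H) (at (?U p)) (axis \<mu> 1))"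
    using smooth_on_frechet_linear[OF smooth_avg[OF P_H_diff_fun] pU]
    by (simp add: frechet_integral_values[OF pW] vec_lambda_sum_axis linear_sum linear_scale)
  finally show ?thesis
    by (simp add: h_def mult.commute)
qed

text \<open>Time plays no part here: for a fixed profile, \<open>whitham_identity\<close> along the
  corresponding curve of parameters is already the equality of the two right-hand sides.\<close>

lemma averaged_flow:
  fixes A :: "nat \<Rightarrow> 'N \<Rightarrow> 'N \<Rightarrow> 'n jet \<Rightarrow> real"
  assumes Q: "conservation_law F (P \<nu>) Q" and dn: "dubrovin_novikov_data B P A QQ"
    and U: "smooth_on UNIV U" "range U \<subseteq> \<U>"
  shows "((\<lambda>X. avg Q (U X)) has_real_derivative
    ham_flow 1 (DN_bracket (\<lambda>\<nu> \<mu>. avg (A 1 \<nu> \<mu>)) (\<lambda>\<nu> \<mu>. avg (QQ \<nu> \<mu>))) (\<lambda>u. avg P_H (u 0)) U X $ \<nu>) (at X)"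
proof -
  have UU: "U X \<in> \<U>" for X
    using U(2) by blast
  have Q': "diff_fun Q" and QQ: "diff_fun (QQ \<nu> \<mu>)" for \<nu> \<mu>
    using Q dn by (auto simp: conservation_law_def dubrovin_novikov_data_def)
  define p where "p = (\<lambda>X. parameters (U X))"
  have p: "smooth_on UNIV p"
    unfolding p_def by (rule smooth_on_compose[OF open_UNIV open_\<U> U(2) smooth_parameters U(1)])
  have pV: "p X \<in> V" and Up: "integral_values \<iota> \<Phi> P (p X) = U X" for X
    unfolding p_def by (rule parameters_V[OF UU], rule integral_values_parameters[OF UU])
  have avg_p: "avg f (U X) = average \<iota> \<Phi> f (p X)" for f X
    by (simp add: p_def average_U_def)
  \<comment> \<open>The modulating curve is the profile U(X) expressed in the original parameters,
    smooth because the inverse of the coordinate change is.\<close>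
  interpret modulation B F P_H \<iota> s W V \<Phi> N dN P p
    by standard (use p pV V_W in auto)
  have smooth_avg_U: "smooth_on UNIV (\<lambda>X. avg f (U X))" if "diff_fun f" for f
    by (rule smooth_on_compose[OF open_UNIV open_\<U> U(2) smooth_avg[OF that] U(1)])
  have hU: "smooth_on UNIV (\<lambda>X. h (U X))"
    by (rule smooth_on_compose[OF open_UNIV open_\<U> U(2) smooth_h U(1)])
  have "continuous_on V (\<lambda>p. h (integral_values \<iota> \<Phi> P p))"
    by (rule continuous_on_compose2[OF smooth_on_imp_continuous_on[OF smooth_h]
          continuous_on_subset[OF smooth_on_imp_continuous_on[OF smooth_integral_values] V_W]]) simp
  note relation = gradient_relation[OF frechet_average_P_H this pV, unfolded Up]
    and momenta = momentum_relation[OF frechet_average_P_H this pV, unfolded Up]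
  have "line_d (\<lambda>X. average \<iota> \<Phi> Q (p X)) X
      = (\<Sum>\<mu>\<in>UNIV. h (U X) $ \<mu> * line_d (\<lambda>X. average \<iota> \<Phi> (QQ \<nu> \<mu>) (p X)) X
        + average \<iota> \<Phi> (A 1 \<nu> \<mu>) (p X) * line_d (\<lambda>X. h (U X) $ \<mu>) X)"
    by (rule whitham_identity[OF hU relation momenta Q, where A = "\<lambda>\<mu> j. A j \<nu> \<mu>"])
      (use dn in \<open>auto simp: dubrovin_novikov_data_def\<close>)
  also have "\<dots> = ham_flow 1 (DN_bracket (\<lambda>\<nu> \<mu>. avg (A 1 \<nu> \<mu>)) (\<lambda>\<nu> \<mu>. avg (QQ \<nu> \<mu>))) (\<lambda>u. avg P_H (u 0)) U X $ \<nu>"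
  proof -
    have vd: "var_deriv 1 (\<lambda>u. avg P_H (u 0)) U = (\<lambda>X. h (U X))"
      unfolding h_def
      by (rule var_deriv_zeroth_order) (rule smooth_on_imp_differentiable[OF smooth_avg[OF P_H_diff_fun] UU])
    have d: "dird 1 g X = line_d g X" if "smooth_on UNIV g" for g :: "real \<Rightarrow> real ^ 'N" and X
      using fun_cong[OF line_dird_pow[OF that, of 1]] by simp
    have "(\<Sum>\<gamma>\<in>UNIV. dird (axis \<gamma> 1) (avg (QQ \<nu> \<mu>)) (U X) * dird 1 U X $ \<gamma>)
        = line_d (\<lambda>X. average \<iota> \<Phi> (QQ \<nu> \<mu>) (p X)) X" for \<mu>
    proof -
      note diff = smooth_on_imp_differentiable[OF smooth_avg[OF QQ[of \<nu> \<mu>]] UU[of X]]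
      note lin = linear_frechet_derivative[OF diff]
      have "line_d (\<lambda>X. avg (QQ \<nu> \<mu>) (U X)) X = frechet_derivative (avg (QQ \<nu> \<mu>)) (at (U X)) (line_d U X)"
        unfolding vd_def by (rule frechet_derivative_chain[OF smooth_on_has_derivative[OF U(1) UNIV_I] diff])
      also have "\<dots> = frechet_derivative (avg (QQ \<nu> \<mu>)) (at (U X)) (\<Sum>\<gamma>\<in>UNIV. line_d U X $ \<gamma> *\<^sub>R axis \<gamma> 1)"
        by (simp add: vec_lambda_sum_axis[symmetric])
      also have "\<dots> = (\<Sum>\<gamma>\<in>UNIV. dird (axis \<gamma> 1) (avg (QQ \<nu> \<mu>)) (U X) * dird 1 U X $ \<gamma>)"
        by (simp add: linear_sum[OF lin] linear_scale[OF lin] dird_eq_frechet[OF diff] d[OF U(1)] mult.commute)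
      finally show ?thesis
        by (simp add: avg_p)
    qed
    moreover have "dird 1 (\<lambda>X. h (U X)) X $ \<mu> = line_d (\<lambda>X. h (U X) $ \<mu>) X" for \<mu>
      using line.vd_bounded_linear[OF bounded_linear_vec_nth hU, of X \<mu>] by (simp add: d[OF hU])
    ultimately show ?thesis
      by (simp add: ham_flow_def vd ham_op_DN_bracket avg_p mult.commute)
  qed
  finally show ?thesis
    using line_d_has_vector_derivative[OF smooth_avg_U[OF Q'], of X]
    by (simp add: has_real_derivative_iff_has_vector_derivative avg_p)
qed

end

text \<open>The first conclusion compares the right-hand sides for an arbitrary profile U(X); the
  second concerns evolutions and follows by applying the first at each time T, since the averages of
  the densities \<open>P \<nu>\<close> are the coordinates of U themselves.\<close>

theorem theorem3p3:
  fixes B :: "'n::finite coeffs"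
    and F :: "'n jet \<Rightarrow> real ^ 'n"
    and P_H :: "'n jet \<Rightarrow> real"
    and \<iota> :: "('m::finite, 'N::finite) labels"
    and s :: nat
    and W V :: "(real ^ 'N) set"
    and \<Phi> :: "('m, 'N, 'n) family"
    and N :: "nat \<Rightarrow> ('m, 'n) qp_functional"
    and dN :: "nat \<Rightarrow> ('m, 'n) qp_covector"
    and P Q :: "'N \<Rightarrow> 'n jet \<Rightarrow> real"
    and A :: "nat \<Rightarrow> 'N \<Rightarrow> 'N \<Rightarrow> 'n jet \<Rightarrow> real"
    and QQ :: "'N \<Rightarrow> 'N \<Rightarrow> 'n jet \<Rightarrow> real"
  assumes "local_poisson_bracket B"
    and "hamiltonian_system B P_H F"
    and "regular_hamiltonian_family B F \<iota> s W \<Phi> N dN"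
    and "complete_hamiltonian_set B P_H \<iota> s W \<Phi> dN P"
    and "\<And>\<nu>. conservation_law F (P \<nu>) (Q \<nu>)"
    and "dubrovin_novikov_data B P A QQ"
    and "open V" and "V \<subseteq> W" and "inj_on (integral_values \<iota> \<Phi> P) V"
  shows "let
       avg = average_U \<iota> \<Phi> P V;
       DN = DN_bracket (\<lambda>\<nu> \<mu>. avg (A 1 \<nu> \<mu>)) (\<lambda>\<nu> \<mu>. avg (QQ \<nu> \<mu>));
       h_av = (\<lambda>u. avg P_H (u 0))
     in
       (\<forall>U. smooth_on UNIV U \<and> range U \<subseteq> integral_values \<iota> \<Phi> P ` V \<longrightarrow>
          (\<forall>\<nu> X. ((\<lambda>X. avg (Q \<nu>) (U X)) has_real_derivative ham_flow 1 DN h_av U X $ \<nu>) (at X))) \<and>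
       (\<forall>U. smooth_on UNIV (\<lambda>(T, X). U T X) \<and> (\<forall>T X. U T X \<in> integral_values \<iota> \<Phi> P ` V) \<longrightarrow>
          (whitham_system (\<lambda>\<nu>. avg (P \<nu>)) (\<lambda>\<nu>. avg (Q \<nu>)) U \<longleftrightarrow> hamiltonian_evolution DN h_av U))"
proof -
  interpret averaging B F P_H \<iota> s W V \<Phi> N dN P
    using assms(1-4,7-9) by unfold_locales
  note flow = averaged_flow[OF assms(5,6)]
  let ?DN = "DN_bracket (\<lambda>\<nu> \<mu>. avg (A 1 \<nu> \<mu>)) (\<lambda>\<nu> \<mu>. avg (QQ \<nu> \<mu>))" and ?h = "\<lambda>u. avg P_H (u 0)"
  have "whitham_system (\<lambda>\<nu>. avg (P \<nu>)) (\<lambda>\<nu>. avg (Q \<nu>)) U \<longleftrightarrow> hamiltonian_evolution ?DN ?h U"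
    if U: "smooth_on UNIV (\<lambda>(T, X). U T X)" "\<forall>T X. U T X \<in> \<U>" for U
  proof -
    have "smooth_on UNIV (\<lambda>X. (\<lambda>(T, X). U T X) (T, X))" for T
      by (rule smooth_on_compose[OF open_UNIV open_UNIV _ U(1)])
        (auto intro: smooth_on_Pair smooth_on_const smooth_on_ident)
    then have "smooth_on UNIV (U T)" for T
      by simp
    then have "deriv (\<lambda>X. avg (Q \<nu>) (U T X)) X = ham_flow 1 ?DN ?h (U T) X $ \<nu>" for \<nu> T X
      by (intro DERIV_imp_deriv flow) (use U(2) in auto)
    then show ?thesis
      using U(2) by (simp add: whitham_system_def hamiltonian_evolution_def avg_P)
  qed
  then show ?thesis
    unfolding Let_def using flow by blast
qed

end
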